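(* Let $n\ge 2$ and let $M$ be an $n$-dimensional non-degenerate (hence Riemannian) submanifold of the Minkowski space $\mathbb E^{n+2}_1$ lying on $\mathcal{LC}^n\times\mathbb R$, for which the function $\alpha$ of the context vanishes at no point of $M$. Then there exist an orthonormal frame field $\{e_1,e_2,\dots,e_n\}$ of the tangent bundle of $M$ and a pseudo-orthonormal frame field $\{\theta,\xi\}$ of the normal bundle of $M$ such that the following conditions hold (with $a,b\in\{2,\dots,n\}$). (a) $e_1$ and $\theta$ satisfy $\partial_{x_{n+2}}|_M=e_1-\alpha\theta$ for an $\alpha\in C^\infty(M)$. (b) The Levi-Civita connection $\nabla$ of $M$ satisfies $\nabla_{e_1}e_1=0$ and $\nabla_{e_a}e_1=\alpha e_a$. (c) With respect to $\{e_1,\dots,e_n\}$ the shape operators of $M$ have the matrix representations $$A_\theta=\begin{pmatrix}0&0&0&\cdots&0\\0&-1&0&\cdots&0\\0&0&-1&\cdots&0\\ \vdots&\vdots&\vdots&\ddots&\vdots\\0&0&0&\cdots&-1\end{pmatrix},\qquad A_\xi=\begin{pmatrix}-e_1(\alpha)-\alpha^2&-e_2(\alpha)&-e_3(\alpha)&\cdots&-e_n(\alpha)\\-e_2(\alpha)&\beta_2&0&\cdots&0\\-e_3(\alpha)&0&\beta_3&\cdots&0\\ \vdots&\vdots&\vdots&\ddots&\vdots\\-e_n(\alpha)&0&0&\cdots&\beta_n\end{pmatrix}$$ for some $\beta_2,\beta_3,\dots,\beta_n\in C^\infty(M)$. (d) The normal connection of $M$ satisfies $\nabla^\perp_{e_1}\theta=\alpha\theta$,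 $\nabla^\perp_{e_1}\xi=-\alpha\xi$, and $\nabla^\perp_X\theta=\nabla^\perp_X\xi=0$ whenever $X\in D^\perp$, where $D^\perp$ is the orthogonal complement of $D=\mathrm{span}\{e_1\}$ in $TM$. (e) The second fundamental form of $M$ satisfies $h(e_1,e_1)=(e_1(\alpha)+\alpha^2)\theta$, $h(e_1,e_a)=e_a(\alpha)\theta$, $h(e_a,e_a)=-\beta_a\theta+\xi$, and $h(e_a,e_b)=0$ for $a\ne b$.
   Context: $\mathbb E^{m}_1$ is $\mathbb R^m$ with the metric $\langle\cdot,\cdot\rangle=-dx_1^2+\sum_{i=2}^m dx_i^2$. A vector $v$ is light-like if $\langle v,v\rangle=0$ and $v\neq0$. The hypersurface $\mathcal{LC}^n\times\mathbb R\subset\mathbb E^{n+2}_1$ is $\{x: -x_1^2+x_2^2+\cdots+x_{n+1}^2=0,\ x_1>0\}$. For a Riemannian submanifold $M$, $h$ is the second fundamental form, $A$ the shape operator and $\nabla^\perp$ the normal connection: $\widetilde\nabla_XY=\nabla_XY+h(X,Y)$ and $\widetilde\nabla_X\zeta=-A_\zeta X+\nabla^\perp_X\zeta$, where $\widetilde\nabla$ is the flat connection of $\mathbb E^{n+2}_1$. A frame field $\{\theta,\xi\}$ of $T^\perp M$ is pseudo-orthonormal if $\theta,\xi$ are light-like, future-pointing ($\langle\cdot,\partial_{x_1}\rangle<0$) and $\langle\theta,\xi\rangle=-1$. The function $\alpha$ of $M$: let $\phi=(\phi_1,\dots,\phi_{n+2})$ be the position vector of $M$; the vector field $(\phi_1,\dots,\phi_{n+1},0)$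 along $M$ is a light-like normal vector field, taken as $\theta$; with $(\partial_{x_{n+2}})^T$ the tangential part of $\partial_{x_{n+2}}|_M$, the function $\alpha$ is defined by $\nabla^\perp_{(\partial_{x_{n+2}})^T}\theta=\alpha\theta$.
   Formalization: For n≥3 smooth e_a, β_a (a≥2) need not exist. Shown: e_1, θ, ξ, α smooth on M and (a)–(e) at every point, e_a, β_a pointwise; where the number of distinct β_a is locally constant (open, dense), β_a are smooth and smooth local frames exist. For n=2 all is smooth and global. *)

theory Defs
  imports "HOL-Analysis.Analysis"
begin

section \<open>Smooth maps between Euclidean spaces\<close>

text \<open>Both notions are meant for open \<^term>\<open>S\<close>.\<close>

primrec C_k_on :: "nat \<Rightarrow> 'a::euclidean_space set \<Rightarrow> ('a \<Rightarrow> 'b::real_normed_vector) \<Rightarrow> bool" where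
  "C_k_on 0 S f \<longleftrightarrow> continuous_on S f"
| "C_k_on (Suc k) S f \<longleftrightarrow>
     (\<forall>x\<in>S. f differentiable (at x)) \<and> (\<forall>v. C_k_on k S (\<lambda>x. frechet_derivative f (at x) v))"

definition smooth_on :: "'a::euclidean_space set \<Rightarrow> ('a \<Rightarrow> 'b::real_normed_vector) \<Rightarrow> bool" where
  "smooth_on S f \<longleftrightarrow> (\<forall>k. C_k_on k S f)"

section \<open>Minkowski space\<close>

text \<open>With \<open>n = CARD('n)\<close>, a point of the (n+2)-dimensional Minkowski space is written \<open>(t, y, z)\<close>:
  \<open>t\<close> is the coordinate \<open>x\<^sub>1\<close>, \<open>y\<close> collects \<open>x\<^sub>2, \<dots>, x\<^sub>n\<^sub>+\<^sub>1\<close>, and \<open>z\<close> is the coordinate \<open>x\<^sub>n\<^sub>+\<^sub>2\<close>.\<close>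

type_synonym 'n mink = "real \<times> (real ^ 'n) \<times> real"

definition lorentz :: "'n::finite mink \<Rightarrow> 'n mink \<Rightarrow> real" where
  "lorentz v w = - (fst v * fst w)
     + (\<Sum>i\<in>UNIV. (fst (snd v) $ i) * (fst (snd w) $ i)) + snd (snd v) * snd (snd w)"

definition d_first :: "'n::finite mink" where
  "d_first = (1, 0, 0)"

definition d_last :: "'n::finite mink" where
  "d_last = (0, 0, 1)"

definition light_like :: "'n::finite mink \<Rightarrow> bool" where
  "light_like v \<longleftrightarrow> lorentz v v = 0 \<and> v \<noteq> 0"

definition future_pointing :: "'n::finite mink \<Rightarrow> bool" where
  "future_pointing v \<longleftrightarrow> lorentz v d_first < 0"

definition LC_times_R :: "'n::finite mink set" where
  "LC_times_R = {(t, y, z). - (t\<^sup>2) + (\<Sum>i\<in>UNIV. (y $ i)\<^sup>2) = 0 \<and> t > 0}"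

section \<open>Immersed submanifolds of dimension n\<close>

text \<open>A submanifold is a topological space \<open>X\<close> with a position vector \<open>\<phi>\<close>. The smooth structure
  is the one induced by \<open>\<phi>\<close>: its local parametrizations are the homeomorphisms \<open>\<psi>\<close> from an open
  subset of n-space onto an open subset of \<open>X\<close> for which \<open>\<phi> \<circ> \<psi>\<close> is a smooth immersion (two such
  maps automatically differ by a diffeomorphism). Embedded submanifolds are the case
  \<open>X = top_of_set M\<close>, \<open>\<phi> = id\<close>.\<close>

definition local_param ::
  "'p topology \<Rightarrow> ('p \<Rightarrow> 'n::finite mink) \<Rightarrow> (real ^ 'n) set \<Rightarrow> (real ^ 'n \<Rightarrow> 'p) \<Rightarrow> bool" where
  "local_param X \<phi> U \<psi> \<longleftrightarrow>
     open U \<and> openin X (\<psi> ` U) \<and>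
     homeomorphic_map (top_of_set U) (subtopology X (\<psi> ` U)) \<psi> \<and>
     smooth_on U (\<phi> \<circ> \<psi>) \<and>
     (\<forall>u\<in>U. inj (frechet_derivative (\<phi> \<circ> \<psi>) (at u)))"

definition submanifold :: "'p topology \<Rightarrow> ('p \<Rightarrow> 'n::finite mink) \<Rightarrow> bool" where
  "submanifold X \<phi> \<longleftrightarrow>
     Hausdorff_space X \<and> second_countable X \<and>
     (\<forall>p\<in>topspace X. \<exists>U \<psi>. local_param X \<phi> U \<psi> \<and> p \<in> \<psi> ` U)"

text \<open>For \<^term>\<open>W\<close> open in \<^term>\<open>X\<close>.\<close>

definition smooth_field ::
  "'p topology \<Rightarrow> ('p \<Rightarrow> 'n::finite mink) \<Rightarrow> 'p set \<Rightarrow> ('p \<Rightarrow> 'b::real_normed_vector) \<Rightarrow> bool" where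
  "smooth_field X \<phi> W f \<longleftrightarrow> (\<forall>U \<psi>. local_param X \<phi> U \<psi> \<and> \<psi> ` U \<subseteq> W \<longrightarrow> smooth_on U (f \<circ> \<psi>))"

text \<open>Tangent vectors are identified with their images under the differential of \<open>\<phi>\<close>.\<close>

definition tangent_space :: "'p topology \<Rightarrow> ('p \<Rightarrow> 'n::finite mink) \<Rightarrow> 'p \<Rightarrow> 'n mink set" where
  "tangent_space X \<phi> p =
     {v. \<exists>U \<psi> u w. local_param X \<phi> U \<psi> \<and> u \<in> U \<and> \<psi> u = p \<and> v = frechet_derivative (\<phi> \<circ> \<psi>) (at u) w}"

definition normal_space :: "'p topology \<Rightarrow> ('p \<Rightarrow> 'n::finite mink) \<Rightarrow> 'p \<Rightarrow> 'n mink set" where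
  "normal_space X \<phi> p = {w. \<forall>v\<in>tangent_space X \<phi> p. lorentz w v = 0}"

definition non_degenerate :: "'p topology \<Rightarrow> ('p \<Rightarrow> 'n::finite mink) \<Rightarrow> bool" where
  "non_degenerate X \<phi> \<longleftrightarrow>
     (\<forall>p\<in>topspace X. \<forall>v\<in>tangent_space X \<phi> p.
        (\<forall>w\<in>tangent_space X \<phi> p. lorentz v w = 0) \<longrightarrow> v = 0)"

definition tan_part :: "'p topology \<Rightarrow> ('p \<Rightarrow> 'n::finite mink) \<Rightarrow> 'p \<Rightarrow> 'n mink \<Rightarrow> 'n mink" where
  "tan_part X \<phi> p x = (THE v. v \<in> tangent_space X \<phi> p \<and> x - v \<in> normal_space X \<phi> p)"

definition nor_part :: "'p topology \<Rightarrow> ('p \<Rightarrow> 'n::finite mink) \<Rightarrow> 'p \<Rightarrow> 'n mink \<Rightarrow> 'n mink" where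
  "nor_part X \<phi> p x = x - tan_part X \<phi> p x"

section \<open>Connections, second fundamental form, shape operator\<close>

text \<open>The derivative at \<open>p\<close> of a function \<open>f\<close> on \<open>X\<close> in the direction of a tangent vector \<open>v\<close>.
  For real-valued \<open>f\<close> this is \<open>v(f)\<close>; for vector-valued \<open>f\<close> it is the flat connection along \<open>\<phi>\<close>.\<close>

definition dir_deriv ::
  "'p topology \<Rightarrow> ('p \<Rightarrow> 'n::finite mink) \<Rightarrow> ('p \<Rightarrow> 'b::real_normed_vector) \<Rightarrow> 'p \<Rightarrow> 'n mink \<Rightarrow> 'b" where
  "dir_deriv X \<phi> f p v =
     (THE d. \<exists>U \<psi> u w. local_param X \<phi> U \<psi> \<and> u \<in> U \<and> \<psi> u = p \<and>
        v = frechet_derivative (\<phi> \<circ> \<psi>) (at u) w \<and> d = frechet_derivative (f \<circ> \<psi>) (at u) w)"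

text \<open>In the next three definitions the tangent vector \<open>v\<close> at \<open>p\<close> is the direction of
  differentiation: they are the terms of the formulas of Gauss and Weingarten, for a tangent
  field \<open>Y\<close> and a normal field \<open>\<zeta>\<close>.\<close>

definition levi_civita ::
  "'p topology \<Rightarrow> ('p \<Rightarrow> 'n::finite mink) \<Rightarrow> ('p \<Rightarrow> 'n mink) \<Rightarrow> 'p \<Rightarrow> 'n mink \<Rightarrow> 'n mink" where
  "levi_civita X \<phi> Y p v = tan_part X \<phi> p (dir_deriv X \<phi> Y p v)"

definition shape_op ::
  "'p topology \<Rightarrow> ('p \<Rightarrow> 'n::finite mink) \<Rightarrow> ('p \<Rightarrow> 'n mink) \<Rightarrow> 'p \<Rightarrow> 'n mink \<Rightarrow> 'n mink" where
  "shape_op X \<phi> \<zeta> p v = - tan_part X \<phi> p (dir_deriv X \<phi> \<zeta> p v)"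

definition normal_conn ::
  "'p topology \<Rightarrow> ('p \<Rightarrow> 'n::finite mink) \<Rightarrow> ('p \<Rightarrow> 'n mink) \<Rightarrow> 'p \<Rightarrow> 'n mink \<Rightarrow> 'n mink" where
  "normal_conn X \<phi> \<zeta> p v = nor_part X \<phi> p (dir_deriv X \<phi> \<zeta> p v)"

text \<open>The second fundamental form as a tensor: \<open>h(v, w)\<close> is the normal part of the derivative along
  \<open>v\<close> of any smooth tangent field extending \<open>w\<close>.\<close>

definition second_ff ::
  "'p topology \<Rightarrow> ('p \<Rightarrow> 'n::finite mink) \<Rightarrow> 'p \<Rightarrow> 'n mink \<Rightarrow> 'n mink \<Rightarrow> 'n mink" where
  "second_ff X \<phi> p v w =
     (THE z. \<exists>W Y. openin X W \<and> p \<in> W \<and> smooth_field X \<phi> W Y \<and>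
        (\<forall>q\<in>W. Y q \<in> tangent_space X \<phi> q) \<and> Y p = w \<and>
        z = nor_part X \<phi> p (dir_deriv X \<phi> Y p v))"

section \<open>The function \<open>\<alpha>\<close>\<close>

definition cone_field :: "('p \<Rightarrow> 'n::finite mink) \<Rightarrow> 'p \<Rightarrow> 'n mink" where
  "cone_field \<phi> p = (fst (\<phi> p), fst (snd (\<phi> p)), 0)"

definition alpha :: "'p topology \<Rightarrow> ('p \<Rightarrow> 'n::finite mink) \<Rightarrow> 'p \<Rightarrow> real" where
  "alpha X \<phi> p =
     (THE a. normal_conn X \<phi> (cone_field \<phi>) p (tan_part X \<phi> p d_last) = a *\<^sub>R cone_field \<phi> p)"

section \<open>Frames\<close>

definition orthonormal_basis_of :: "'n::finite mink set \<Rightarrow> (nat \<Rightarrow> 'n mink) \<Rightarrow> bool" where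
  "orthonormal_basis_of T b \<longleftrightarrow>
     (\<forall>i\<in>{1..CARD('n)}. \<forall>j\<in>{1..CARD('n)}. lorentz (b i) (b j) = (if i = j then 1 else 0)) \<and>
     span (b ` {1..CARD('n)}) = T"

definition pseudo_orthonormal_basis_of :: "'n::finite mink set \<Rightarrow> 'n mink \<Rightarrow> 'n mink \<Rightarrow> bool" where
  "pseudo_orthonormal_basis_of N t x \<longleftrightarrow>
     light_like t \<and> light_like x \<and> future_pointing t \<and> future_pointing x \<and>
     lorentz t x = -1 \<and> span {t, x} = N"

definition has_matrix :: "('n::finite mink \<Rightarrow> 'n mink) \<Rightarrow> (nat \<Rightarrow> 'n mink) \<Rightarrow> (nat \<Rightarrow> nat \<Rightarrow> real) \<Rightarrow> bool" where
  "has_matrix L b A \<longleftrightarrow> (\<forall>j\<in>{1..CARD('n)}. L (b j) = (\<Sum>i=1..CARD('n). A i j *\<^sub>R b i))"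

text \<open>A tangent frame \<open>e\<^sub>1, \<dots>, e\<^sub>n\<close> is a map \<open>e\<close> on indices (only those in \<open>{1..n}\<close> matter),
  likewise the \<open>\<beta>\<^sub>a\<close> for \<open>a \<in> {2..n}\<close>. The five blocks after the frame conditions are (a) to (e).
  All conditions are at the single point \<open>p\<close>, and only \<open>e 1\<close>, \<open>\<theta>\<close>, \<open>\<xi>\<close> and \<open>\<alpha>\<close> are differentiated;
  smoothness is not part of the definition.\<close>

definition adapted_at ::
  "'p topology \<Rightarrow> ('p \<Rightarrow> 'n::finite mink) \<Rightarrow> (nat \<Rightarrow> 'p \<Rightarrow> 'n mink) \<Rightarrow> ('p \<Rightarrow> 'n mink) \<Rightarrow> ('p \<Rightarrow> 'n mink)
    \<Rightarrow> ('p \<Rightarrow> real) \<Rightarrow> (nat \<Rightarrow> 'p \<Rightarrow> real) \<Rightarrow> 'p \<Rightarrow> bool" where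
  "adapted_at X \<phi> e \<theta> \<xi> \<alpha> \<beta> p \<longleftrightarrow>
     orthonormal_basis_of (tangent_space X \<phi> p) (\<lambda>i. e i p) \<and>
     pseudo_orthonormal_basis_of (normal_space X \<phi> p) (\<theta> p) (\<xi> p) \<and>

     d_last = e 1 p - \<alpha> p *\<^sub>R \<theta> p \<and>

     levi_civita X \<phi> (e 1) p (e 1 p) = 0 \<and>
     (\<forall>a\<in>{2..CARD('n)}. levi_civita X \<phi> (e 1) p (e a p) = \<alpha> p *\<^sub>R e a p) \<and>

     has_matrix (shape_op X \<phi> \<theta> p) (\<lambda>i. e i p)
       (\<lambda>i j. if i = j \<and> i \<noteq> 1 then -1 else 0) \<and>
     has_matrix (shape_op X \<phi> \<xi> p) (\<lambda>i. e i p)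
       (\<lambda>i j. if i = 1 \<and> j = 1 then - dir_deriv X \<phi> \<alpha> p (e 1 p) - (\<alpha> p)\<^sup>2
              else if i = 1 then - dir_deriv X \<phi> \<alpha> p (e j p)
              else if j = 1 then - dir_deriv X \<phi> \<alpha> p (e i p)
              else if i = j then \<beta> i p
              else 0) \<and>

     normal_conn X \<phi> \<theta> p (e 1 p) = \<alpha> p *\<^sub>R \<theta> p \<and>
     normal_conn X \<phi> \<xi> p (e 1 p) = - (\<alpha> p *\<^sub>R \<xi> p) \<and>
     (\<forall>v\<in>tangent_space X \<phi> p. lorentz v (e 1 p) = 0 \<longrightarrow>
        normal_conn X \<phi> \<theta> p v = 0 \<and> normal_conn X \<phi> \<xi> p v = 0) \<and>

     second_ff X \<phi> p (e 1 p) (e 1 p) = (dir_deriv X \<phi> \<alpha> p (e 1 p) + (\<alpha> p)\<^sup>2) *\<^sub>R \<theta> p \<and>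
     (\<forall>a\<in>{2..CARD('n)}. second_ff X \<phi> p (e 1 p) (e a p) = dir_deriv X \<phi> \<alpha> p (e a p) *\<^sub>R \<theta> p) \<and>
     (\<forall>a\<in>{2..CARD('n)}. second_ff X \<phi> p (e a p) (e a p) = - (\<beta> a p *\<^sub>R \<theta> p) + \<xi> p) \<and>
     (\<forall>a\<in>{2..CARD('n)}. \<forall>b\<in>{2..CARD('n)}. a \<noteq> b \<longrightarrow> second_ff X \<phi> p (e a p) (e b p) = 0)"

text \<open>The points near which the number of distinct values among \<open>\<beta>\<^sub>2, \<dots>, \<beta>\<^sub>n\<close> is constant. Smooth
  frames diagonalizing a smooth family of symmetric operators exist locally around such points,
  but in general not around other points. For \<open>n = 2\<close> every point is of this kind.\<close>

definition constant_multiplicity_points ::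
  "'p topology \<Rightarrow> nat \<Rightarrow> (nat \<Rightarrow> 'p \<Rightarrow> real) \<Rightarrow> 'p set" where
  "constant_multiplicity_points X n \<beta> =
     {p. \<exists>W. openin X W \<and> p \<in> W \<and>
        (\<forall>q\<in>W. card ((\<lambda>a. \<beta> a q) ` {2..n}) = card ((\<lambda>a. \<beta> a p) ` {2..n}))}"

end

theory Submission
  imports Defs
begin

text \<open>Write a point of the cone times the line as \<open>(t, t s, z)\<close> with \<open>s\<close> on the unit sphere. The
  metric degenerates exactly along the rays \<open>\<theta> = (t, t s, 0)\<close>. A non-degenerate \<open>M\<close> of dimension \<open>n\<close>
  is therefore transverse to the rays, and dividing by them identifies each tangent space
  isometrically with \<open>s\<^sup>\<bottom> \<oplus> \<real> s = \<real>\<^sup>n\<close>, where \<open>s\<close> stands for the last coordinate direction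
  (\<open>tangent_lorentz\<close>, \<open>lift\<close>). This trivializes the tangent bundle of \<open>M\<close>, so that everything
  that follows is a computation with vectors and matrices on \<open>\<real>\<^sup>n\<close> depending on a point of \<open>M\<close>.

  The vector \<open>e\<^sub>1\<close> is the lift of \<open>s\<close>; it differs from the last coordinate direction \<open>\<partial>\<^sub>z\<close> by a
  multiple of \<open>\<theta>\<close>, the factor being \<open>\<alpha>\<close>. Since \<open>\<theta>\<close> is the position vector without its last component,
  \<open>D\<^sub>v \<theta> = v - \<langle>v, e\<^sub>1\<rangle> \<partial>\<^sub>z = (v - \<langle>v, e\<^sub>1\<rangle> e\<^sub>1) + \<alpha> \<langle>v, e\<^sub>1\<rangle> \<theta>\<close>. This one formula yields the shape
  operator of \<open>\<theta>\<close>, the normal connection, and, by differentiating \<open>e\<^sub>1 = \<partial>\<^sub>z + \<alpha> \<theta>\<close>, the derivative of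
  \<open>e\<^sub>1\<close>; differentiating \<open>\<langle>\<xi>, e\<^sub>1\<rangle> = 0\<close> gives the first column of the shape operator of \<open>\<xi>\<close>
  (\<open>DD_cone_lift\<close>, \<open>DD_E1_lift\<close>, \<open>xi_shape_dirn\<close>). The rest of that operator is its compression to
  \<open>e\<^sub>1\<^sup>\<bottom>\<close>, which is symmetric because second derivatives commute, and \<open>e\<^sub>2, \<dots>, e\<^sub>n\<close> are an
  orthonormal basis diagonalizing it (\<open>adapted_frame\<close>).

  What remains is the regularity of the eigenvalues \<open>\<beta>\<^sub>2 \<ge> \<dots> \<ge> \<beta>\<^sub>n\<close>. By Weyl's inequality they are
  continuous, so the number of distinct ones is lower semicontinuous, and the points where it is
  locally constant form an open dense set. There the coincidences among the eigenvalues do not change,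
  the spectral projections are polynomials in the operator whose coefficients are rational in the
  eigenvalues, and a bootstrap argument shows that eigenvalues and projections are smooth
  (\<open>C_k_on_eigenvalue\<close>). Projecting a fixed eigenbasis and orthonormalizing gives smooth local
  frames (\<open>smooth_eigenframe\<close>). For \<open>n = 2\<close> there is a global smooth frame, because \<open>s\<close> lies
  on a circle and can be turned by a right angle (\<open>frame_choice\<close>).\<close>

section \<open>Calculus of smooth maps\<close>

lemma C_k_on_cong:
  assumes "open S" "\<And>x. x \<in> S \<Longrightarrow> f x = g x"
  shows "C_k_on k S f \<longleftrightarrow> C_k_on k S g"
  using assms(2)
proof (induction k arbitrary: f g)
  case 0
  then show ?case unfolding C_k_on.simps by (intro continuous_on_cong refl)
next
  case (Suc k)
  have fr: "frechet_derivative f (at x) = frechet_derivative g (at x)"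
    and df: "f differentiable (at x) \<longleftrightarrow> g differentiable (at x)" if "x \<in> S" for x
  proof -
    have *: "(f has_derivative D) (at x) \<longleftrightarrow> (g has_derivative D) (at x)" for D
    proof
      show "(g has_derivative D) (at x)" if "(f has_derivative D) (at x)"
        by (rule has_derivative_transform_within_open[OF that assms(1) \<open>x \<in> S\<close>]) (rule Suc.prems)
      show "(f has_derivative D) (at x)" if "(g has_derivative D) (at x)"
        by (rule has_derivative_transform_within_open[OF that assms(1) \<open>x \<in> S\<close>]) (simp add: Suc.prems)
    qed
    then show "f differentiable (at x) \<longleftrightarrow> g differentiable (at x)"
      by (simp add: differentiable_def)
    show "frechet_derivative f (at x) = frechet_derivative g (at x)"
      using * by (simp add: frechet_derivative_def)
  qed
  have "C_k_on k S (\<lambda>x. frechet_derivative f (at x) v) = C_k_on k S (\<lambda>x. frechet_derivative g (at x) v)" for v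
    by (rule Suc.IH) (simp add: fr)
  then show ?case using df by auto
qed

text \<open>The recursive definition of the class speaks of the chosen derivative; this form accepts any formula
  for it.\<close>

lemma C_k_on_SucI:
  assumes "open S" "\<And>x. x \<in> S \<Longrightarrow> (f has_derivative D x) (at x)"
    and "\<And>v. C_k_on k S (\<lambda>x. D x v)"
  shows "C_k_on (Suc k) S f"
proof -
  have "frechet_derivative f (at x) = D x" if "x \<in> S" for x
    using frechet_derivative_at[OF assms(2)[OF that]] by simp
  then have "C_k_on k S (\<lambda>x. D x v) \<longleftrightarrow> C_k_on k S (\<lambda>x. frechet_derivative f (at x) v)" for v
    by (intro C_k_on_cong[OF assms(1)]) simp
  then have "C_k_on k S (\<lambda>x. frechet_derivative f (at x) v)" for v
    using assms(3) by blast
  then show ?thesis using assms(2) by (auto simp: differentiable_def)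
qed

lemma C_k_on_Suc_has_derivative:
  assumes "C_k_on (Suc k) S f" "x \<in> S"
  shows "(f has_derivative frechet_derivative f (at x)) (at x)"
  using assms frechet_derivative_works by auto

lemma C_k_on_Suc_lower: "C_k_on (Suc k) S f \<Longrightarrow> C_k_on k S f"
proof (induction k arbitrary: f)
  case 0
  then have "\<forall>x\<in>S. isCont f x" using differentiable_imp_continuous_within by auto
  then show ?case by (simp add: continuous_at_imp_continuous_on)
next
  case (Suc k)
  have "C_k_on k S (\<lambda>x. frechet_derivative f (at x) v)" for v
    using Suc.prems by (intro Suc.IH) simp
  then show ?case using Suc.prems by (subst C_k_on.simps(2)) simp
qed

lemma C_k_on_mono: "C_k_on k S f \<Longrightarrow> T \<subseteq> S \<Longrightarrow> C_k_on k T f"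
proof (induction k arbitrary: f)
  case 0
  then show ?case unfolding C_k_on.simps by (rule continuous_on_subset)
next
  case (Suc k)
  have "C_k_on k T (\<lambda>x. frechet_derivative f (at x) v)" for v
    using Suc.prems by (intro Suc.IH) auto
  then show ?case using Suc.prems by auto
qed

lemma C_k_on_local:
  assumes "\<And>x. x \<in> S \<Longrightarrow> \<exists>T. open T \<and> x \<in> T \<and> C_k_on k T f"
  shows "C_k_on k S f"
  using assms
proof (induction k arbitrary: f)
  case 0
  show ?case
    unfolding C_k_on.simps
  proof (rule continuous_at_imp_continuous_on, rule ballI)
    fix x assume "x \<in> S"
    then obtain T where "open T" "x \<in> T" "continuous_on T f" using 0 by auto
    then show "isCont f x" using continuous_on_eq_continuous_at by blast
  qed
next
  case (Suc k)
  show ?case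
    unfolding C_k_on.simps
  proof (intro conjI ballI allI)
    fix x assume "x \<in> S"
    then show "f differentiable at x" using Suc.prems by auto
  next
    fix v
    show "C_k_on k S (\<lambda>x. frechet_derivative f (at x) v)"
    proof (rule Suc.IH)
      fix x assume "x \<in> S"
      then show "\<exists>T. open T \<and> x \<in> T \<and> C_k_on k T (\<lambda>x. frechet_derivative f (at x) v)"
        using Suc.prems by fastforce
    qed
  qed
qed

lemma C_k_on_const: "open S \<Longrightarrow> C_k_on k S (\<lambda>x. c)"
proof (induction k arbitrary: c)
  case (Suc k)
  show ?case by (rule C_k_on_SucI[where D="\<lambda>_ _. 0"]) (use Suc in auto)
qed simp

lemma C_k_on_linear:
  assumes "bounded_linear L" "open S" "C_k_on k S f"
  shows "C_k_on k S (\<lambda>x. L (f x))"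
  using assms(3)
proof (induction k arbitrary: f)
  case 0
  then show ?case
    unfolding C_k_on.simps by (rule bounded_linear.continuous_on[OF assms(1)])
next
  case (Suc k)
  show ?case
  proof (rule C_k_on_SucI[OF assms(2)])
    show "((\<lambda>x. L (f x)) has_derivative (\<lambda>v. L (frechet_derivative f (at x) v))) (at x)"
      if "x \<in> S" for x
      by (rule bounded_linear.has_derivative[OF assms(1) C_k_on_Suc_has_derivative[OF Suc.prems that]])
    show "C_k_on k S (\<lambda>x. L (frechet_derivative f (at x) v))" for v
      using Suc.prems by (intro Suc.IH) simp
  qed
qed

lemma C_k_on_add:
  assumes "open S" "C_k_on k S f" "C_k_on k S g"
  shows "C_k_on k S (\<lambda>x. f x + g x)"
  using assms(2-)
proof (induction k arbitrary: f g)
  case 0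
  then show ?case by (simp add: continuous_on_add)
next
  case (Suc k)
  show ?case
  proof (rule C_k_on_SucI[OF assms(1)])
    show "((\<lambda>x. f x + g x) has_derivative
        (\<lambda>v. frechet_derivative f (at x) v + frechet_derivative g (at x) v)) (at x)"
      if "x \<in> S" for x
      by (rule has_derivative_add) (use Suc.prems that C_k_on_Suc_has_derivative in blast)+
    show "C_k_on k S (\<lambda>x. frechet_derivative f (at x) v + frechet_derivative g (at x) v)" for v
      using Suc.prems by (intro Suc.IH) auto
  qed
qed

lemma C_k_on_bilinear:
  assumes "bounded_bilinear B" "open S" "C_k_on k S f" "C_k_on k S g"
  shows "C_k_on k S (\<lambda>x. B (f x) (g x))"
  using assms(3-)
proof (induction k arbitrary: f g)
  case 0
  then show ?case
    unfolding C_k_on.simps by (rule bounded_bilinear.continuous_on[OF assms(1)])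
next
  case (Suc k)
  show ?case
  proof (rule C_k_on_SucI[OF assms(2)])
    show "((\<lambda>x. B (f x) (g x)) has_derivative
        (\<lambda>v. B (f x) (frechet_derivative g (at x) v) + B (frechet_derivative f (at x) v) (g x))) (at x)"
      if "x \<in> S" for x
      by (rule bounded_bilinear.FDERIV[OF assms(1)])
         (use Suc.prems that C_k_on_Suc_has_derivative in blast)+
    show "C_k_on k S (\<lambda>x. B (f x) (frechet_derivative g (at x) v) + B (frechet_derivative f (at x) v) (g x))" for v
      using Suc.prems C_k_on_Suc_lower[OF Suc.prems(1)] C_k_on_Suc_lower[OF Suc.prems(2)]
      by (intro C_k_on_add Suc.IH assms(2)) auto
  qed
qed

lemma C_k_on_sum:
  assumes "open S" "\<And>i. i \<in> I \<Longrightarrow> C_k_on k S (f i)"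
  shows "C_k_on k S (\<lambda>x. \<Sum>i\<in>I. f i x)"
  using assms(2)
  by (induction I rule: infinite_finite_induct) (auto intro!: C_k_on_const C_k_on_add assms(1))

lemma C_k_on_inverse:
  fixes f :: "'a::euclidean_space \<Rightarrow> real"
  assumes "open S" "C_k_on k S f" "\<And>x. x \<in> S \<Longrightarrow> f x \<noteq> 0"
  shows "C_k_on k S (\<lambda>x. inverse (f x))"
  using assms(2)
proof (induction k)
  case 0
  then show ?case using assms(3) by (simp add: continuous_on_inverse)
next
  case (Suc k)
  show ?case
  proof (rule C_k_on_SucI[OF assms(1)])
    show "((\<lambda>x. inverse (f x)) has_derivative
        (\<lambda>v. - (inverse (f x) * frechet_derivative f (at x) v * inverse (f x)))) (at x)"
      if "x \<in> S" for x
      by (rule Deriv.has_derivative_inverse[OF assms(3)[OF that] C_k_on_Suc_has_derivative[OF Suc.prems that]])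
    show "C_k_on k S (\<lambda>x. - (inverse (f x) * frechet_derivative f (at x) v * inverse (f x)))" for v
      using Suc.prems Suc.IH[OF C_k_on_Suc_lower[OF Suc.prems]]
      by (intro C_k_on_linear[OF bounded_linear_minus[OF bounded_linear_ident]]
          C_k_on_bilinear[OF bounded_bilinear_mult] assms(1)) auto
  qed
qed

lemma C_k_on_sqrt:
  fixes f :: "'a::euclidean_space \<Rightarrow> real"
  assumes "open S" "C_k_on k S f" "\<And>x. x \<in> S \<Longrightarrow> f x > 0"
  shows "C_k_on k S (\<lambda>x. sqrt (f x))"
  using assms(2)
proof (induction k)
  case 0
  then show ?case by (simp add: continuous_on_real_sqrt)
next
  case (Suc k)
  show ?case
  proof (rule C_k_on_SucI[OF assms(1)])
    show "((\<lambda>x. sqrt (f x)) has_derivative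
        (\<lambda>v. (inverse (sqrt (f x)) / 2) * frechet_derivative f (at x) v)) (at x)"
      if "x \<in> S" for x
      by (rule has_derivative_compose[OF C_k_on_Suc_has_derivative[OF Suc.prems that]
          DERIV_real_sqrt[OF assms(3)[OF that], unfolded has_field_derivative_def]])
    show "C_k_on k S (\<lambda>x. (inverse (sqrt (f x)) / 2) * frechet_derivative f (at x) v)" for v
      using Suc.prems Suc.IH[OF C_k_on_Suc_lower[OF Suc.prems]] assms(3)
      by (intro C_k_on_linear[OF bounded_linear_divide]
          C_k_on_bilinear[OF bounded_bilinear_mult] C_k_on_inverse assms(1)) force+
  qed
qed

lemma C_k_on_prod:
  fixes f :: "'i \<Rightarrow> 'a::euclidean_space \<Rightarrow> real"
  assumes "open S" "\<And>i. i \<in> I \<Longrightarrow> C_k_on k S (f i)"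
  shows "C_k_on k S (\<lambda>x. \<Prod>i\<in>I. f i x)"
  using assms(2)
  by (induction I rule: infinite_finite_induct)
     (auto intro!: C_k_on_const C_k_on_bilinear[OF bounded_bilinear_mult] assms(1))

lemma C_k_on_euclidean:
  fixes f :: "'a::euclidean_space \<Rightarrow> 'b::euclidean_space"
  assumes "open S" "\<And>b. b \<in> Basis \<Longrightarrow> C_k_on k S (\<lambda>x. f x \<bullet> b)"
  shows "C_k_on k S f"
proof -
  have "C_k_on k S (\<lambda>x. \<Sum>b\<in>Basis. (f x \<bullet> b) *\<^sub>R b)"
    by (intro C_k_on_sum C_k_on_linear[OF bounded_linear_scaleR_left] assms)
  then show ?thesis by (simp add: euclidean_representation)
qed

lemma C_k_on_vec:
  fixes f :: "'a::euclidean_space \<Rightarrow> real ^ 'm"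
  assumes "open S" "\<And>i. C_k_on k S (\<lambda>x. f x $ i)"
  shows "C_k_on k S f"
  by (rule C_k_on_euclidean[OF assms(1)])
     (auto simp: Basis_vec_def inner_axis assms(2))

lemma C_k_on_matrix:
  fixes f :: "'a::euclidean_space \<Rightarrow> real ^ 'm ^ 'l"
  assumes "open S" "\<And>i j. C_k_on k S (\<lambda>x. f x $ i $ j)"
  shows "C_k_on k S f"
  by (rule C_k_on_euclidean[OF assms(1)])
     (auto simp: Basis_vec_def inner_axis assms(2))

lemma bounded_linear_entry: "bounded_linear (\<lambda>A::real^'m^'l. A $ i $ j)"
  by (rule bounded_linear_compose[OF bounded_linear_vec_nth bounded_linear_vec_nth])

text \<open>By Cramer's rule the solution of a linear system is a rational function of the data.\<close>

lemma C_k_on_det: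
  fixes A :: "'a::euclidean_space \<Rightarrow> real ^ 'm ^ 'm"
  assumes "open S" "\<And>i j. C_k_on k S (\<lambda>x. A x $ i $ j)"
  shows "C_k_on k S (\<lambda>x. det (A x))"
  unfolding det_def
  by (intro C_k_on_sum C_k_on_bilinear[OF bounded_bilinear_mult] C_k_on_const C_k_on_prod assms)

lemma C_k_on_linear_solve:
  fixes A :: "'a::euclidean_space \<Rightarrow> real ^ 'm ^ 'm"
  assumes "open S" and A: "C_k_on k S A" and b: "C_k_on k S b"
    and nz: "\<And>x. x \<in> S \<Longrightarrow> det (A x) \<noteq> 0" and sol: "\<And>x. x \<in> S \<Longrightarrow> A x *v w x = b x"
  shows "C_k_on k S w"
proof -
  have A': "C_k_on k S (\<lambda>x. A x $ i $ j)" for i j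
    using C_k_on_linear[OF bounded_linear_entry assms(1) A] by simp
  have b': "C_k_on k S (\<lambda>x. b x $ i)" for i
    using C_k_on_linear[OF bounded_linear_vec_nth assms(1) b] by simp
  have "C_k_on k S (\<lambda>x. \<chi> l. det (\<chi> i j. if j = l then b x $ i else A x $ i $ j) * inverse (det (A x)))"
  proof (rule C_k_on_vec[OF assms(1)])
    fix l
    have "C_k_on k S (\<lambda>x. (\<chi> i j. if j = l then b x $ i else A x $ i $ j) $ i $ j)"
      for i j :: 'm
      using A'[of i j] b'[of i] by (cases "j = l") simp_all
    then have db: "C_k_on k S (\<lambda>x. det (\<chi> i j. if j = l then b x $ i else A x $ i $ j))"
      by (rule C_k_on_det[OF assms(1)])
    show "C_k_on k S (\<lambda>x. (\<chi> l. det (\<chi> i j. if j = l then b x $ i else A x $ i $ j) * inverse (det (A x))) $ l)"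
      unfolding vec_lambda_beta
      by (rule C_k_on_bilinear[OF bounded_bilinear_mult assms(1) db
            C_k_on_inverse[OF assms(1) C_k_on_det[OF assms(1) A'] nz]])
  qed
  moreover have "w x = (\<chi> l. det (\<chi> i j. if j = l then b x $ i else A x $ i $ j) * inverse (det (A x)))"
    if "x \<in> S" for x
    using cramer[OF nz[OF that], of "w x" "b x"] sol[OF that] by (simp add: divide_inverse)
  ultimately show ?thesis
    using C_k_on_cong[OF assms(1), of w "\<lambda>x. \<chi> l. det (\<chi> i j. if j = l then b x $ i else A x $ i $ j) * inverse (det (A x))"]
    by blast
qed

lemma linear_axis_expansion:
  fixes f :: "real ^ 'm \<Rightarrow> 'b::real_vector"
  assumes "linear f"
  shows "f x = (\<Sum>i\<in>UNIV. (x $ i) *\<^sub>R f (axis i 1))"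
proof -
  have "x = (\<Sum>i\<in>UNIV. (x $ i) *\<^sub>R axis i 1)"
    using basis_expansion[of x] by (simp add: scalar_mult_eq_scaleR)
  then have "f x = f (\<Sum>i\<in>UNIV. (x $ i) *\<^sub>R axis i 1)" by simp
  then show ?thesis by (simp add: linear_sum[OF assms] linear_scale[OF assms])
qed

lemma matrix_of_linear:
  fixes f :: "real ^ 'm \<Rightarrow> real ^ 'l"
  assumes "linear f"
  shows "matrix f *v x = f x"
  by (rule matrix_works) (use assms in \<open>simp add: linear_matrix_vector_mul_eq\<close>)

text \<open>The definition of the class has only constant directions; a smooth direction is expanded in them.\<close>

lemma C_k_on_frechet_apply:
  fixes F :: "real ^ 'm \<Rightarrow> 'b::real_normed_vector"
  assumes S: "open S" and F: "\<And>k. C_k_on k S F" and w: "\<And>k. C_k_on k S w"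
  shows "C_k_on k S (\<lambda>u. frechet_derivative F (at u) (w u))"
proof -
  have ax: "C_k_on k S (\<lambda>u. frechet_derivative F (at u) (axis i 1))" for i
    using F[of "Suc k"] by simp
  have wi: "C_k_on k S (\<lambda>u. w u $ i)" for i
    by (rule C_k_on_linear[OF bounded_linear_vec_nth S w])
  have "C_k_on k S (\<lambda>u. \<Sum>i\<in>UNIV. (w u $ i) *\<^sub>R frechet_derivative F (at u) (axis i 1))"
    by (rule C_k_on_sum[OF S C_k_on_bilinear[OF bounded_bilinear_scaleR S wi ax]])
  moreover have "frechet_derivative F (at u) (w u) = (\<Sum>i\<in>UNIV. (w u $ i) *\<^sub>R frechet_derivative F (at u) (axis i 1))"
    if "u \<in> S" for u
    by (rule linear_axis_expansion[OF has_derivative_linear[OF C_k_on_Suc_has_derivative[OF F that]]])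
  ultimately show ?thesis
    using C_k_on_cong[OF S, of "\<lambda>u. frechet_derivative F (at u) (w u)"
      "\<lambda>u. \<Sum>i\<in>UNIV. (w u $ i) *\<^sub>R frechet_derivative F (at u) (axis i 1)"] by blast
qed

text \<open>The mean value theorem, applied once in each direction, turns the second difference into an
  iterated derivative at an intermediate point. The second difference is symmetric in the two
  directions, which gives Schwarz's theorem in the limit.\<close>

lemma second_difference_mean_value:
  fixes f :: "'a::euclidean_space \<Rightarrow> real"
  assumes f: "C_k_on 2 S f" and h: "h > 0"
    and sub: "\<And>a b. a \<in> {0..h} \<Longrightarrow> b \<in> {0..h} \<Longrightarrow> u + a *\<^sub>R v + b *\<^sub>R w \<in> S"
  shows "\<exists>a\<in>{0..h}. \<exists>b\<in>{0..h}.
    f (u + h *\<^sub>R v + h *\<^sub>R w) - f (u + h *\<^sub>R v) - f (u + h *\<^sub>R w) + f u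
      = h * h * frechet_derivative (\<lambda>x. frechet_derivative f (at x) v) (at (u + a *\<^sub>R v + b *\<^sub>R w)) w"
proof -
  let ?g = "\<lambda>a. f (u + a *\<^sub>R v + h *\<^sub>R w) - f (u + a *\<^sub>R v)"
  let ?D = "\<lambda>x. frechet_derivative f (at x) v"
  have fd: "(f has_derivative frechet_derivative f (at x)) (at x)" if "x \<in> S" for x
    using f that C_k_on_Suc_has_derivative[of 1 S f x] by (simp add: numeral_2_eq_2)
  have fdd: "(?D has_derivative frechet_derivative ?D (at x)) (at x)" if "x \<in> S" for x
    using f that C_k_on_Suc_has_derivative[of 0 S ?D x] by (simp add: numeral_2_eq_2)
  have lin1: "linear (frechet_derivative f (at x))" and lin2: "linear (frechet_derivative ?D (at x))"
    if "x \<in> S" for x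
    using fd[OF that] fdd[OF that] has_derivative_linear by blast+
  have d1: "((\<lambda>a. f (u + a *\<^sub>R v + b *\<^sub>R w)) has_real_derivative ?D (u + a *\<^sub>R v + b *\<^sub>R w)) (at a)"
    if "a \<in> {0..h}" "b \<in> {0..h}" for a b
  proof -
    have "((\<lambda>a. f (u + a *\<^sub>R v + b *\<^sub>R w)) has_derivative
        (\<lambda>t. frechet_derivative f (at (u + a *\<^sub>R v + b *\<^sub>R w)) (t *\<^sub>R v))) (at a)"
      by (rule has_derivative_compose[of _ _ _ _ f])
         (auto intro!: derivative_eq_intros fd sub that)
    moreover have "(\<lambda>t. frechet_derivative f (at (u + a *\<^sub>R v + b *\<^sub>R w)) (t *\<^sub>R v))
        = (*) (?D (u + a *\<^sub>R v + b *\<^sub>R w))"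
      by (rule ext) (simp add: linear_scale[OF lin1[OF sub[OF that]]] mult.commute)
    ultimately show ?thesis by (simp add: has_field_derivative_def)
  qed
  have d2: "((\<lambda>b. ?D (u + a *\<^sub>R v + b *\<^sub>R w)) has_real_derivative
      frechet_derivative ?D (at (u + a *\<^sub>R v + b *\<^sub>R w)) w) (at b)"
    if "a \<in> {0..h}" "b \<in> {0..h}" for a b
  proof -
    have "((\<lambda>b. ?D (u + a *\<^sub>R v + b *\<^sub>R w)) has_derivative
        (\<lambda>t. frechet_derivative ?D (at (u + a *\<^sub>R v + b *\<^sub>R w)) (t *\<^sub>R w))) (at b)"
      by (rule has_derivative_compose[of _ _ _ _ ?D])
         (auto intro!: derivative_eq_intros fdd sub that)
    moreover have "(\<lambda>t. frechet_derivative ?D (at (u + a *\<^sub>R v + b *\<^sub>R w)) (t *\<^sub>R w))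
        = (*) (frechet_derivative ?D (at (u + a *\<^sub>R v + b *\<^sub>R w)) w)"
      by (rule ext) (simp add: linear_scale[OF lin2[OF sub[OF that]]] mult.commute)
    ultimately show ?thesis by (simp add: has_field_derivative_def)
  qed
  obtain a where a: "0 < a" "a < h"
    and ga: "?g h - ?g 0 = (h - 0) * (?D (u + a *\<^sub>R v + h *\<^sub>R w) - ?D (u + a *\<^sub>R v))"
  proof -
    have "(?g has_real_derivative (?D (u + a *\<^sub>R v + h *\<^sub>R w) - ?D (u + a *\<^sub>R v))) (at a)"
      if "0 \<le> a" "a \<le> h" for a
      using d1[of a h] d1[of a 0] that h by (auto intro!: DERIV_diff)
    from MVT2[OF h this] show ?thesis using that by blast
  qed
  obtain b where b: "0 < b" "b < h"
    and gb: "?D (u + a *\<^sub>R v + h *\<^sub>R w) - ?D (u + a *\<^sub>R v + 0 *\<^sub>R w)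
      = (h - 0) * frechet_derivative ?D (at (u + a *\<^sub>R v + b *\<^sub>R w)) w"
  proof -
    have "((\<lambda>b. ?D (u + a *\<^sub>R v + b *\<^sub>R w)) has_real_derivative
      frechet_derivative ?D (at (u + a *\<^sub>R v + b *\<^sub>R w)) w) (at b)" if "0 \<le> b" "b \<le> h" for b
      using d2[of a b] a that by auto
    from MVT2[OF h this] show ?thesis using that by blast
  qed
  show ?thesis
    using a b ga gb by (intro bexI[of _ a] bexI[of _ b]) (auto simp: algebra_simps)
qed

lemma mixed_derivatives_commute_real:
  fixes f :: "'a::euclidean_space \<Rightarrow> real"
  assumes S: "open S" and f: "C_k_on 2 S f" and u: "u \<in> S"
  shows "frechet_derivative (\<lambda>x. frechet_derivative f (at x) v) (at u) w
       = frechet_derivative (\<lambda>x. frechet_derivative f (at x) w) (at u) v"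
proof (rule ccontr)
  define P where "P x = frechet_derivative (\<lambda>x. frechet_derivative f (at x) v) (at x) w" for x
  define Q where "Q x = frechet_derivative (\<lambda>x. frechet_derivative f (at x) w) (at x) v" for x
  assume "\<not> ?thesis"
  then have ne: "dist (P u) (Q u) > 0" by (simp add: P_def Q_def)
  have "continuous_on S P" "continuous_on S Q"
    using f by (auto simp: numeral_2_eq_2 P_def Q_def)
  then have "isCont P u" "isCont Q u" using S u continuous_on_eq_continuous_at by blast+
  moreover have ne2: "dist (P u) (Q u) / 2 > 0" using ne by simp
  ultimately obtain d1 d2 where d1: "d1 > 0" "\<And>x. dist x u < d1 \<Longrightarrow> dist (P x) (P u) < dist (P u) (Q u) / 2"
    and d2: "d2 > 0" "\<And>x. dist x u < d2 \<Longrightarrow> dist (Q x) (Q u) < dist (P u) (Q u) / 2"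
    unfolding continuous_at_eps_delta by blast
  obtain d3 where d3: "d3 > 0" "ball u d3 \<subseteq> S" using S u open_contains_ball by blast
  define d where "d = Min {d1, d2, d3}"
  have d: "d > 0" "d \<le> d1" "d \<le> d2" "d \<le> d3" using d1 d2 d3 by (auto simp: d_def)
  define h where "h = d / (2 * (norm v + norm w + 1))"
  have den: "norm v + norm w + 1 > 0" by (simp add: add_nonneg_pos)
  have h: "h > 0" using d den by (simp add: h_def)
  have near: "dist (u + a *\<^sub>R v + b *\<^sub>R w) u < d" if "a \<in> {0..h}" "b \<in> {0..h}" for a b
  proof -
    have "dist (u + a *\<^sub>R v + b *\<^sub>R w) u = norm (a *\<^sub>R v + b *\<^sub>R w)" by (simp add: dist_norm add.assoc)
    also have "\<dots> \<le> a * norm v + b * norm w"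
      using norm_triangle_ineq[of "a *\<^sub>R v" "b *\<^sub>R w"] that by simp
    also have "\<dots> \<le> h * norm v + h * norm w"
      using that by (intro add_mono mult_right_mono) auto
    also have "\<dots> \<le> h * (norm v + norm w + 1)" using h by (simp add: algebra_simps)
    also have "\<dots> = d / 2"
    proof -
      have "d / (2 * m) * m = d / 2" if "m > 0" for m :: real using that by simp
      from this[OF den] show ?thesis by (simp only: h_def)
    qed
    also have "\<dots> < d" using d by simp
    finally show ?thesis .
  qed
  have inS: "u + a *\<^sub>R v + b *\<^sub>R w \<in> S" if "a \<in> {0..h}" "b \<in> {0..h}" for a b
    using near[OF that] d d3 by (auto simp: subset_iff dist_commute)
  obtain a b where ab: "a \<in> {0..h}" "b \<in> {0..h}"
    and eq1: "f (u + h *\<^sub>R v + h *\<^sub>R w) - f (u + h *\<^sub>R v) - f (u + h *\<^sub>R w) + f u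
      = h * h * P (u + a *\<^sub>R v + b *\<^sub>R w)"
    using second_difference_mean_value[OF f h inS] unfolding P_def by blast
  have inS': "u + a *\<^sub>R w + b *\<^sub>R v \<in> S" if "a \<in> {0..h}" "b \<in> {0..h}" for a b
    using inS[OF that(2,1)] by (simp add: algebra_simps)
  obtain a' b' where ab': "a' \<in> {0..h}" "b' \<in> {0..h}"
    and eq2: "f (u + h *\<^sub>R w + h *\<^sub>R v) - f (u + h *\<^sub>R w) - f (u + h *\<^sub>R v) + f u
      = h * h * Q (u + a' *\<^sub>R w + b' *\<^sub>R v)"
    using second_difference_mean_value[OF f h inS'] unfolding Q_def by blast
  have "h * h * P (u + a *\<^sub>R v + b *\<^sub>R w) = h * h * Q (u + b' *\<^sub>R v + a' *\<^sub>R w)"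
    using eq1 eq2 by (simp add: algebra_simps)
  then have eq: "P (u + a *\<^sub>R v + b *\<^sub>R w) = Q (u + b' *\<^sub>R v + a' *\<^sub>R w)"
    using h by simp
  have "dist (P u) (Q u) \<le> dist (P (u + a *\<^sub>R v + b *\<^sub>R w)) (P u) + dist (Q (u + b' *\<^sub>R v + a' *\<^sub>R w)) (Q u)"
    using dist_triangle[of "P u" "Q u" "Q (u + b' *\<^sub>R v + a' *\<^sub>R w)"] unfolding eq
    by (simp add: dist_commute)
  also have "\<dots> < dist (P u) (Q u) / 2 + dist (P u) (Q u) / 2"
    using near[OF ab] near[OF ab'(2,1)] d by (intro add_strict_mono d1 d2) auto
  finally show False by simp
qed

lemma mixed_derivatives_commute:
  fixes f :: "'a::euclidean_space \<Rightarrow> 'b::euclidean_space"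
  assumes S: "open S" and f: "C_k_on 2 S f" and u: "u \<in> S"
  shows "frechet_derivative (\<lambda>x. frechet_derivative f (at x) v) (at u) w
       = frechet_derivative (\<lambda>x. frechet_derivative f (at x) w) (at u) v"
proof (rule euclidean_eqI)
  fix b :: 'b assume "b \<in> Basis"
  let ?f = "\<lambda>x. f x \<bullet> b"
  have fb: "C_k_on 2 S ?f" by (rule C_k_on_linear[OF bounded_linear_inner_left S f])
  have 1: "frechet_derivative ?f (at x) v = frechet_derivative f (at x) v \<bullet> b" if "x \<in> S" for x v
  proof -
    have "(f has_derivative frechet_derivative f (at x)) (at x)"
      using f that C_k_on_Suc_has_derivative[of 1 S f x] by (simp add: numeral_2_eq_2)
    from bounded_linear.has_derivative[OF bounded_linear_inner_left this, of b]
    show ?thesis using frechet_derivative_at by metis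
  qed
  have 2: "frechet_derivative (\<lambda>x. frechet_derivative ?f (at x) v) (at u) w
     = frechet_derivative (\<lambda>x. frechet_derivative f (at x) v) (at u) w \<bullet> b" for v w
  proof -
    have "((\<lambda>x. frechet_derivative f (at x) v) has_derivative
       frechet_derivative (\<lambda>x. frechet_derivative f (at x) v) (at u)) (at u)"
      using f u C_k_on_Suc_has_derivative[of 0 S "\<lambda>x. frechet_derivative f (at x) v" u]
      by (simp add: numeral_2_eq_2)
    from bounded_linear.has_derivative[OF bounded_linear_inner_left this, of b]
    have "((\<lambda>x. frechet_derivative ?f (at x) v) has_derivative
       (\<lambda>w. frechet_derivative (\<lambda>x. frechet_derivative f (at x) v) (at u) w \<bullet> b)) (at u)"
      by (rule has_derivative_transform_within_open[OF _ S u]) (simp add: 1)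
    then show ?thesis using frechet_derivative_at by metis
  qed
  show "frechet_derivative (\<lambda>x. frechet_derivative f (at x) v) (at u) w \<bullet> b
       = frechet_derivative (\<lambda>x. frechet_derivative f (at x) w) (at u) v \<bullet> b"
    using mixed_derivatives_commute_real[OF S fb u, of v w] by (simp add: 2)
qed

section \<open>Symmetric matrices: sorted eigenvalues\<close>

definition orthonormal_on :: "'i set \<Rightarrow> ('i \<Rightarrow> 'a::real_inner) \<Rightarrow> bool" where
  "orthonormal_on I x \<longleftrightarrow> (\<forall>i\<in>I. \<forall>j\<in>I. x i \<bullet> x j = (if i = j then 1 else 0))"

lemma orthonormal_onD:
  "orthonormal_on I x \<Longrightarrow> i \<in> I \<Longrightarrow> j \<in> I \<Longrightarrow> x i \<bullet> x j = (if i = j then 1 else 0)"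
  by (simp add: orthonormal_on_def)

lemma orthonormal_on_independent:
  fixes x :: "'i \<Rightarrow> 'a::euclidean_space"
  assumes on: "orthonormal_on I x"
  shows "inj_on x I" and "independent (x ` I)"
proof -
  show inj: "inj_on x I"
  proof (rule inj_onI)
    fix i j assume ij: "i \<in> I" "j \<in> I" "x i = x j"
    then have "x i \<bullet> x j = 1" using orthonormal_onD[OF on, of i i] by simp
    then show "i = j" using orthonormal_onD[OF on ij(1,2)] by (auto split: if_splits)
  qed
  have "pairwise orthogonal (x ` I)"
    unfolding pairwise_def orthogonal_def
  proof (intro ballI impI)
    fix a b assume "a \<in> x ` I" "b \<in> x ` I" "a \<noteq> b"
    then obtain i j where "i \<in> I" "j \<in> I" "a = x i" "b = x j" by blast
    then show "a \<bullet> b = 0" using orthonormal_onD[OF on, of i j] \<open>a \<noteq> b\<close> by auto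
  qed
  moreover have "0 \<notin> x ` I"
  proof
    assume "0 \<in> x ` I"
    then obtain i where "i \<in> I" "x i = 0" by auto
    then show False using orthonormal_onD[OF on, of i i] by simp
  qed
  ultimately show "independent (x ` I)" by (rule pairwise_orthogonal_independent)
qed

lemma orthonormal_on_dim:
  fixes x :: "'i \<Rightarrow> 'a::euclidean_space"
  assumes "orthonormal_on I x"
  shows "dim (span (x ` I)) = card I"
  using orthonormal_on_independent[OF assms] by (simp add: dim_eq_card_independent card_image)

lemma orthonormal_expansion:
  fixes x :: "nat \<Rightarrow> real ^ 'n"
  assumes on: "orthonormal_on {1..CARD('n)} x"
  shows "y = (\<Sum>i=1..CARD('n). (y \<bullet> x i) *\<^sub>R x i)"
proof -
  define d where "d = y - (\<Sum>i=1..CARD('n). (y \<bullet> x i) *\<^sub>R x i)"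
  have "card (x ` {1..CARD('n)}) = CARD('n)"
    using orthonormal_on_independent(1)[OF on] by (simp add: card_image)
  then have "UNIV \<subseteq> span (x ` {1..CARD('n)})"
    using card_ge_dim_independent[of "x ` {1..CARD('n)}" UNIV] orthonormal_on_independent(2)[OF on] by simp
  moreover have "orthogonal d v" if "v \<in> x ` {1..CARD('n)}" for v
  proof -
    from that obtain j where j: "j \<in> {1..CARD('n)}" "v = x j" by blast
    have "(\<Sum>i=1..CARD('n). (y \<bullet> x i) * (x i \<bullet> x j)) = (\<Sum>i=1..CARD('n). if i = j then y \<bullet> x j else 0)"
      by (rule sum.cong) (use orthonormal_onD[OF on _ j(1)] in auto)
    also have "\<dots> = y \<bullet> x j" using j by simp
    finally show ?thesis by (simp add: orthogonal_def d_def j inner_diff_left inner_sum_left)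
  qed
  ultimately have "orthogonal d d" using orthogonal_to_span[of d "x ` {1..CARD('n)}" d] by blast
  then show ?thesis by (simp add: orthogonal_def d_def)
qed

lemma parseval:
  fixes x :: "nat \<Rightarrow> real ^ 'n"
  assumes "orthonormal_on {1..CARD('n)} x"
  shows "y \<bullet> z = (\<Sum>i=1..CARD('n). (y \<bullet> x i) * (z \<bullet> x i))"
proof -
  have "y \<bullet> z = (\<Sum>i=1..CARD('n). (y \<bullet> x i) *\<^sub>R x i) \<bullet> z"
    using orthonormal_expansion[OF assms, of y] by simp
  then show ?thesis by (simp add: inner_sum_left inner_commute[of z])
qed

lemma nonneg_quadratic_imp_linear_part_zero:
  fixes a b :: real
  assumes "\<And>t. 2 * t * a + t * t * b \<ge> 0"
  shows "a = 0"
proof (rule ccontr)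
  assume a: "a \<noteq> 0"
  define B where "B = \<bar>b\<bar> + 1"
  have B: "B > 0" "b \<le> B" by (auto simp: B_def)
  \<comment> \<open>The quadratic term has at most half the size of the linear one at this \<open>t\<close>.\<close>
  have "2 * (- a / B) * a + (- a / B) * (- a / B) * b \<ge> 0" by (rule assms)
  moreover have "(- a / B) * (- a / B) * b \<le> (- a / B) * (- a / B) * B"
    by (rule mult_left_mono[OF B(2)]) simp
  moreover have "2 * (- a / B) * a + (- a / B) * (- a / B) * B = - (a * a / B)"
    using B(1) by (simp add: field_simps)
  moreover have "a * a / B > 0" using a B(1) not_real_square_gt_zero[of a] by (intro divide_pos_pos) blast+
  ultimately show False by linarith
qed

text \<open>A maximizer of the Rayleigh quotient on the unit sphere of an invariant subspace is an
  eigenvector.\<close>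

lemma top_eigenvector:
  fixes f :: "'a::euclidean_space \<Rightarrow> 'a"
  assumes lin: "linear f" and sym: "\<And>x y. f x \<bullet> y = x \<bullet> f y"
    and V: "subspace V" "f ` V \<subseteq> V" "V \<noteq> {0}"
  obtains x l where "x \<in> V" "norm x = 1" "f x = l *\<^sub>R x" "\<And>y. y \<in> V \<Longrightarrow> f y \<bullet> y \<le> l * (y \<bullet> y)"
proof -
  let ?K = "V \<inter> sphere 0 1"
  obtain v where v: "v \<in> V" "v \<noteq> 0" using V subspace_0[OF V(1)] by blast
  have "(1 / norm v) *\<^sub>R v \<in> ?K" using v V(1) by (simp add: subspace_scale)
  then have "?K \<noteq> {}" by blast
  moreover have "compact ?K" using closed_Int_compact[OF closed_subspace[OF V(1)] compact_sphere] .
  moreover have "continuous_on ?K (\<lambda>x. f x \<bullet> x)"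
    by (intro continuous_on_inner linear_continuous_on continuous_on_id linear_conv_bounded_linear[THEN iffD1] lin)
  ultimately obtain x where x: "x \<in> ?K" and sup: "\<And>y. y \<in> ?K \<Longrightarrow> f y \<bullet> y \<le> f x \<bullet> x"
    using continuous_attains_sup[of ?K "\<lambda>x. f x \<bullet> x"] by blast
  define l where "l = f x \<bullet> x"
  have xV: "x \<in> V" and nx: "norm x = 1" using x by auto
  have le: "f y \<bullet> y \<le> l * (y \<bullet> y)" if "y \<in> V" for y
  proof (cases "y = 0")
    case True
    then show ?thesis by simp
  next
    case False
    let ?u = "(1 / norm y) *\<^sub>R y"
    have "?u \<in> ?K" using False V(1) that by (simp add: subspace_scale)
    from sup[OF this] have "f ?u \<bullet> ?u \<le> l" by (simp add: l_def)
    then have "(f y \<bullet> y) / (norm y)\<^sup>2 \<le> l" by (simp add: linear_scale[OF lin] power2_eq_square)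
    then show ?thesis using False by (simp add: power2_norm_eq_inner field_simps)
  qed
  define y where "y = l *\<^sub>R x - f x"
  have yV: "y \<in> V" using V xV by (auto simp: y_def intro!: subspace_diff subspace_scale)
  have "2 * t * (y \<bullet> y) + t * t * (l * (y \<bullet> y) - f y \<bullet> y) \<ge> 0" for t
  proof -
    have "x + t *\<^sub>R y \<in> V" using xV yV V(1) by (intro subspace_add subspace_scale)
    then have "f (x + t *\<^sub>R y) \<bullet> (x + t *\<^sub>R y) \<le> l * ((x + t *\<^sub>R y) \<bullet> (x + t *\<^sub>R y))" by (rule le)
    moreover have "f (x + t *\<^sub>R y) \<bullet> (x + t *\<^sub>R y) = l + 2 * t * (f x \<bullet> y) + t * t * (f y \<bullet> y)"
      using sym[of y x] inner_commute[of "f x" y]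
      by (simp add: linear_add[OF lin] linear_scale[OF lin] inner_add_left inner_add_right l_def algebra_simps)
    moreover have "(x + t *\<^sub>R y) \<bullet> (x + t *\<^sub>R y) = 1 + 2 * t * (x \<bullet> y) + t * t * (y \<bullet> y)"
      using nx inner_commute[of y x] dot_square_norm[of x]
      by (simp add: inner_add_left inner_add_right algebra_simps)
    ultimately have "l + 2 * t * (f x \<bullet> y) + t * t * (f y \<bullet> y)
        \<le> l * (1 + 2 * t * (x \<bullet> y) + t * t * (y \<bullet> y))" by simp
    moreover have "2 * t * (y \<bullet> y) = 2 * t * (l * (x \<bullet> y) - f x \<bullet> y)"
      by (subst (1) y_def) (simp add: inner_diff_left)
    ultimately show ?thesis by (simp add: algebra_simps)
  qed
  then have "y \<bullet> y = 0" by (rule nonneg_quadratic_imp_linear_part_zero)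
  then have "f x = l *\<^sub>R x" by (simp add: y_def)
  then show ?thesis using that xV nx le by blast
qed

text \<open>Splitting off top eigenvectors one at a time yields the eigenvalues in decreasing order.\<close>

lemma sorted_eigenbasis_subspace:
  fixes f :: "'a::euclidean_space \<Rightarrow> 'a"
  assumes lin: "linear f" and sym: "\<And>x y. f x \<bullet> y = x \<bullet> f y"
    and V: "subspace V" "f ` V \<subseteq> V" "dim V = m"
  shows "\<exists>x l. orthonormal_on {k..<k+m} x \<and> (\<forall>i\<in>{k..<k+m}. x i \<in> V \<and> f (x i) = l i *\<^sub>R x i) \<and>
    (\<forall>i\<in>{k..<k+m}. \<forall>j\<in>{k..<k+m}. i \<le> j \<longrightarrow> l j \<le> (l i :: real))"
  using V
proof (induction m arbitrary: V k)
  case 0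
  then show ?case by (simp add: orthonormal_on_def)
next
  case (Suc m)
  have "V \<noteq> {0}" using Suc.prems(3) by auto
  then obtain x0 l0 where x0: "x0 \<in> V" "norm x0 = 1" "f x0 = l0 *\<^sub>R x0"
    and le: "\<And>y. y \<in> V \<Longrightarrow> f y \<bullet> y \<le> l0 * (y \<bullet> y)"
    using top_eigenvector[OF lin sym Suc.prems(1,2)] by metis
  have x0x0: "x0 \<bullet> x0 = 1" using x0 by (simp add: dot_square_norm)
  define V' where "V' = {y \<in> V. \<forall>z\<in>span {x0}. orthogonal z y}"
  have V'D: "y \<in> V" "x0 \<bullet> y = 0" if "y \<in> V'" for y
    using that span_base[of x0 "{x0}"] by (auto simp: V'_def orthogonal_def)
  have V'I: "y \<in> V'" if "y \<in> V" "x0 \<bullet> y = 0" for y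
    using that by (auto simp: V'_def orthogonal_def span_singleton)
  have sub': "subspace V'"
  proof (rule subspaceI)
    show "0 \<in> V'" by (rule V'I) (simp_all add: subspace_0[OF Suc.prems(1)])
    show "a + b \<in> V'" if "a \<in> V'" "b \<in> V'" for a b
      using V'D[OF that(1)] V'D[OF that(2)]
      by (intro V'I) (simp_all add: inner_add_right subspace_add[OF Suc.prems(1)])
    show "c *\<^sub>R a \<in> V'" if "a \<in> V'" for a c
      using V'D[OF that] by (intro V'I) (simp_all add: subspace_scale[OF Suc.prems(1)])
  qed
  have inv': "f ` V' \<subseteq> V'"
  proof (rule image_subsetI)
    fix y assume y: "y \<in> V'"
    have "x0 \<bullet> f y = 0" using sym[of x0 y] V'D[OF y] x0(3) by simp
    then show "f y \<in> V'" using V'D(1)[OF y] Suc.prems(2) by (auto intro!: V'I)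
  qed
  have "x0 \<noteq> 0" using x0(2) by auto
  then have "dim (span {x0}) = 1" by simp
  moreover have "span {x0} \<subseteq> V" using x0(1) Suc.prems(1) by (simp add: span_minimal)
  ultimately have dim': "dim V' = m"
    using dim_subspace_orthogonal_to_vectors[of "span {x0}" V] Suc.prems by (simp add: V'_def)
  obtain x l where on: "orthonormal_on {Suc k..<Suc k+m} x"
    and xV: "\<And>i. i \<in> {Suc k..<Suc k+m} \<Longrightarrow> x i \<in> V'"
    and ev: "\<And>i. i \<in> {Suc k..<Suc k+m} \<Longrightarrow> f (x i) = l i *\<^sub>R x i"
    and srt: "\<And>i j. i \<in> {Suc k..<Suc k+m} \<Longrightarrow> j \<in> {Suc k..<Suc k+m} \<Longrightarrow> i \<le> j \<Longrightarrow> l j \<le> (l i :: real)"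
    using Suc.IH[OF sub' inv' dim', of "Suc k"] by blast
  have lle: "l i \<le> l0" if "i \<in> {Suc k..<Suc k+m}" for i
    using le[OF V'D(1)[OF xV[OF that]]] orthonormal_onD[OF on that that] ev[OF that] by simp
  have set: "{k..<k + Suc m} = insert k {Suc k..<Suc k+m}" by auto
  have notk: "i \<noteq> k" if "i \<in> {Suc k..<Suc k+m}" for i using that by auto
  have perp: "x0 \<bullet> x i = 0" "x i \<bullet> x0 = 0" if "i \<in> {Suc k..<Suc k+m}" for i
    using V'D(2)[OF xV[OF that]] by (simp_all add: inner_commute)
  show ?case
  proof (intro exI[of _ "x(k := x0)"] exI[of _ "l(k := l0)"] conjI)
    show "orthonormal_on {k..<k + Suc m} (x(k := x0))"
      unfolding orthonormal_on_def
    proof (intro ballI)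
      fix i j assume "i \<in> {k..<k + Suc m}" "j \<in> {k..<k + Suc m}"
      then consider "i = k" "j = k" | "i = k" "j \<in> {Suc k..<Suc k+m}"
        | "i \<in> {Suc k..<Suc k+m}" "j = k" | "i \<in> {Suc k..<Suc k+m}" "j \<in> {Suc k..<Suc k+m}"
        unfolding set by blast
      then show "(x(k := x0)) i \<bullet> (x(k := x0)) j = (if i = j then 1 else 0)"
      proof cases
        case 1 then show ?thesis by (simp add: x0x0)
      next
        case 2 then show ?thesis using notk[of j] perp[of j] by simp
      next
        case 3 then show ?thesis using notk[of i] perp[of i] by simp
      next
        case 4 then show ?thesis using notk[of i] notk[of j] orthonormal_onD[OF on 4] by simp
      qed
    qed
    show "\<forall>i\<in>{k..<k + Suc m}. (x(k := x0)) i \<in> V \<and> f ((x(k := x0)) i) = (l(k := l0)) i *\<^sub>R (x(k := x0)) i"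
      unfolding set using x0 xV V'D(1) ev by auto
    show "\<forall>i\<in>{k..<k + Suc m}. \<forall>j\<in>{k..<k + Suc m}. i \<le> j \<longrightarrow> (l(k := l0)) j \<le> (l(k := l0)) i"
      unfolding set using lle srt by auto
  qed
qed

definition eigenframe :: "real ^ 'n ^ 'n \<Rightarrow> (nat \<Rightarrow> real ^ 'n) \<Rightarrow> (nat \<Rightarrow> real) \<Rightarrow> bool" where
  "eigenframe A x l \<longleftrightarrow>
     orthonormal_on {1..CARD('n)} x \<and> (\<forall>i\<in>{1..CARD('n)}. A *v x i = l i *\<^sub>R x i)"

lemma eigenframe_expansion:
  fixes A :: "real ^ 'n ^ 'n"
  assumes "eigenframe A x l"
  shows "A *v y = (\<Sum>i=1..CARD('n). (l i * (y \<bullet> x i)) *\<^sub>R x i)"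
proof -
  have "A *v y = A *v (\<Sum>i=1..CARD('n). (y \<bullet> x i) *\<^sub>R x i)"
    using orthonormal_expansion[of x y] assms by (simp add: eigenframe_def)
  also have "\<dots> = (\<Sum>i=1..CARD('n). (y \<bullet> x i) *\<^sub>R (A *v x i))"
    by (simp add: linear_sum[OF matrix_vector_mul_linear] matrix_vector_mult_scaleR)
  also have "\<dots> = (\<Sum>i=1..CARD('n). (l i * (y \<bullet> x i)) *\<^sub>R x i)"
    by (rule sum.cong) (use assms in \<open>auto simp: eigenframe_def\<close>)
  finally show ?thesis .
qed

lemma eigenframe_inner:
  fixes A :: "real ^ 'n ^ 'n"
  assumes "eigenframe A x l"
  shows "(A *v y) \<bullet> z = (\<Sum>i=1..CARD('n). l i * (y \<bullet> x i) * (z \<bullet> x i))"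
  by (simp add: eigenframe_expansion[OF assms] inner_sum_left inner_commute[of z])

lemma eigenframe_symmetric:
  fixes A :: "real ^ 'n ^ 'n"
  assumes "eigenframe A x l"
  shows "(A *v y) \<bullet> z = y \<bullet> (A *v z)"
  using eigenframe_inner[OF assms, of y z] eigenframe_inner[OF assms, of z y]
  by (simp add: inner_commute mult.commute mult.left_commute)

lemma norm_matrix_vector_mult_le:
  fixes A :: "real ^ 'n ^ 'm"
  shows "norm (A *v v) \<le> norm A * norm v"
proof -
  have "norm (A *v v) = L2_set (\<lambda>i. \<bar>A $ i \<bullet> v\<bar>) UNIV"
    by (simp add: norm_vec_def matrix_vector_mult_def inner_vec_def)
  also have "\<dots> \<le> L2_set (\<lambda>i. norm (A $ i) * norm v) UNIV"
    by (rule L2_set_mono) (auto simp: Cauchy_Schwarz_ineq2)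
  also have "\<dots> = norm A * norm v"
    by (simp add: L2_set_left_distrib norm_vec_def[of A])
  finally show ?thesis .
qed

lemma bounded_bilinear_matrix_vector_mult:
  "bounded_bilinear ((*v) :: real ^ 'n ^ 'm \<Rightarrow> real ^ 'n \<Rightarrow> real ^ 'm)"
proof
  fix A B :: "real ^ 'n ^ 'm" and x y :: "real ^ 'n" and c :: real
  show "(A + B) *v x = A *v x + B *v x" by (simp add: matrix_vector_mult_add_rdistrib)
  show "A *v (x + y) = A *v x + A *v y" by (simp add: matrix_vector_right_distrib)
  show "(c *\<^sub>R A) *v x = c *\<^sub>R (A *v x)" by (simp add: scaleR_matrix_vector_assoc)
  show "A *v (c *\<^sub>R x) = c *\<^sub>R (A *v x)" by (simp add: matrix_vector_mult_scaleR)
  show "\<exists>K. \<forall>a b. norm ((a::real ^ 'n ^ 'm) *v b) \<le> norm a * norm b * K"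
    by (intro exI[of _ 1]) (simp add: norm_matrix_vector_mult_le)
qed

definition sorted_eigenframe :: "real ^ 'n ^ 'n \<Rightarrow> (nat \<Rightarrow> real ^ 'n) \<Rightarrow> (nat \<Rightarrow> real) \<Rightarrow> bool" where
  "sorted_eigenframe A x l \<longleftrightarrow>
     eigenframe A x l \<and> (\<forall>i\<in>{1..CARD('n)}. \<forall>j\<in>{1..CARD('n)}. i \<le> j \<longrightarrow> l j \<le> l i)"

text \<open>Weyl's inequality: the first \<open>k\<close> eigenvectors of \<open>A\<close> and the last \<open>n - k + 1\<close> ones of \<open>B\<close>
  span subspaces that meet for dimensional reasons; compare the two quadratic forms there.\<close>

lemma Weyl_inequality_aux:
  fixes A B :: "real ^ 'n ^ 'n"
  assumes A: "sorted_eigenframe A x l" and B: "sorted_eigenframe B y m" and k: "k \<in> {1..CARD('n)}"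
  shows "l k \<le> m k + norm (A - B)"
proof -
  have eA: "eigenframe A x l" and eB: "eigenframe B y m"
    and sA: "\<And>i j. i \<in> {1..CARD('n)} \<Longrightarrow> j \<in> {1..CARD('n)} \<Longrightarrow> i \<le> j \<Longrightarrow> l j \<le> l i"
    and sB: "\<And>i j. i \<in> {1..CARD('n)} \<Longrightarrow> j \<in> {1..CARD('n)} \<Longrightarrow> i \<le> j \<Longrightarrow> m j \<le> m i"
    using A B by (auto simp: sorted_eigenframe_def)
  have onA: "orthonormal_on {1..CARD('n)} x" and onB: "orthonormal_on {1..CARD('n)} y"
    using eA eB by (auto simp: eigenframe_def)
  let ?P = "span (x ` {1..k})" and ?Q = "span (y ` {k..CARD('n)})"
  have onP: "orthonormal_on {1..k} x" and onQ: "orthonormal_on {k..CARD('n)} y"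
    using onA onB k by (auto simp: orthonormal_on_def)
  have d1: "dim {a + b |a b. a \<in> ?P \<and> b \<in> ?Q} \<le> CARD('n)"
    using dim_subset_UNIV[of "{a + b |a b. a \<in> ?P \<and> b \<in> ?Q}"] by simp
  have d2: "dim ?P = k" "dim ?Q = CARD('n) + 1 - k"
    using orthonormal_on_dim[OF onP] orthonormal_on_dim[OF onQ] by auto
  have d3: "dim {a + b |a b. a \<in> ?P \<and> b \<in> ?Q} + dim (?P \<inter> ?Q) = dim ?P + dim ?Q"
    by (rule dim_sums_Int) (rule subspace_span)+
  have "1 \<le> k" "k \<le> CARD('n)" using k by auto
  then have "dim (?P \<inter> ?Q) \<noteq> 0" using d1 d3 unfolding d2 by arith
  then have "\<not> ?P \<inter> ?Q \<subseteq> {0}" unfolding dim_eq_0 .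
  then obtain v where v: "v \<in> ?P" "v \<in> ?Q" "v \<noteq> 0" by blast
  have vA: "v \<bullet> x i = 0" if "i \<in> {1..CARD('n)}" "k < i" for i
  proof -
    have "orthogonal (x i) v"
      by (rule orthogonal_to_span[OF v(1)])
         (use that k orthonormal_onD[OF onA] in \<open>auto simp: orthogonal_def\<close>)
    then show ?thesis by (simp add: orthogonal_def inner_commute)
  qed
  have vB: "v \<bullet> y i = 0" if "i \<in> {1..CARD('n)}" "i < k" for i
  proof -
    have "orthogonal (y i) v"
      by (rule orthogonal_to_span[OF v(2)])
         (use that k orthonormal_onD[OF onB] in \<open>auto simp: orthogonal_def\<close>)
    then show ?thesis by (simp add: orthogonal_def inner_commute)
  qed
  have "l k * (v \<bullet> v) \<le> (A *v v) \<bullet> v"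
    unfolding eigenframe_inner[OF eA] parseval[OF onA, of v v] sum_distrib_left
  proof (rule sum_mono)
    fix i assume i: "i \<in> {1..CARD('n)}"
    show "l k * (v \<bullet> x i * (v \<bullet> x i)) \<le> l i * (v \<bullet> x i) * (v \<bullet> x i)"
    proof (cases "k < i")
      case True
      then show ?thesis using vA[OF i] by simp
    next
      case False
      then have "l k \<le> l i" using sA[OF i k] by simp
      then have "l k * (v \<bullet> x i * (v \<bullet> x i)) \<le> l i * (v \<bullet> x i * (v \<bullet> x i))"
        by (rule mult_right_mono) simp
      then show ?thesis by (simp add: mult.assoc)
    qed
  qed
  also have "(A *v v) \<bullet> v = (B *v v) \<bullet> v + ((A - B) *v v) \<bullet> v"
    by (simp add: matrix_vector_mult_diff_rdistrib inner_diff_left)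
  also have "((A - B) *v v) \<bullet> v \<le> norm (A - B) * (v \<bullet> v)"
  proof -
    have "((A - B) *v v) \<bullet> v \<le> norm ((A - B) *v v) * norm v" by (rule norm_cauchy_schwarz)
    also have "\<dots> \<le> norm (A - B) * norm v * norm v"
      by (rule mult_right_mono[OF norm_matrix_vector_mult_le]) simp
    finally show ?thesis by (simp add: dot_square_norm power2_eq_square mult.assoc)
  qed
  also have "(B *v v) \<bullet> v \<le> m k * (v \<bullet> v)"
    unfolding eigenframe_inner[OF eB] parseval[OF onB, of v v] sum_distrib_left
  proof (rule sum_mono)
    fix i assume i: "i \<in> {1..CARD('n)}"
    show "m i * (v \<bullet> y i) * (v \<bullet> y i) \<le> m k * (v \<bullet> y i * (v \<bullet> y i))"
    proof (cases "i < k")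
      case True
      then show ?thesis using vB[OF i] by simp
    next
      case False
      then have "m i \<le> m k" using sB[OF k i] by simp
      then have "m i * (v \<bullet> y i * (v \<bullet> y i)) \<le> m k * (v \<bullet> y i * (v \<bullet> y i))"
        by (rule mult_right_mono) simp
      then show ?thesis by (simp add: mult.assoc)
    qed
  qed
  finally have "l k * (v \<bullet> v) \<le> (m k + norm (A - B)) * (v \<bullet> v)" by (simp add: algebra_simps)
  then show ?thesis using v(3) by (simp add: mult_le_cancel_right)
qed

lemma Weyl_inequality:
  fixes A B :: "real ^ 'n ^ 'n"
  assumes "sorted_eigenframe A x l" "sorted_eigenframe B y m" "k \<in> {1..CARD('n)}"
  shows "\<bar>l k - m k\<bar> \<le> norm (A - B)"
  using Weyl_inequality_aux[OF assms] Weyl_inequality_aux[OF assms(2,1,3)]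
  by (simp add: norm_minus_commute)

section \<open>Smoothness of eigenvalues of locally constant multiplicity\<close>

text \<open>\<open>spectral_filter A c vs\<close> is the polynomial in \<open>A\<close> that interpolates the value 1 at \<open>c\<close> and 0
  at the members of \<open>vs\<close>; if these are the remaining eigenvalues, it is the projection to the
  eigenspace of \<open>c\<close>.\<close>

definition spectral_filter :: "real ^ 'n ^ 'n \<Rightarrow> real \<Rightarrow> real list \<Rightarrow> real ^ 'n \<Rightarrow> real ^ 'n" where
  "spectral_filter A c vs y = fold (\<lambda>v y. inverse (c - v) *\<^sub>R (A *v y - v *\<^sub>R y)) vs y"

lemma spectral_filter_Nil [simp]: "spectral_filter A c [] y = y"
  by (simp add: spectral_filter_def)

lemma spectral_filter_Cons [simp]:
  "spectral_filter A c (v # vs) y = spectral_filter A c vs (inverse (c - v) *\<^sub>R (A *v y - v *\<^sub>R y))"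
  by (simp add: spectral_filter_def)

lemma linear_spectral_filter: "linear (spectral_filter A c vs)"
proof (induction vs)
  case Nil
  then show ?case by (simp add: linear_iff)
next
  case (Cons v vs)
  have "linear (\<lambda>y. inverse (c - v) *\<^sub>R (A *v y - v *\<^sub>R y))"
    by (simp add: linear_iff algebra_simps matrix_vector_right_distrib matrix_vector_mult_scaleR)
  from linear_compose[OF this Cons.IH] show ?case by (simp add: comp_def)
qed

lemma spectral_filter_eigenvector:
  assumes "A *v x = m *\<^sub>R x" "c \<notin> set vs" "m \<noteq> c \<Longrightarrow> m \<in> set vs"
  shows "spectral_filter A c vs x = (if m = c then x else 0)"
  using assms(2,3)
proof (induction vs)
  case Nil
  then show ?case by auto
next
  case (Cons v vs)
  have step: "inverse (c - v) *\<^sub>R (A *v x - v *\<^sub>R x) = (inverse (c - v) * (m - v)) *\<^sub>R x"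
    by (simp add: assms(1) algebra_simps)
  have scale: "spectral_filter A c vs (a *\<^sub>R x) = a *\<^sub>R spectral_filter A c vs x" for a
    by (rule linear_scale[OF linear_spectral_filter])
  show ?case
  proof (cases "m = v")
    case True
    then show ?thesis using Cons.prems(1) unfolding spectral_filter_Cons step
      by (simp add: linear_0[OF linear_spectral_filter])
  next
    case False
    then show ?thesis using Cons unfolding spectral_filter_Cons step scale by auto
  qed
qed

lemma spectral_filter_in_eigenspace:
  fixes A :: "real ^ 'n ^ 'n"
  assumes A: "eigenframe A x l" and c: "c \<notin> set vs"
    and vs: "\<And>i. i \<in> {1..CARD('n)} \<Longrightarrow> l i \<noteq> c \<Longrightarrow> l i \<in> set vs"
  shows "A *v spectral_filter A c vs y = c *\<^sub>R spectral_filter A c vs y"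
proof -
  have ev: "A *v x i = l i *\<^sub>R x i" if "i \<in> {1..CARD('n)}" for i
    using A that by (simp add: eigenframe_def)
  have "spectral_filter A c vs y = spectral_filter A c vs (\<Sum>i=1..CARD('n). (y \<bullet> x i) *\<^sub>R x i)"
    using orthonormal_expansion[of x y] A by (simp add: eigenframe_def)
  also have "\<dots> = (\<Sum>i=1..CARD('n). (y \<bullet> x i) *\<^sub>R spectral_filter A c vs (x i))"
    by (simp add: linear_sum[OF linear_spectral_filter] linear_scale[OF linear_spectral_filter])
  also have "\<dots> = (\<Sum>i=1..CARD('n). (y \<bullet> x i) *\<^sub>R (if l i = c then x i else 0))"
    by (rule sum.cong[OF refl]) (subst spectral_filter_eigenvector[OF ev c vs]; simp)
  finally have eq: "spectral_filter A c vs y = (\<Sum>i=1..CARD('n). (y \<bullet> x i) *\<^sub>R (if l i = c then x i else 0))" .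
  have "A *v spectral_filter A c vs y = (\<Sum>i=1..CARD('n). (y \<bullet> x i) *\<^sub>R (A *v (if l i = c then x i else 0)))"
    unfolding eq by (simp add: linear_sum[OF matrix_vector_mul_linear] matrix_vector_mult_scaleR)
  also have "\<dots> = (\<Sum>i=1..CARD('n). c *\<^sub>R ((y \<bullet> x i) *\<^sub>R (if l i = c then x i else 0)))"
    by (rule sum.cong[OF refl]) (simp add: ev)
  finally show ?thesis unfolding eq by (simp add: scaleR_sum_right)
qed

lemma C_k_on_spectral_filter:
  fixes A :: "'a::euclidean_space \<Rightarrow> real ^ 'n ^ 'n"
  assumes S: "open S" and A: "C_k_on k S A" and c: "C_k_on k S c"
    and v: "\<And>j. j \<in> set js \<Longrightarrow> C_k_on k S (\<lambda>u. v u j)"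
    and ne: "\<And>u j. u \<in> S \<Longrightarrow> j \<in> set js \<Longrightarrow> c u \<noteq> v u j"
    and y: "C_k_on k S y"
  shows "C_k_on k S (\<lambda>u. spectral_filter (A u) (c u) (map (v u) js) (y u))"
  using v ne y
proof (induction js arbitrary: y)
  case Nil
  then show ?case by simp
next
  case (Cons j js)
  have vj: "C_k_on k S (\<lambda>u. - v u j)"
    using C_k_on_linear[OF bounded_linear_minus[OF bounded_linear_ident] S] Cons.prems(1)[of j] by simp
  have cv: "C_k_on k S (\<lambda>u. c u + - v u j)" by (rule C_k_on_add[OF S c vj])
  have "C_k_on k S (\<lambda>u. inverse (c u + - v u j) *\<^sub>R (A u *v y u + (- v u j) *\<^sub>R y u))"
    by (intro C_k_on_bilinear[OF bounded_bilinear_scaleR S] C_k_on_inverse[OF S cv] C_k_on_add[OF S]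
        C_k_on_bilinear[OF bounded_bilinear_matrix_vector_mult S A] vj Cons.prems(3))
       (use Cons.prems(2)[of _ j] in auto)
  then have "C_k_on k S (\<lambda>u. inverse (c u - v u j) *\<^sub>R (A u *v y u - v u j *\<^sub>R y u))" by simp
  then show ?case unfolding list.map spectral_filter_Cons
    by (rule Cons.IH[rotated 2]) (use Cons.prems in auto)
qed

text \<open>The error \<open>B (g z) (h z - h u)\<close> is \<open>O(\<bar>z - u\<bar>) o(1)\<close>, so that continuity of the second
  factor suffices.\<close>

lemma has_derivative_vanishing_factor:
  fixes B :: "'b::real_normed_vector \<Rightarrow> 'c::real_normed_vector \<Rightarrow> 'd::real_normed_vector"
  assumes B: "bounded_bilinear B" and g: "(g has_derivative g') (at u)" "g u = 0" and h: "isCont h u"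
  shows "((\<lambda>z. B (g z) (h z)) has_derivative (\<lambda>v. B (g' v) (h u))) (at u)"
proof -
  interpret B: bounded_bilinear B by (rule B)
  obtain K where K: "K > 0" "\<And>a b. norm (B a b) \<le> norm a * norm b * K" using B.pos_bounded by blast
  interpret g': bounded_linear g' using g(1) has_derivative_bounded_linear by blast
  obtain G where G: "G > 0" "\<And>v. norm (g' v) \<le> norm v * G" using g'.pos_bounded by blast
  obtain d1 where d1: "d1 > 0" "\<And>z. norm (z - u) < d1 \<Longrightarrow> norm (g z - g u - g' (z - u)) \<le> 1 * norm (z - u)"
    using g(1) unfolding has_derivative_at_alt by (meson zero_less_one)
  have small: "norm (g z) \<le> (G + 1) * norm (z - u)" if "norm (z - u) < d1" for z
  proof -
    have "norm (g z) \<le> norm (g z - g u - g' (z - u)) + norm (g' (z - u))"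
      using norm_triangle_ineq[of "g z - g u - g' (z - u)" "g' (z - u)"] g(2) by simp
    then show ?thesis using d1(2)[OF that] G(2)[of "z - u"] by (simp add: algebra_simps)
  qed
  have "((\<lambda>z. B (g z) (h z - h u)) has_derivative (\<lambda>v. 0)) (at u)"
    unfolding has_derivative_at_alt
  proof (intro conjI allI impI)
    fix e :: real assume e: "e > 0"
    define e' where "e' = e / (K * (G + 1))"
    have e': "e' > 0" using e K G by (simp add: e'_def)
    obtain d2 where d2: "d2 > 0" "\<And>z. dist z u < d2 \<Longrightarrow> dist (h z) (h u) < e'"
      using h e' unfolding continuous_at_eps_delta by blast
    show "\<exists>d>0. \<forall>z. norm (z - u) < d \<longrightarrow>
        norm (B (g z) (h z - h u) - B (g u) (h u - h u) - 0) \<le> e * norm (z - u)"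
    proof (intro exI[of _ "min d1 d2"] conjI allI impI)
      show "min d1 d2 > 0" using d1 d2 by simp
      fix z assume z: "norm (z - u) < min d1 d2"
      have "norm (B (g z) (h z - h u)) \<le> norm (g z) * norm (h z - h u) * K" by (rule K)
      also have "\<dots> \<le> ((G + 1) * norm (z - u)) * e' * K"
        using small[of z] d2(2)[of z] z K G e'
        by (intro mult_right_mono mult_mono) (auto simp: dist_norm)
      also have "\<dots> = (e' * (K * (G + 1))) * norm (z - u)" by (simp add: mult_ac)
      also have "e' * (K * (G + 1)) = e" using K G by (simp add: e'_def)
      finally show "norm (B (g z) (h z - h u) - B (g u) (h u - h u) - 0) \<le> e * norm (z - u)"
        by (simp add: B.zero_right)
    qed
  qed simp
  moreover have "((\<lambda>z. B (g z) (h u)) has_derivative (\<lambda>v. B (g' v) (h u))) (at u)"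
    by (rule bounded_linear.has_derivative[OF B.bounded_linear_left g(1)])
  ultimately have "((\<lambda>z. B (g z) (h u) + B (g z) (h z - h u)) has_derivative (\<lambda>v. B (g' v) (h u) + 0)) (at u)"
    by (intro has_derivative_add)
  then show ?thesis by (simp add: B.diff_right)
qed

text \<open>Eigenvalues whose coincidences are constant. Along the eigenvector field \<open>y\<close> that the
  spectral filter produces from a fixed vector,
  \<open>l(z) - l(u) = y(u) \<bullet> (A(z) - A(u)) y(z) / (y(u) \<bullet> y(z))\<close>, which gives the derivative of \<open>l\<close> as soon
  as \<open>y\<close> is continuous, and shows that the derivative is as regular as \<open>y\<close>, hence as \<open>l\<close>.\<close>

lemma C_k_on_eigenvalue:
  fixes A :: "'a::euclidean_space \<Rightarrow> real ^ 'n ^ 'n" and l :: "'a \<Rightarrow> nat \<Rightarrow> real"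
  assumes S: "open S" and A: "\<And>k. C_k_on k S A"
    and ef: "\<And>u. u \<in> S \<Longrightarrow> eigenframe (A u) (x u) (l u)"
    and cont: "\<And>i. i \<in> {1..CARD('n)} \<Longrightarrow> continuous_on S (\<lambda>u. l u i)"
    and R: "\<And>u i j. u \<in> S \<Longrightarrow> i \<in> {1..CARD('n)} \<Longrightarrow> j \<in> {1..CARD('n)} \<Longrightarrow> l u i = l u j \<longleftrightarrow> R i j"
    and i: "i \<in> {1..CARD('n)}"
  shows "C_k_on k S (\<lambda>u. l u i)"
  using i
proof (induction k arbitrary: i)
  case 0
  then show ?case using cont by simp
next
  case (Suc k)
  note i = Suc.prems
  show ?case
  proof (rule C_k_on_local)
    fix u0 assume u0: "u0 \<in> S"
    \<comment> \<open>The indices of the other eigenvalues; a repeated eigenvalue gives a repeated, harmless factor of the filter.\<close>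
    define js where "js = filter (\<lambda>j. \<not> R i j) [1..<CARD('n) + 1]"
    define y where "y u = spectral_filter (A u) (l u i) (map (l u) js) (x u0 i)" for u
    have js: "j \<in> set js \<longleftrightarrow> j \<in> {1..CARD('n)} \<and> \<not> R i j" for j
      unfolding js_def set_filter set_upt by auto
    have ne: "l u i \<noteq> l u j" if "u \<in> S" "j \<in> set js" for u j
      using R[OF that(1) i, of j] that(2) js by blast
    have notin: "l u i \<notin> set (map (l u) js)" if "u \<in> S" for u
      using ne[OF that] by auto
    have rest: "l u j \<in> set (map (l u) js)" if "u \<in> S" "j \<in> {1..CARD('n)}" "l u j \<noteq> l u i" for u j
      using R[OF that(1) i that(2)] that js by auto
    have Ay: "A u *v y u = l u i *\<^sub>R y u" if "u \<in> S" for u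
      unfolding y_def by (rule spectral_filter_in_eigenspace[OF ef[OF that] notin[OF that] rest[OF that]])
    have yk: "C_k_on k' S y" if l: "\<And>j. j \<in> {1..CARD('n)} \<Longrightarrow> C_k_on k' S (\<lambda>u. l u j)" for k'
      unfolding y_def
      by (rule C_k_on_spectral_filter[OF S A l[OF i] l ne C_k_on_const[OF S]]) (simp_all add: js)
    have ycont: "continuous_on S y" using yk[of 0] cont by simp
    have y0: "y u0 = x u0 i"
    proof -
      have "A u0 *v x u0 i = l u0 i *\<^sub>R x u0 i" using ef[OF u0] i by (simp add: eigenframe_def)
      from spectral_filter_eigenvector[OF this notin[OF u0]] show ?thesis by (simp add: y_def)
    qed
    define T where "T = S \<inter> y -` (- {0})"
    have T: "open T" unfolding T_def 
      by (rule continuous_open_preimage[OF ycont S]) (rule open_Compl[OF closed_singleton])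
    have TS: "T \<subseteq> S" and yT: "\<And>u. u \<in> T \<Longrightarrow> y u \<noteq> 0" by (auto simp: T_def)
    have "x u0 i \<bullet> x u0 i = 1"
      using orthonormal_onD[of "{1..CARD('n)}" "x u0" i i] ef[OF u0] i by (simp add: eigenframe_def)
    then have u0T: "u0 \<in> T" using u0 y0 by (auto simp: T_def)
    let ?D = "\<lambda>u v. inverse (y u \<bullet> y u) * (y u \<bullet> (frechet_derivative A (at u) v *v y u))"
    have deriv: "((\<lambda>u. l u i) has_derivative ?D u) (at u)" if u: "u \<in> T" for u
    proof -
      have uS: "u \<in> S" using u TS by blast
      have yu: "y u \<bullet> y u \<noteq> 0" using yT[OF u] by simp
      have A': "((\<lambda>z. A z - A u) has_derivative frechet_derivative A (at u)) (at u)"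
        using has_derivative_diff[OF C_k_on_Suc_has_derivative[OF A uS] has_derivative_const[of "A u"]]
        by simp
      have yc: "isCont y u" using ycont uS by (simp add: continuous_on_eq_continuous_at[OF S])
      have hc: "isCont (\<lambda>z. inverse (y u \<bullet> y z) *\<^sub>R y z) u"
        using yc yu by (intro continuous_intros) auto
      have d1: "((\<lambda>z. y u \<bullet> ((A z - A u) *v (inverse (y u \<bullet> y z) *\<^sub>R y z))) has_derivative ?D u) (at u)"
        using bounded_linear.has_derivative[OF bounded_linear_inner_right[of "y u"]
            has_derivative_vanishing_factor[OF bounded_bilinear_matrix_vector_mult A' _ hc]]
        by (simp add: matrix_vector_mult_scaleR)
      have "open (S \<inter> (\<lambda>z. y u \<bullet> y z) -` (- {0}))"
        by (rule continuous_open_preimage[OF continuous_on_inner[OF continuous_on_const ycont] S])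
           (rule open_Compl[OF closed_singleton])
      moreover have "u \<in> S \<inter> (\<lambda>z. y u \<bullet> y z) -` (- {0})" using uS yu by simp
      moreover have "y u \<bullet> ((A z - A u) *v (inverse (y u \<bullet> y z) *\<^sub>R y z)) = l z i - l u i"
        if "z \<in> S \<inter> (\<lambda>z. y u \<bullet> y z) -` (- {0})" for z
      proof -
        have z: "z \<in> S" "y u \<bullet> y z \<noteq> 0" using that by auto
        have "y u \<bullet> (A u *v y z) = l u i * (y u \<bullet> y z)"
          using eigenframe_symmetric[OF ef[OF uS], of "y u" "y z"] Ay[OF uS] by simp
        then have "y u \<bullet> ((A z - A u) *v y z) = (l z i - l u i) * (y u \<bullet> y z)"
          using Ay[OF z(1)] by (simp add: matrix_vector_mult_diff_rdistrib inner_diff_right left_diff_distrib)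
        then show ?thesis using z(2) by (simp add: matrix_vector_mult_scaleR)
      qed
      ultimately have "((\<lambda>z. l z i - l u i) has_derivative ?D u) (at u)"
        by (rule has_derivative_transform_within_open[OF d1])
      from has_derivative_add[OF this has_derivative_const[of "l u i"]] show ?thesis by simp
    qed
    have yk': "C_k_on k T y" by (rule C_k_on_mono[OF yk[OF Suc.IH] TS])
    have Dk: "C_k_on k T (\<lambda>u. ?D u v)" for v
    proof -
      have A': "C_k_on k T (\<lambda>u. frechet_derivative A (at u) v)"
        by (rule C_k_on_mono[OF _ TS]) (use A[of "Suc k"] in simp)
      show ?thesis
        by (rule C_k_on_bilinear[OF bounded_bilinear_mult T
              C_k_on_inverse[OF T C_k_on_bilinear[OF bounded_bilinear_inner T yk' yk']]
              C_k_on_bilinear[OF bounded_bilinear_inner T yk'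
                C_k_on_bilinear[OF bounded_bilinear_matrix_vector_mult T A' yk']]])
           (simp_all add: yT)
    qed
    have "C_k_on (Suc k) T (\<lambda>u. l u i)" by (rule C_k_on_SucI[OF T deriv Dk])
    then show "\<exists>T. open T \<and> u0 \<in> T \<and> C_k_on (Suc k) T (\<lambda>u. l u i)" using T u0T by blast
  qed
qed

section \<open>Charts and directional derivatives\<close>

lemma smooth_on_C_k: "smooth_on S f \<Longrightarrow> C_k_on k S f"
  by (simp add: smooth_on_def)

lemma smooth_on_has_derivative:
  assumes "smooth_on S f" "u \<in> S"
  shows "(f has_derivative frechet_derivative f (at u)) (at u)"
  by (rule C_k_on_Suc_has_derivative[OF smooth_on_C_k[OF assms(1)] assms(2)])

lemma local_paramD:
  assumes "local_param X \<phi> U \<psi>"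
  shows "open U" "openin X (\<psi> ` U)" "homeomorphic_map (top_of_set U) (subtopology X (\<psi> ` U)) \<psi>"
    "smooth_on U (\<phi> \<circ> \<psi>)" "u \<in> U \<Longrightarrow> inj (frechet_derivative (\<phi> \<circ> \<psi>) (at u))"
    "inj_on \<psi> U" "u \<in> U \<Longrightarrow> \<psi> u \<in> topspace X"
proof -
  show *: "open U" "openin X (\<psi> ` U)" "homeomorphic_map (top_of_set U) (subtopology X (\<psi> ` U)) \<psi>"
    "smooth_on U (\<phi> \<circ> \<psi>)" "u \<in> U \<Longrightarrow> inj (frechet_derivative (\<phi> \<circ> \<psi>) (at u))"
    using assms by (auto simp: local_param_def)
  show "inj_on \<psi> U" using homeomorphic_imp_injective_map[OF *(3)] by simp
  show "u \<in> U \<Longrightarrow> \<psi> u \<in> topspace X" using openin_subset[OF *(2)] by blast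
qed

lemma local_param_has_derivative:
  assumes "local_param X \<phi> U \<psi>" "u \<in> U"
  shows "(\<phi> \<circ> \<psi> has_derivative frechet_derivative (\<phi> \<circ> \<psi>) (at u)) (at u)"
  by (rule smooth_on_has_derivative[OF local_paramD(4)[OF assms(1)] assms(2)])

lemma local_param_linear:
  assumes "local_param X \<phi> U \<psi>" "u \<in> U"
  shows "linear (frechet_derivative (\<phi> \<circ> \<psi>) (at u))"
  using local_param_has_derivative[OF assms] has_derivative_linear by blast

lemma chart_preimage_open:
  assumes lp: "local_param X \<phi> U \<psi>" and W: "openin X W"
  shows "open {u \<in> U. \<psi> u \<in> W}"
proof -
  have cm: "continuous_map (top_of_set U) (subtopology X (\<psi> ` U)) \<psi>"
    by (rule homeomorphic_imp_continuous_map[OF local_paramD(3)[OF lp]])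
  have "openin (subtopology X (\<psi> ` U)) (W \<inter> \<psi> ` U)"
    using W by (auto simp: openin_subtopology)
  from openin_continuous_map_preimage[OF cm this]
  have "openin (top_of_set U) {u \<in> U. \<psi> u \<in> W \<inter> \<psi> ` U}" by simp
  moreover have "{u \<in> U. \<psi> u \<in> W \<inter> \<psi> ` U} = {u \<in> U. \<psi> u \<in> W}" by blast
  ultimately show ?thesis using openin_open_trans[OF _ local_paramD(1)[OF lp]] by simp
qed

lemma chart_image_openin:
  assumes lp: "local_param X \<phi> U \<psi>" and O: "open V" "V \<subseteq> U"
  shows "openin X (\<psi> ` V)"
proof -
  have om: "open_map (top_of_set U) (subtopology X (\<psi> ` U)) \<psi>"
    by (rule homeomorphic_imp_open_map[OF local_paramD(3)[OF lp]])
  have "openin (top_of_set U) V" using O by (simp add: open_subset)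
  then have "openin (subtopology X (\<psi> ` U)) (\<psi> ` V)" using om by (simp add: open_map_def)
  then show ?thesis using openin_trans_full[OF _ local_paramD(2)[OF lp]] by blast
qed

lemma local_param_restrict:
  assumes lp: "local_param X \<phi> U \<psi>" and V: "open V" "V \<subseteq> U"
  shows "local_param X \<phi> V \<psi>"
  unfolding local_param_def
proof (intro conjI ballI)
  show "openin X (\<psi> ` V)" by (rule chart_image_openin[OF lp V])
  have eq: "\<psi> ` (topspace (top_of_set U) \<inter> V) = topspace (subtopology X (\<psi> ` U)) \<inter> \<psi> ` V"
    using V(2) openin_subset[OF local_paramD(2)[OF lp]] by (auto simp: Int_absorb1)
  have "homeomorphic_map (subtopology (top_of_set U) V) (subtopology (subtopology X (\<psi> ` U)) (\<psi> ` V)) \<psi>"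
    by (rule homeomorphic_map_subtopologies[OF local_paramD(3)[OF lp] eq])
  moreover have "U \<inter> V = V" "\<psi> ` U \<inter> \<psi> ` V = \<psi> ` V" using V(2) by auto
  ultimately show "homeomorphic_map (top_of_set V) (subtopology X (\<psi> ` V)) \<psi>"
    by (simp add: subtopology_subtopology)
  show "smooth_on V (\<phi> \<circ> \<psi>)"
    using C_k_on_mono[OF smooth_on_C_k[OF local_paramD(4)[OF lp]] V(2)] by (simp add: smooth_on_def)
  show "inj (frechet_derivative (\<phi> \<circ> \<psi>) (at u))" if "u \<in> V" for u
    using local_paramD(5)[OF lp] that V(2) by blast
qed (rule V(1))

lemma chart_inside:
  assumes "submanifold X \<phi>" and W: "openin X W" "p \<in> W"
  obtains U \<psi> u where "local_param X \<phi> U \<psi>" "\<psi> ` U \<subseteq> W" "u \<in> U" "\<psi> u = p"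
proof -
  have "p \<in> topspace X" using openin_subset[OF W(1)] W(2) by blast
  then obtain U \<psi> where lp: "local_param X \<phi> U \<psi>" "p \<in> \<psi> ` U"
    using assms(1) unfolding submanifold_def by blast
  have "local_param X \<phi> {u \<in> U. \<psi> u \<in> W} \<psi>"
    by (rule local_param_restrict[OF lp(1) chart_preimage_open[OF lp(1) W(1)]]) blast
  then show ?thesis using that[of "{u \<in> U. \<psi> u \<in> W}" \<psi>] lp(2) W(2) by blast
qed

text \<open>No inverse function theorem is involved, since the solution \<open>\<tau>\<close> of \<open>G \<circ> \<tau> = H\<close> is given:
  increments of \<open>G\<close> and of its argument agree up to a small multiple of the latter, hence so do those
  of \<open>H\<close> and \<open>\<tau>\<close>.\<close>

lemma has_derivative_implicit:
  fixes \<tau> :: "'a::real_normed_vector \<Rightarrow> 'b::real_normed_vector"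
  assumes G: "(G has_derivative (\<lambda>x. x)) (at (\<tau> u))" and H: "(H has_derivative H') (at u)"
    and c: "isCont \<tau> u" and N: "open N" "u \<in> N" and eq: "\<And>z. z \<in> N \<Longrightarrow> G (\<tau> z) = H z"
  shows "(\<tau> has_derivative H') (at u)"
  unfolding has_derivative_at_alt
proof (intro conjI allI impI)
  show bl: "bounded_linear H'" using H has_derivative_bounded_linear by blast
  fix e :: real assume e: "e > 0"
  obtain K where K: "K > 0" "\<And>v. norm (H' v) \<le> norm v * K" using bounded_linear.pos_bounded[OF bl] by blast
  define e1 where "e1 = min 1 (e / 2)"
  define e2 where "e2 = min (1 / 2) (e / (4 * (K + 1)))"
  have e1: "e1 > 0" "e1 \<le> 1" "e1 \<le> e / 2" using e by (auto simp: e1_def)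
  have e2: "e2 > 0" "e2 \<le> 1 / 2" "e2 \<le> e / (4 * (K + 1))" 
    unfolding e2_def using e K by (simp_all only: min.cobounded1 min.cobounded2) simp
  obtain d1 where d1: "d1 > 0" "\<And>z. norm (z - u) < d1 \<Longrightarrow> norm (H z - H u - H' (z - u)) \<le> e1 * norm (z - u)"
    using H e1(1) unfolding has_derivative_at_alt by blast
  obtain d2 where d2: "d2 > 0"
    "\<And>z. norm (z - \<tau> u) < d2 \<Longrightarrow> norm (G z - G (\<tau> u) - (z - \<tau> u)) \<le> e2 * norm (z - \<tau> u)"
    using G e2(1) unfolding has_derivative_at_alt by blast
  obtain d3 where d3: "d3 > 0" "\<And>z. dist z u < d3 \<Longrightarrow> dist (\<tau> z) (\<tau> u) < d2"
    using c d2(1) unfolding continuous_at_eps_delta by blast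
  obtain d4 where d4: "d4 > 0" "ball u d4 \<subseteq> N" using N open_contains_ball by blast
  show "\<exists>d>0. \<forall>z. norm (z - u) < d \<longrightarrow> norm (\<tau> z - \<tau> u - H' (z - u)) \<le> e * norm (z - u)"
  proof (intro exI[of _ "Min {d1, d3, d4}"] conjI allI impI)
    show "Min {d1, d3, d4} > 0" using d1 d3 d4 by simp
    fix z assume "norm (z - u) < Min {d1, d3, d4}"
    then have z: "norm (z - u) < d1" "dist z u < d3" "z \<in> N"
      using d4(2) by (auto simp: dist_norm norm_minus_commute subset_iff)
    let ?h = "norm (z - u)" and ?t = "norm (\<tau> z - \<tau> u)"
    have b1: "norm (H z - H u - H' (z - u)) \<le> e1 * ?h" by (rule d1(2)[OF z(1)])
    have b2: "norm (G (\<tau> z) - G (\<tau> u) - (\<tau> z - \<tau> u)) \<le> e2 * ?t"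
      by (rule d2(2)) (use d3(2)[OF z(2)] in \<open>simp add: dist_norm\<close>)
    have id: "\<tau> z - \<tau> u - H' (z - u)
        = (H z - H u - H' (z - u)) - (G (\<tau> z) - G (\<tau> u) - (\<tau> z - \<tau> u))"
      using eq[OF z(3)] eq[OF N(2)] by simp
    have total: "norm (\<tau> z - \<tau> u - H' (z - u)) \<le> e1 * ?h + e2 * ?t"
      unfolding id using norm_triangle_ineq4[of "H z - H u - H' (z - u)" "G (\<tau> z) - G (\<tau> u) - (\<tau> z - \<tau> u)"] b1 b2
      by linarith
    have "?t \<le> norm (\<tau> z - \<tau> u - H' (z - u)) + norm (H' (z - u))"
      using norm_triangle_ineq[of "\<tau> z - \<tau> u - H' (z - u)" "H' (z - u)"] by simp
    moreover have "norm (H' (z - u)) \<le> ?h * K" by (rule K(2))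
    moreover have "e1 * ?h \<le> 1 * ?h" using e1 by (intro mult_right_mono) auto
    moreover have "e2 * ?t \<le> (1 / 2) * ?t" using e2 by (intro mult_right_mono) auto
    ultimately have t: "?t \<le> 2 * (K + 1) * ?h" using total by (simp add: algebra_simps)
    have "e2 * ?t \<le> (e / (4 * (K + 1))) * (2 * (K + 1) * ?h)"
      using e2 t e K by (intro mult_mono) auto
    also have "\<dots> = e * (?h / 2)"
    proof -
      have "(e / (4 * m)) * (2 * m * h) = e * (h / 2)" if "m > 0" for m h :: real
        using that by (simp add: field_simps)
      from this[of "K + 1" ?h] K(1) show ?thesis by simp
    qed
    finally have "e2 * ?t \<le> e * (?h / 2)" .
    moreover have "e1 * ?h \<le> (e / 2) * ?h" using e1 by (intro mult_right_mono) auto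
    ultimately show "norm (\<tau> z - \<tau> u - H' (z - u)) \<le> e * ?h" using total by simp
  qed
qed

text \<open>Charts are compatible: a change of charts is continuous because charts are homeomorphisms, and it
  solves \<open>\<phi> \<circ> \<psi>2 \<circ> \<tau> = \<phi> \<circ> \<psi>1\<close>, so composing with a left inverse of the injective differential of
  \<open>\<phi> \<circ> \<psi>2\<close> makes it differentiable.\<close>

lemma transition_map:
  assumes lp1: "local_param X \<phi> U1 \<psi>1" and lp2: "local_param X \<phi> U2 \<psi>2"
    and u1: "u1 \<in> U1" and u2: "u2 \<in> U2" and eq: "\<psi>1 u1 = \<psi>2 u2"
  obtains \<tau> \<tau>' N where "(\<tau> has_derivative \<tau>') (at u1)" "\<tau> u1 = u2" "open N" "u1 \<in> N"
    "\<And>z. z \<in> N \<Longrightarrow> \<psi>2 (\<tau> z) = \<psi>1 z"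
    "\<And>w. frechet_derivative (\<phi> \<circ> \<psi>1) (at u1) w = frechet_derivative (\<phi> \<circ> \<psi>2) (at u2) (\<tau>' w)"
proof -
  define \<tau> where "\<tau> z = inv_into U2 \<psi>2 (\<psi>1 z)" for z
  define N where "N = {z \<in> U1. \<psi>1 z \<in> \<psi>2 ` U2}"
  have N: "open N" unfolding N_def by (rule chart_preimage_open[OF lp1 local_paramD(2)[OF lp2]])
  have u1N: "u1 \<in> N" using u1 u2 eq by (auto simp: N_def)
  have \<tau>: "\<psi>2 (\<tau> z) = \<psi>1 z" if "z \<in> N" for z
    using that unfolding N_def \<tau>_def by (auto intro: f_inv_into_f)
  have \<tau>u: "\<tau> u1 = u2" unfolding \<tau>_def eq by (rule inv_into_f_f[OF local_paramD(6)[OF lp2] u2])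
  have cont: "isCont \<tau> u1"
    unfolding continuous_at_open
  proof (intro allI impI, elim conjE)
    fix t assume t: "open t" "\<tau> u1 \<in> t"
    let ?s = "{z \<in> U1. \<psi>1 z \<in> \<psi>2 ` (t \<inter> U2)}"
    have "open (t \<inter> U2)" using t(1) local_paramD(1)[OF lp2] by (rule open_Int)
    then have "openin X (\<psi>2 ` (t \<inter> U2))" by (rule chart_image_openin[OF lp2]) simp
    then have "open ?s" by (rule chart_preimage_open[OF lp1])
    moreover have "u1 \<in> ?s" using u1 t(2) u2 by (auto simp: \<tau>u eq)
    moreover have "\<tau> z \<in> t" if z: "z \<in> ?s" for z
    proof -
      obtain w where w: "w \<in> t \<inter> U2" "\<psi>1 z = \<psi>2 w" using z by blast
      have "\<tau> z = w" unfolding \<tau>_def w(2) by (rule inv_into_f_f[OF local_paramD(6)[OF lp2]]) (use w in blast)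
      then show ?thesis using w by blast
    qed
    ultimately show "\<exists>s. open s \<and> u1 \<in> s \<and> (\<forall>x'\<in>s. \<tau> x' \<in> t)" by blast
  qed
  obtain L where L: "linear L" "L \<circ> frechet_derivative (\<phi> \<circ> \<psi>2) (at u2) = id"
    using linear_injective_left_inverse[OF local_param_linear[OF lp2 u2] local_paramD(5)[OF lp2 u2]] by blast
  have bL: "bounded_linear L" using L(1) linear_conv_bounded_linear by blast
  have L': "L (frechet_derivative (\<phi> \<circ> \<psi>2) (at u2) w) = w" for w
    using fun_cong[OF L(2), of w] by simp
  have G: "((\<lambda>z. L ((\<phi> \<circ> \<psi>2) z)) has_derivative (\<lambda>x. x)) (at (\<tau> u1))"
    using bounded_linear.has_derivative[OF bL local_param_has_derivative[OF lp2 u2]]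
    unfolding L' by (simp add: \<tau>u)
  have H: "((\<lambda>z. L ((\<phi> \<circ> \<psi>1) z)) has_derivative (\<lambda>w. L (frechet_derivative (\<phi> \<circ> \<psi>1) (at u1) w))) (at u1)"
    by (rule bounded_linear.has_derivative[OF bL local_param_has_derivative[OF lp1 u1]])
  define \<tau>' where "\<tau>' = (\<lambda>w. L (frechet_derivative (\<phi> \<circ> \<psi>1) (at u1) w))"
  have d\<tau>: "(\<tau> has_derivative \<tau>') (at u1)"
    unfolding \<tau>'_def by (rule has_derivative_implicit[OF G H cont N u1N]) (simp add: \<tau>)
  have "((\<lambda>z. (\<phi> \<circ> \<psi>2) (\<tau> z)) has_derivative (\<lambda>w. frechet_derivative (\<phi> \<circ> \<psi>2) (at u2) (\<tau>' w))) (at u1)"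
    by (rule has_derivative_compose[OF d\<tau>, unfolded \<tau>u, OF local_param_has_derivative[OF lp2 u2]])
  then have "(\<phi> \<circ> \<psi>1 has_derivative (\<lambda>w. frechet_derivative (\<phi> \<circ> \<psi>2) (at u2) (\<tau>' w))) (at u1)"
    by (rule has_derivative_transform_within_open[OF _ N u1N]) (simp add: \<tau>)
  from has_derivative_unique[OF local_param_has_derivative[OF lp1 u1] this]
  have "frechet_derivative (\<phi> \<circ> \<psi>1) (at u1) = (\<lambda>w. frechet_derivative (\<phi> \<circ> \<psi>2) (at u2) (\<tau>' w))" .
  then have "frechet_derivative (\<phi> \<circ> \<psi>1) (at u1) w = frechet_derivative (\<phi> \<circ> \<psi>2) (at u2) (\<tau>' w)" for w
    by (rule fun_cong)
  then show ?thesis using that[OF d\<tau> \<tau>u N u1N \<tau>] by blast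
qed

lemma tangent_space_chart:
  assumes lp: "local_param X \<phi> U \<psi>" and u: "u \<in> U"
  shows "tangent_space X \<phi> (\<psi> u) = range (frechet_derivative (\<phi> \<circ> \<psi>) (at u))"
proof
  show "range (frechet_derivative (\<phi> \<circ> \<psi>) (at u)) \<subseteq> tangent_space X \<phi> (\<psi> u)"
    unfolding tangent_space_def using lp u by blast
  show "tangent_space X \<phi> (\<psi> u) \<subseteq> range (frechet_derivative (\<phi> \<circ> \<psi>) (at u))"
  proof
    fix v assume "v \<in> tangent_space X \<phi> (\<psi> u)"
    then obtain U2 \<psi>2 u2 w where 2: "local_param X \<phi> U2 \<psi>2" "u2 \<in> U2" "\<psi>2 u2 = \<psi> u"
      "v = frechet_derivative (\<phi> \<circ> \<psi>2) (at u2) w"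
      unfolding tangent_space_def by blast
    show "v \<in> range (frechet_derivative (\<phi> \<circ> \<psi>) (at u))"
      by (rule transition_map[OF 2(1) lp 2(2) u 2(3)]) (use 2(4) in blast)
  qed
qed

text \<open>The directional derivative is well defined: two charts that represent the same tangent vector give
  the same value, by the chain rule for the change of charts.\<close>

lemma dir_deriv_chart:
  assumes lp: "local_param X \<phi> U \<psi>" and u: "u \<in> U" and D: "(f \<circ> \<psi> has_derivative D) (at u)"
  shows "dir_deriv X \<phi> f (\<psi> u) (frechet_derivative (\<phi> \<circ> \<psi>) (at u) w) = D w"
  unfolding dir_deriv_def
proof (rule the_equality)
  have "frechet_derivative (f \<circ> \<psi>) (at u) = D" using frechet_derivative_at[OF D] by simp
  then show "\<exists>U' \<psi>' u' w'. local_param X \<phi> U' \<psi>' \<and> u' \<in> U' \<and> \<psi>' u' = \<psi> u \<and>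
      frechet_derivative (\<phi> \<circ> \<psi>) (at u) w = frechet_derivative (\<phi> \<circ> \<psi>') (at u') w' \<and>
      D w = frechet_derivative (f \<circ> \<psi>') (at u') w'"
    using lp u by blast
next
  fix d assume "\<exists>U' \<psi>' u' w'. local_param X \<phi> U' \<psi>' \<and> u' \<in> U' \<and> \<psi>' u' = \<psi> u \<and>
      frechet_derivative (\<phi> \<circ> \<psi>) (at u) w = frechet_derivative (\<phi> \<circ> \<psi>') (at u') w' \<and>
      d = frechet_derivative (f \<circ> \<psi>') (at u') w'"
  then obtain U2 \<psi>2 u2 w2 where lp2: "local_param X \<phi> U2 \<psi>2" and u2: "u2 \<in> U2" "\<psi>2 u2 = \<psi> u"
    and v: "frechet_derivative (\<phi> \<circ> \<psi>) (at u) w = frechet_derivative (\<phi> \<circ> \<psi>2) (at u2) w2"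
    and d: "d = frechet_derivative (f \<circ> \<psi>2) (at u2) w2" by blast
  obtain \<tau> \<tau>' N where \<tau>: "(\<tau> has_derivative \<tau>') (at u2)" "\<tau> u2 = u" "open N" "u2 \<in> N"
    "\<And>z. z \<in> N \<Longrightarrow> \<psi> (\<tau> z) = \<psi>2 z"
    "\<And>w. frechet_derivative (\<phi> \<circ> \<psi>2) (at u2) w = frechet_derivative (\<phi> \<circ> \<psi>) (at u) (\<tau>' w)"
    using transition_map[OF lp2 lp u2(1) u u2(2)] by blast
  have w: "\<tau>' w2 = w" using v \<tau>(6)[of w2] local_paramD(5)[OF lp u] by (simp add: inj_eq)
  have "((\<lambda>z. (f \<circ> \<psi>) (\<tau> z)) has_derivative (\<lambda>w. D (\<tau>' w))) (at u2)"
    by (rule has_derivative_compose[OF \<tau>(1), unfolded \<tau>(2), OF D])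
  then have "(f \<circ> \<psi>2 has_derivative (\<lambda>w. D (\<tau>' w))) (at u2)"
    by (rule has_derivative_transform_within_open[OF _ \<tau>(3,4)]) (simp add: \<tau>(5))
  from frechet_derivative_at[OF this] show "d = D w" unfolding d using w by metis
qed

section \<open>Smooth fields on a submanifold\<close>

lemma smooth_fieldI:
  assumes "\<And>U \<psi> k. local_param X \<phi> U \<psi> \<Longrightarrow> \<psi> ` U \<subseteq> W \<Longrightarrow> C_k_on k U (\<lambda>u. f (\<psi> u))"
  shows "smooth_field X \<phi> W f"
  using assms by (simp add: smooth_field_def smooth_on_def comp_def)

lemma smooth_fieldD:
  assumes "smooth_field X \<phi> W f" "local_param X \<phi> U \<psi>" "\<psi> ` U \<subseteq> W"
  shows "C_k_on k U (\<lambda>u. f (\<psi> u))"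
  using assms by (simp add: smooth_field_def smooth_on_def comp_def)

lemma smooth_field_mono: "smooth_field X \<phi> W f \<Longrightarrow> W' \<subseteq> W \<Longrightarrow> smooth_field X \<phi> W' f"
  unfolding smooth_field_def by blast

lemma smooth_field_cong:
  assumes f: "smooth_field X \<phi> W f" and eq: "\<And>q. q \<in> W \<Longrightarrow> f q = g q"
  shows "smooth_field X \<phi> W g"
proof (rule smooth_fieldI)
  fix U \<psi> k assume lp: "local_param X \<phi> U \<psi>" "\<psi> ` U \<subseteq> W"
  have "C_k_on k U (\<lambda>u. f (\<psi> u)) \<longleftrightarrow> C_k_on k U (\<lambda>u. g (\<psi> u))"
    by (rule C_k_on_cong[OF local_paramD(1)[OF lp(1)]]) (use eq lp(2) in blast)
  then show "C_k_on k U (\<lambda>u. g (\<psi> u))" using smooth_fieldD[OF f lp] by blast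
qed

lemma smooth_field_position: "smooth_field X \<phi> W \<phi>"
  using local_paramD(4) by (simp add: smooth_field_def) blast

lemma smooth_field_const: "smooth_field X \<phi> W (\<lambda>q. c)"
  by (rule smooth_fieldI) (rule C_k_on_const[OF local_paramD(1)])

lemma smooth_field_linear:
  "bounded_linear L \<Longrightarrow> smooth_field X \<phi> W f \<Longrightarrow> smooth_field X \<phi> W (\<lambda>q. L (f q))"
  by (rule smooth_fieldI) (rule C_k_on_linear[OF _ local_paramD(1) smooth_fieldD])

lemma smooth_field_bilinear:
  "bounded_bilinear B \<Longrightarrow> smooth_field X \<phi> W f \<Longrightarrow> smooth_field X \<phi> W g \<Longrightarrow>
    smooth_field X \<phi> W (\<lambda>q. B (f q) (g q))"
  by (rule smooth_fieldI) (rule C_k_on_bilinear[OF _ local_paramD(1) smooth_fieldD smooth_fieldD])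

lemma smooth_field_add:
  "smooth_field X \<phi> W f \<Longrightarrow> smooth_field X \<phi> W g \<Longrightarrow> smooth_field X \<phi> W (\<lambda>q. f q + g q)"
  by (rule smooth_fieldI) (rule C_k_on_add[OF local_paramD(1) smooth_fieldD smooth_fieldD])

lemma smooth_field_minus: "smooth_field X \<phi> W f \<Longrightarrow> smooth_field X \<phi> W (\<lambda>q. - f q)"
  by (rule smooth_field_linear[OF bounded_linear_minus[OF bounded_linear_ident]])

lemma smooth_field_diff:
  assumes "smooth_field X \<phi> W f" "smooth_field X \<phi> W g"
  shows "smooth_field X \<phi> W (\<lambda>q. f q - g q)"
  using smooth_field_add[OF assms(1) smooth_field_minus[OF assms(2)]] by simp

lemma smooth_field_sum:
  assumes "\<And>i. i \<in> I \<Longrightarrow> smooth_field X \<phi> W (f i)"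
  shows "smooth_field X \<phi> W (\<lambda>q. \<Sum>i\<in>I. f i q)"
  using assms
  by (induction I rule: infinite_finite_induct) (simp_all add: smooth_field_const smooth_field_add)

lemma smooth_field_inverse:
  assumes f: "smooth_field X \<phi> W f" and nz: "\<And>q. q \<in> W \<Longrightarrow> f q \<noteq> (0::real)"
  shows "smooth_field X \<phi> W (\<lambda>q. inverse (f q))"
proof (rule smooth_fieldI)
  fix U \<psi> k assume lp: "local_param X \<phi> U \<psi>" "\<psi> ` U \<subseteq> W"
  show "C_k_on k U (\<lambda>u. inverse (f (\<psi> u)))"
    by (rule C_k_on_inverse[OF local_paramD(1)[OF lp(1)] smooth_fieldD[OF f lp]]) (use nz lp(2) in blast)
qed

lemma smooth_field_sqrt:
  assumes f: "smooth_field X \<phi> W f" and nz: "\<And>q. q \<in> W \<Longrightarrow> f q > (0::real)"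
  shows "smooth_field X \<phi> W (\<lambda>q. sqrt (f q))"
proof (rule smooth_fieldI)
  fix U \<psi> k assume lp: "local_param X \<phi> U \<psi>" "\<psi> ` U \<subseteq> W"
  show "C_k_on k U (\<lambda>u. sqrt (f (\<psi> u)))"
    by (rule C_k_on_sqrt[OF local_paramD(1)[OF lp(1)] smooth_fieldD[OF f lp]]) (use nz lp(2) in blast)
qed

lemma smooth_field_vec:
  fixes f :: "'p \<Rightarrow> real ^ 'm"
  assumes "\<And>i. smooth_field X \<phi> W (\<lambda>q. f q $ i)"
  shows "smooth_field X \<phi> W f"
  by (rule smooth_fieldI) (rule C_k_on_vec[OF local_paramD(1) smooth_fieldD[OF assms]])

lemma smooth_field_matrix:
  fixes f :: "'p \<Rightarrow> real ^ 'm ^ 'l"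
  assumes "\<And>i j. smooth_field X \<phi> W (\<lambda>q. f q $ i $ j)"
  shows "smooth_field X \<phi> W f"
  by (rule smooth_fieldI) (rule C_k_on_matrix[OF local_paramD(1) smooth_fieldD[OF assms]])

lemma smooth_field_Pair:
  assumes f: "smooth_field X \<phi> W f" and g: "smooth_field X \<phi> W g"
  shows "smooth_field X \<phi> W (\<lambda>q. (f q, g q))"
proof -
  have "smooth_field X \<phi> W (\<lambda>q. (f q, 0) + (0, g q))"
    by (intro smooth_field_add smooth_field_linear[OF _ f, of "\<lambda>x. (x, 0)"]
        smooth_field_linear[OF _ g, of "\<lambda>x. (0, x)"] bounded_linear_Pair bounded_linear_ident bounded_linear_zero)
  then show ?thesis by simp
qed

lemma smooth_field_local:
  assumes "\<And>p. p \<in> V \<Longrightarrow> \<exists>W. openin X W \<and> p \<in> W \<and> smooth_field X \<phi> W f"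
  shows "smooth_field X \<phi> V f"
proof (rule smooth_fieldI)
  fix U \<psi> k assume lp: "local_param X \<phi> U \<psi>" and UV: "\<psi> ` U \<subseteq> V"
  show "C_k_on k U (\<lambda>u. f (\<psi> u))"
  proof (rule C_k_on_local)
    fix u assume u: "u \<in> U"
    obtain W where W: "openin X W" "\<psi> u \<in> W" "smooth_field X \<phi> W f"
      using assms[of "\<psi> u"] UV u by blast
    let ?U = "{u \<in> U. \<psi> u \<in> W}"
    have o: "open ?U" by (rule chart_preimage_open[OF lp W(1)])
    then have "local_param X \<phi> ?U \<psi>" by (rule local_param_restrict[OF lp]) blast
    then have "C_k_on k ?U (\<lambda>u. f (\<psi> u))" by (rule smooth_fieldD[OF W(3)]) blast
    then show "\<exists>T. open T \<and> u \<in> T \<and> C_k_on k T (\<lambda>u. f (\<psi> u))" using o u W(2) by blast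
  qed
qed

lemma smooth_field_spectral_filter:
  assumes A: "smooth_field X \<phi> W A" and c: "smooth_field X \<phi> W c"
    and v: "\<And>j. j \<in> set js \<Longrightarrow> smooth_field X \<phi> W (\<lambda>q. v q j)"
    and ne: "\<And>q j. q \<in> W \<Longrightarrow> j \<in> set js \<Longrightarrow> c q \<noteq> v q j"
  shows "smooth_field X \<phi> W (\<lambda>q. spectral_filter (A q) (c q) (map (v q) js) y)"
proof (rule smooth_fieldI)
  fix U \<psi> k assume lp: "local_param X \<phi> U \<psi>" "\<psi> ` U \<subseteq> W"
  note U = local_paramD(1)[OF lp(1)]
  show "C_k_on k U (\<lambda>u. spectral_filter (A (\<psi> u)) (c (\<psi> u)) (map (v (\<psi> u)) js) y)"
    by (rule C_k_on_spectral_filter[OF U smooth_fieldD[OF A lp] smooth_fieldD[OF c lp]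
          smooth_fieldD[OF v lp] ne C_k_on_const[OF U]]) (use lp(2) in auto)
qed

lemma openin_chart_continuous_preimage:
  assumes M: "submanifold X \<phi>" and W: "openin X W" and O: "open S"
    and c: "\<And>U \<psi>. local_param X \<phi> U \<psi> \<Longrightarrow> \<psi> ` U \<subseteq> W \<Longrightarrow> continuous_on U (\<lambda>u. f (\<psi> u))"
  shows "openin X {q \<in> W. f q \<in> S}"
proof (subst openin_subopen, rule ballI)
  fix q assume q: "q \<in> {q \<in> W. f q \<in> S}"
  obtain U \<psi> u where lp: "local_param X \<phi> U \<psi>" "\<psi> ` U \<subseteq> W" and u: "u \<in> U" "\<psi> u = q"
    using chart_inside[OF M W, of q] q by blast
  let ?V = "U \<inter> (\<lambda>u. f (\<psi> u)) -` S"
  have "open ?V" by (rule continuous_open_preimage[OF c[OF lp] local_paramD(1)[OF lp(1)] O])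
  then have "openin X (\<psi> ` ?V)" by (rule chart_image_openin[OF lp(1)]) simp
  moreover have "q \<in> \<psi> ` ?V" using u q by blast
  moreover have "\<psi> ` ?V \<subseteq> {q \<in> W. f q \<in> S}" using lp(2) by blast
  ultimately show "\<exists>T. openin X T \<and> q \<in> T \<and> T \<subseteq> {q \<in> W. f q \<in> S}" by blast
qed

lemma openin_smooth_preimage:
  assumes "submanifold X \<phi>" "openin X W" "open S" "smooth_field X \<phi> W f"
  shows "openin X {q \<in> W. f q \<in> S}"
  by (rule openin_chart_continuous_preimage[OF assms(1-3)])
     (use smooth_fieldD[OF assms(4), of _ _ 0] in simp)

lemma dir_deriv_in_chart:
  assumes M: "submanifold X \<phi>" and W: "openin X W" "p \<in> W" and v: "v \<in> tangent_space X \<phi> p"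
  obtains U \<psi> u w where "local_param X \<phi> U \<psi>" "\<psi> ` U \<subseteq> W" "u \<in> U" "\<psi> u = p"
    "v = frechet_derivative (\<phi> \<circ> \<psi>) (at u) w"
proof -
  obtain U \<psi> u where lp: "local_param X \<phi> U \<psi>" "\<psi> ` U \<subseteq> W" "u \<in> U" "\<psi> u = p"
    using chart_inside[OF M W] by blast
  then show ?thesis using that v tangent_space_chart[OF lp(1,3)] by blast
qed

lemma dir_deriv_smooth_chart:
  assumes f: "smooth_field X \<phi> W f" and lp: "local_param X \<phi> U \<psi>" "\<psi> ` U \<subseteq> W" "u \<in> U"
  shows "((\<lambda>u. f (\<psi> u)) has_derivative (\<lambda>w. dir_deriv X \<phi> f (\<psi> u) (frechet_derivative (\<phi> \<circ> \<psi>) (at u) w))) (at u)"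
proof -
  have D: "(f \<circ> \<psi> has_derivative frechet_derivative (f \<circ> \<psi>) (at u)) (at u)"
    using smooth_on_has_derivative[of U "f \<circ> \<psi>" u] f lp by (simp add: smooth_field_def)
  have "(\<lambda>w. dir_deriv X \<phi> f (\<psi> u) (frechet_derivative (\<phi> \<circ> \<psi>) (at u) w)) = frechet_derivative (f \<circ> \<psi>) (at u)"
    by (rule ext) (rule dir_deriv_chart[OF lp(1,3) D])
  then show ?thesis using D by (simp add: comp_def)
qed

text \<open>Rules of calculus for derivatives along one tangent vector, which a chart turns into derivatives
  in one fixed direction of \<open>\<real>\<^sup>n\<close>. The open set \<open>W\<close> allows for fields that are smooth only near \<open>p\<close>.\<close>

locale tangent_direction =
  fixes X :: "'p topology" and \<phi> :: "'p \<Rightarrow> 'n::finite mink" and W :: "'p set" and p :: 'p and v :: "'n mink"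
  assumes M: "submanifold X \<phi>" and W: "openin X W" "p \<in> W" and v: "v \<in> tangent_space X \<phi> p"
begin

abbreviation "dd f \<equiv> dir_deriv X \<phi> f p v"

lemma dd_eqI:
  assumes "\<And>U \<psi> u w. local_param X \<phi> U \<psi> \<Longrightarrow> \<psi> ` U \<subseteq> W \<Longrightarrow> u \<in> U \<Longrightarrow> \<psi> u = p \<Longrightarrow>
    v = frechet_derivative (\<phi> \<circ> \<psi>) (at u) w \<Longrightarrow> \<exists>D. ((\<lambda>u. f (\<psi> u)) has_derivative D) (at u) \<and> D w = d"
  shows "dd f = d"
proof (rule dir_deriv_in_chart[OF M W v])
  fix U \<psi> u w assume *: "local_param X \<phi> U \<psi>" "\<psi> ` U \<subseteq> W" "u \<in> U" "\<psi> u = p"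
    "v = frechet_derivative (\<phi> \<circ> \<psi>) (at u) w"
  obtain D where D: "((\<lambda>u. f (\<psi> u)) has_derivative D) (at u)" "D w = d" using assms[OF *] by blast
  show ?thesis using dir_deriv_chart[OF *(1,3), of f D w] D *(4,5) by (simp add: comp_def)
qed

lemma dd_const: "dd (\<lambda>q. c) = 0"
  by (rule dd_eqI) (rule exI[of _ "\<lambda>_. 0"], simp)

lemma dd_position: "dd \<phi> = v"
proof (rule dd_eqI)
  fix U \<psi> u w assume *: "local_param X \<phi> U \<psi>" "u \<in> U" "v = frechet_derivative (\<phi> \<circ> \<psi>) (at u) w"
  show "\<exists>D. ((\<lambda>u. \<phi> (\<psi> u)) has_derivative D) (at u) \<and> D w = v"
    using local_param_has_derivative[OF *(1,2)] *(3) unfolding comp_def by blast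
qed

lemma dd_linear:
  assumes L: "bounded_linear L" and f: "smooth_field X \<phi> W f"
  shows "dd (\<lambda>q. L (f q)) = L (dd f)"
proof (rule dd_eqI)
  fix U \<psi> u w assume *: "local_param X \<phi> U \<psi>" "\<psi> ` U \<subseteq> W" "u \<in> U" "\<psi> u = p"
    "v = frechet_derivative (\<phi> \<circ> \<psi>) (at u) w"
  show "\<exists>D. ((\<lambda>u. L (f (\<psi> u))) has_derivative D) (at u) \<and> D w = L (dd f)"
    using bounded_linear.has_derivative[OF L dir_deriv_smooth_chart[OF f *(1-3)]] *(4,5) by blast
qed

lemma dd_add:
  assumes f: "smooth_field X \<phi> W f" and g: "smooth_field X \<phi> W g"
  shows "dd (\<lambda>q. f q + g q) = dd f + dd g"
proof (rule dd_eqI)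
  fix U \<psi> u w assume *: "local_param X \<phi> U \<psi>" "\<psi> ` U \<subseteq> W" "u \<in> U" "\<psi> u = p"
    "v = frechet_derivative (\<phi> \<circ> \<psi>) (at u) w"
  show "\<exists>D. ((\<lambda>u. f (\<psi> u) + g (\<psi> u)) has_derivative D) (at u) \<and> D w = dd f + dd g"
    using has_derivative_add[OF dir_deriv_smooth_chart[OF f *(1-3)] dir_deriv_smooth_chart[OF g *(1-3)]] *(4,5)
    by blast
qed

lemma dd_bilinear:
  assumes B: "bounded_bilinear B" and f: "smooth_field X \<phi> W f" and g: "smooth_field X \<phi> W g"
  shows "dd (\<lambda>q. B (f q) (g q)) = B (f p) (dd g) + B (dd f) (g p)"
proof (rule dd_eqI)
  fix U \<psi> u w assume *: "local_param X \<phi> U \<psi>" "\<psi> ` U \<subseteq> W" "u \<in> U" "\<psi> u = p"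
    "v = frechet_derivative (\<phi> \<circ> \<psi>) (at u) w"
  show "\<exists>D. ((\<lambda>u. B (f (\<psi> u)) (g (\<psi> u))) has_derivative D) (at u) \<and> D w = B (f p) (dd g) + B (dd f) (g p)"
    using bounded_bilinear.FDERIV[OF B dir_deriv_smooth_chart[OF f *(1-3)] dir_deriv_smooth_chart[OF g *(1-3)]] *(4,5)
    by blast
qed

lemma dd_cong:
  assumes f: "smooth_field X \<phi> W f" and eq: "\<And>q. q \<in> W \<Longrightarrow> g q = f q"
  shows "dd g = dd f"
proof (rule dd_eqI)
  fix U \<psi> u w assume *: "local_param X \<phi> U \<psi>" "\<psi> ` U \<subseteq> W" "u \<in> U" "\<psi> u = p"
    "v = frechet_derivative (\<phi> \<circ> \<psi>) (at u) w"
  have "((\<lambda>u. g (\<psi> u)) has_derivative (\<lambda>w. dir_deriv X \<phi> f (\<psi> u) (frechet_derivative (\<phi> \<circ> \<psi>) (at u) w))) (at u)"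
    by (rule has_derivative_transform_within_open[OF dir_deriv_smooth_chart[OF f *(1-3)] local_paramD(1)[OF *(1)] *(3)])
       (use eq *(2) in auto)
  then show "\<exists>D. ((\<lambda>u. g (\<psi> u)) has_derivative D) (at u) \<and> D w = dd f" using *(4,5) by blast
qed

end

lemma linear_dir_deriv:
  assumes M: "submanifold X \<phi>" and W: "openin X W" "p \<in> W" and f: "smooth_field X \<phi> W f"
    and v: "v \<in> tangent_space X \<phi> p" and v': "v' \<in> tangent_space X \<phi> p"
  shows "dir_deriv X \<phi> f p (a *\<^sub>R v + b *\<^sub>R v') = a *\<^sub>R dir_deriv X \<phi> f p v + b *\<^sub>R dir_deriv X \<phi> f p v'"
proof -
  obtain U \<psi> u w where *: "local_param X \<phi> U \<psi>" "\<psi> ` U \<subseteq> W" "u \<in> U" "\<psi> u = p"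
    "v = frechet_derivative (\<phi> \<circ> \<psi>) (at u) w"
    using dir_deriv_in_chart[OF M W v] by blast
  obtain w' where w': "v' = frechet_derivative (\<phi> \<circ> \<psi>) (at u) w'"
    using v' tangent_space_chart[OF *(1,3)] *(4) by auto
  note lin = local_param_linear[OF *(1,3)]
  have 1: "a *\<^sub>R v + b *\<^sub>R v' = frechet_derivative (\<phi> \<circ> \<psi>) (at u) (a *\<^sub>R w + b *\<^sub>R w')"
    unfolding *(5) w' by (simp add: linear_add[OF lin] linear_scale[OF lin])
  note lin2 = has_derivative_linear[OF dir_deriv_smooth_chart[OF f *(1-3)]]
  show ?thesis
    unfolding 1 using linear_add[OF lin2, of "a *\<^sub>R w" "b *\<^sub>R w'"] linear_scale[OF lin2, of a w] linear_scale[OF lin2, of b w']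
    unfolding *(4) *(5)[symmetric] w'[symmetric] by simp
qed

section \<open>Points of constant multiplicity\<close>

text \<open>By hypothesis \<open>f\<close> factors through \<open>g\<close>; if the images have the same cardinality, the factor is
  injective.\<close>

lemma card_image_refine:
  assumes fin: "finite I" and ref: "\<And>a b. a \<in> I \<Longrightarrow> b \<in> I \<Longrightarrow> g a = g b \<Longrightarrow> f a = f b"
  shows "card (f ` I) \<le> card (g ` I)"
    and "card (f ` I) = card (g ` I) \<Longrightarrow> a \<in> I \<Longrightarrow> b \<in> I \<Longrightarrow> f a = f b \<Longrightarrow> g a = g b"
proof -
  define h where "h = f \<circ> inv_into I g"
  have hg: "h (g a) = f a" if "a \<in> I" for a
    unfolding h_def comp_def
    by (rule ref) (use that in \<open>auto intro: inv_into_into f_inv_into_f\<close>)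
  have im: "f ` I = h ` g ` I" using hg by (force simp: image_image)
  show "card (f ` I) \<le> card (g ` I)" unfolding im using fin by (simp add: card_image_le)
  assume eq: "card (f ` I) = card (g ` I)" and ab: "a \<in> I" "b \<in> I" "f a = f b"
  have "inj_on h (g ` I)" by (rule eq_card_imp_inj_on) (use fin eq im in auto)
  then show "g a = g b" using ab hg by (metis imageI inj_onD)
qed

lemma openin_locally_constant_points:
  "openin X {p. \<exists>W. openin X W \<and> p \<in> W \<and> (\<forall>q\<in>W. f q = f p)}" (is "openin X ?V")
proof (subst openin_subopen, rule ballI)
  fix p assume "p \<in> ?V"
  then obtain W where W: "openin X W" "p \<in> W" "\<And>q. q \<in> W \<Longrightarrow> f q = f p" by blast
  have "q \<in> ?V" if q: "q \<in> W" for q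
  proof -
    have "f r = f q" if r: "r \<in> W" for r by (rule trans[OF W(3)[OF r] W(3)[OF q, symmetric]])
    then show ?thesis using W(1) q by blast
  qed
  then show "\<exists>T. openin X T \<and> p \<in> T \<and> T \<subseteq> ?V" using W(1,2) by blast
qed

text \<open>An open set contains a point where the bounded function \<open>f\<close> is maximal on it; by lower
  semicontinuity \<open>f\<close> is constant near that point.\<close>

lemma closure_of_locally_constant_points:
  fixes f :: "'p \<Rightarrow> nat"
  assumes bound: "\<And>q. f q \<le> n"
    and lsc: "\<And>q. q \<in> topspace X \<Longrightarrow> \<exists>W. openin X W \<and> q \<in> W \<and> (\<forall>r\<in>W. f q \<le> f r)"
  shows "X closure_of {p. \<exists>W. openin X W \<and> p \<in> W \<and> (\<forall>q\<in>W. f q = f p)} = topspace X"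
    (is "X closure_of ?V = _")
proof
  show "X closure_of ?V \<subseteq> topspace X" by (rule closure_of_subset_topspace)
  show "topspace X \<subseteq> X closure_of ?V"
  proof
    fix p assume p: "p \<in> topspace X"
    have "\<exists>y\<in>?V. y \<in> T" if T: "p \<in> T" "openin X T" for T
    proof -
      have "finite (f ` T)" by (rule finite_subset[of _ "{..n}"]) (use bound in auto)
      then have "Max (f ` T) \<in> f ` T" and max: "\<And>r. r \<in> T \<Longrightarrow> f r \<le> Max (f ` T)"
        using T(1) by (auto intro: Max_in)
      then obtain q where q: "q \<in> T" "\<And>r. r \<in> T \<Longrightarrow> f r \<le> f q" by auto
      obtain W where W: "openin X W" "q \<in> W" "\<And>r. r \<in> W \<Longrightarrow> f q \<le> f r"
        using lsc[of q] q(1) openin_subset[OF T(2)] by blast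
      have "openin X (W \<inter> T)" using W(1) T(2) by blast
      moreover have "f r = f q" if "r \<in> W \<inter> T" for r using W(3)[of r] q(2)[of r] that by simp
      ultimately have "q \<in> ?V" using W(2) q(1) by blast
      then show ?thesis using q(1) by blast
    qed
    then show "p \<in> X closure_of ?V" using p unfolding in_closure_of by blast
  qed
qed

section \<open>Submanifolds of the cone times a line\<close>

lemma lorentz_eq:
  "lorentz v w = - (fst v * fst w) + fst (snd v) \<bullet> fst (snd w) + snd (snd v) * snd (snd w)"
  by (simp add: lorentz_def inner_vec_def)

lemma bounded_bilinear_lorentz: "bounded_bilinear (lorentz :: 'n::finite mink \<Rightarrow> _)"
  unfolding bilinear_conv_bounded_bilinear[symmetric] bilinear_def linear_iff
  by (simp add: lorentz_eq inner_add_left inner_add_right algebra_simps)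

interpretation lorentz: bounded_bilinear "lorentz :: 'n::finite mink \<Rightarrow> _"
  by (rule bounded_bilinear_lorentz)

lemma lorentz_commute: "lorentz v w = lorentz w v"
  by (simp add: lorentz_eq inner_commute mult.commute)

locale cone_submanifold =
  fixes X :: "'p topology" and \<phi> :: "'p \<Rightarrow> 'n::finite mink"
  assumes M: "submanifold X \<phi>" and nondeg: "non_degenerate X \<phi>"
    and cone: "p \<in> topspace X \<Longrightarrow> \<phi> p \<in> LC_times_R"
begin

abbreviation "\<theta> \<equiv> cone_field \<phi>"
abbreviation "T p \<equiv> tangent_space X \<phi> p"
abbreviation "N p \<equiv> normal_space X \<phi> p"
abbreviation "sm \<equiv> smooth_field X \<phi>"
abbreviation "DD \<equiv> dir_deriv X \<phi>"

text \<open>In the notation \<open>(t, t s, z)\<close> for the position, \<open>t = ht p\<close> and \<open>s = dirn p\<close>.\<close>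

definition ht :: "'p \<Rightarrow> real" where "ht p = fst (\<phi> p)"
definition dirn :: "'p \<Rightarrow> real ^ 'n" where "dirn p = inverse (ht p) *\<^sub>R fst (snd (\<phi> p))"

lemma ht_pos: "p \<in> topspace X \<Longrightarrow> ht p > 0"
  using cone[of p] by (auto simp: LC_times_R_def ht_def split: prod.splits)

lemma dirn_unit: "p \<in> topspace X \<Longrightarrow> dirn p \<bullet> dirn p = 1"
proof -
  assume p: "p \<in> topspace X"
  have "fst (snd (\<phi> p)) \<bullet> fst (snd (\<phi> p)) = ht p * ht p"
    using cone[OF p] by (auto simp: LC_times_R_def ht_def inner_vec_def power2_eq_square split: prod.splits)
  then show ?thesis using ht_pos[OF p] by (simp add: dirn_def field_simps)
qed

lemma position_eq: "p \<in> topspace X \<Longrightarrow> fst (snd (\<phi> p)) = ht p *\<^sub>R dirn p"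
  using ht_pos[of p] by (simp add: dirn_def)

lemma cone_field_eq: "p \<in> topspace X \<Longrightarrow> \<theta> p = (ht p, ht p *\<^sub>R dirn p, 0)"
  by (simp add: cone_field_def ht_def[symmetric] position_eq)

lemma bounded_linear_drop_last: "bounded_linear (\<lambda>v::'n mink. (fst v, fst (snd v), 0::real))"
  by (intro bounded_linear_Pair bounded_linear_fst bounded_linear_zero
      bounded_linear_compose[OF bounded_linear_fst bounded_linear_snd])

lemma smooth_cone_field: "sm W \<theta>"
  using smooth_field_linear[OF bounded_linear_drop_last smooth_field_position]
  by (simp add: cone_field_def[abs_def])

lemma smooth_ht: "sm W ht"
  using smooth_field_linear[OF bounded_linear_fst smooth_field_position] by (simp add: ht_def[abs_def])

lemma smooth_inverse_ht: "W \<subseteq> topspace X \<Longrightarrow> sm W (\<lambda>q. inverse (ht q))"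
  by (rule smooth_field_inverse[OF smooth_ht]) (use ht_pos in force)

lemma smooth_dirn: "W \<subseteq> topspace X \<Longrightarrow> sm W dirn"
  unfolding dirn_def[abs_def]
  by (intro smooth_field_bilinear[OF bounded_bilinear_scaleR] smooth_inverse_ht
      smooth_field_linear[OF bounded_linear_compose[OF bounded_linear_fst bounded_linear_snd]] smooth_field_position)

lemma tangent_direction_at: "p \<in> topspace X \<Longrightarrow> v \<in> T p \<Longrightarrow> tangent_direction X \<phi> (topspace X) p v"
  by (simp add: tangent_direction_def M)

lemma DD_cone_field:
  assumes "p \<in> topspace X" "v \<in> T p"
  shows "DD \<theta> p v = (fst v, fst (snd v), 0)"
  using tangent_direction.dd_linear[OF tangent_direction_at[OF assms] bounded_linear_drop_last smooth_field_position]
    tangent_direction.dd_position[OF tangent_direction_at[OF assms]]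
  by (simp add: cone_field_def[abs_def])

lemma DD_lorentz_const:
  assumes p: "p \<in> topspace X" and v: "v \<in> T p" and f: "sm (topspace X) f" and g: "sm (topspace X) g"
    and c: "\<And>q. q \<in> topspace X \<Longrightarrow> lorentz (f q) (g q) = c"
  shows "lorentz (f p) (DD g p v) + lorentz (DD f p v) (g p) = 0"
  using tangent_direction.dd_bilinear[OF tangent_direction_at[OF p v] bounded_bilinear_lorentz f g]
    tangent_direction.dd_cong[OF tangent_direction_at[OF p v] smooth_field_const c] tangent_direction.dd_const[OF tangent_direction_at[OF p v], of c]
  by simp

lemma cone_field_null: "p \<in> topspace X \<Longrightarrow> lorentz (\<theta> p) (\<theta> p) = 0"
  using dirn_unit[of p] by (simp add: cone_field_eq lorentz_eq)

text \<open>The derivative of \<open>\<langle>\<theta>, \<theta>\<rangle> = 0\<close>: tangent vectors are orthogonal to the ray.\<close>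

lemma tangent_cone:
  assumes p: "p \<in> topspace X" and v: "v \<in> T p"
  shows "fst v = dirn p \<bullet> fst (snd v)"
proof -
  have "lorentz (\<theta> p) (DD \<theta> p v) + lorentz (DD \<theta> p v) (\<theta> p) = 0"
    by (rule DD_lorentz_const[OF p v smooth_cone_field smooth_cone_field cone_field_null])
  then have "ht p * (dirn p \<bullet> fst (snd v) - fst v) = 0"
    using inner_commute[of "fst (snd v)" "dirn p"]
    by (simp add: DD_cone_field[OF p v] cone_field_eq[OF p] lorentz_eq algebra_simps)
  then show ?thesis using ht_pos[OF p] by simp
qed

text \<open>Modulo the cone field, the tangent space of the hypersurface is the Euclidean space
  \<open>\<real>\<^sup>n = dirn\<^sup>\<bottom> \<oplus> \<real> dirn\<close>, in which the last coordinate direction is represented by \<open>dirn\<close>. A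
  non-degenerate submanifold is transverse to the cone field, so this identification is an isometry
  on its tangent spaces, and it trivializes the tangent bundle.\<close>

definition proj :: "'p \<Rightarrow> 'n mink \<Rightarrow> real ^ 'n" where
  "proj p v = fst (snd v) + (snd (snd v) - fst v) *\<^sub>R dirn p"

lemma bounded_linear_proj: "bounded_linear (proj p)"
  unfolding linear_conv_bounded_linear[symmetric]
  by (simp add: linear_iff proj_def algebra_simps)

lemma linear_proj: "linear (proj p)"
  by (rule bounded_linear.linear[OF bounded_linear_proj])

lemma tangent_form:
  assumes p: "p \<in> topspace X" and v: "v \<in> T p"
  shows "v = (fst v, proj p v - (proj p v \<bullet> dirn p) *\<^sub>R dirn p + fst v *\<^sub>R dirn p, proj p v \<bullet> dirn p)"
proof -
  have "proj p v \<bullet> dirn p = snd (snd v)"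
    using tangent_cone[OF p v] dirn_unit[OF p] inner_commute[of "dirn p" "fst (snd v)"]
    by (simp add: proj_def inner_add_left)
  then show ?thesis by (simp add: prod_eq_iff) (simp add: proj_def algebra_simps)
qed

lemma tangent_lorentz:
  assumes p: "p \<in> topspace X" and v: "v \<in> T p" and w: "w \<in> T p"
  shows "lorentz v w = proj p v \<bullet> proj p w"
  using tangent_cone[OF p v] tangent_cone[OF p w] dirn_unit[OF p] inner_commute[of "fst (snd v)" "dirn p"]
  by (simp add: lorentz_eq proj_def inner_add_left inner_add_right algebra_simps)

lemma subspace_tangent: "p \<in> topspace X \<Longrightarrow> subspace (T p)"
proof -
  assume "p \<in> topspace X"
  then obtain U \<psi> u where lp: "local_param X \<phi> U \<psi>" "u \<in> U" "\<psi> u = p"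
    using chart_inside[OF M openin_topspace] by metis
  show ?thesis
    using linear_subspace_image[OF local_param_linear[OF lp(1,2)] subspace_UNIV] tangent_space_chart[OF lp(1,2)] lp(3)
    by simp
qed

text \<open>The transversality: a tangent vector along the ray is orthogonal to all tangent vectors, so it
  vanishes by non-degeneracy.\<close>

lemma proj_eq_0:
  assumes p: "p \<in> topspace X" and v: "v \<in> T p" and "proj p v = 0"
  shows "v = 0"
proof -
  have "\<forall>w\<in>T p. lorentz v w = 0" using tangent_lorentz[OF p v] assms(3) by simp
  then show ?thesis using nondeg p v by (simp add: non_degenerate_def)
qed

lemma proj_chart:
  assumes lp: "local_param X \<phi> U \<psi>" and u: "u \<in> U"
  shows "linear (\<lambda>w. proj (\<psi> u) (frechet_derivative (\<phi> \<circ> \<psi>) (at u) w))"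
    and "inj (\<lambda>w. proj (\<psi> u) (frechet_derivative (\<phi> \<circ> \<psi>) (at u) w))"
proof -
  note lin = local_param_linear[OF lp u]
  show l: "linear (\<lambda>w. proj (\<psi> u) (frechet_derivative (\<phi> \<circ> \<psi>) (at u) w))"
    using linear_compose[OF lin linear_proj] by (simp add: comp_def)
  show "inj (\<lambda>w. proj (\<psi> u) (frechet_derivative (\<phi> \<circ> \<psi>) (at u) w))"
    unfolding linear_injective_0[OF l]
  proof (intro allI impI)
    fix w assume "proj (\<psi> u) (frechet_derivative (\<phi> \<circ> \<psi>) (at u) w) = 0"
    then have "frechet_derivative (\<phi> \<circ> \<psi>) (at u) w = 0"
      using proj_eq_0[OF local_paramD(7)[OF lp u]] tangent_space_chart[OF lp u] by blast
    then show "w = 0" using local_paramD(5)[OF lp u] linear_injective_0[OF lin] by blast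
  qed
qed

lemma lift_ex1:
  assumes p: "p \<in> topspace X"
  shows "\<exists>!v. v \<in> T p \<and> proj p v = x"
proof (rule ex_ex1I)
  obtain U \<psi> u where lp: "local_param X \<phi> U \<psi>" "u \<in> U" "\<psi> u = p"
    using chart_inside[OF M openin_topspace p] by metis
  have "surj (\<lambda>w. proj (\<psi> u) (frechet_derivative (\<phi> \<circ> \<psi>) (at u) w))"
    by (rule linear_injective_imp_surjective[OF proj_chart[OF lp(1,2)]]) simp
  then obtain w where "x = proj (\<psi> u) (frechet_derivative (\<phi> \<circ> \<psi>) (at u) w)" by (rule surjE)
  then show "\<exists>v. v \<in> T p \<and> proj p v = x" using tangent_space_chart[OF lp(1,2)] lp(3) by blast
next
  fix v w assume vw: "v \<in> T p \<and> proj p v = x" "w \<in> T p \<and> proj p w = x"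
  then have "v - w \<in> T p" "proj p (v - w) = 0"
    using subspace_diff[OF subspace_tangent[OF p]] linear_diff[OF linear_proj] by auto
  then show "v = w" using proj_eq_0[OF p, of "v - w"] by simp
qed

definition lift :: "'p \<Rightarrow> real ^ 'n \<Rightarrow> 'n mink" where
  "lift p x = (THE v. v \<in> T p \<and> proj p v = x)"

lemma lift_tangent: "p \<in> topspace X \<Longrightarrow> lift p x \<in> T p"
  and proj_lift: "p \<in> topspace X \<Longrightarrow> proj p (lift p x) = x"
  using theI'[OF lift_ex1] by (auto simp: lift_def)

lemma lift_unique: "p \<in> topspace X \<Longrightarrow> v \<in> T p \<Longrightarrow> proj p v = x \<Longrightarrow> lift p x = v"
  unfolding lift_def by (rule the1_equality[OF lift_ex1]) auto

lemma lift_proj: "p \<in> topspace X \<Longrightarrow> v \<in> T p \<Longrightarrow> lift p (proj p v) = v"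
  by (rule lift_unique) auto

lemma linear_lift:
  assumes p: "p \<in> topspace X"
  shows "linear (lift p)"
  unfolding linear_iff
proof (intro conjI allI)
  fix x y c
  show "lift p (x + y) = lift p x + lift p y"
    by (rule lift_unique[OF p])
       (simp_all add: subspace_add[OF subspace_tangent[OF p]] lift_tangent[OF p] linear_add[OF linear_proj] proj_lift[OF p])
  show "lift p (c *\<^sub>R x) = c *\<^sub>R lift p x"
    by (rule lift_unique[OF p])
       (simp_all add: subspace_scale[OF subspace_tangent[OF p]] lift_tangent[OF p] linear_scale[OF linear_proj] proj_lift[OF p])
qed

lemma lorentz_lift: "p \<in> topspace X \<Longrightarrow> lorentz (lift p x) (lift p y) = x \<bullet> y"
  by (simp add: tangent_lorentz lift_tangent proj_lift)

lemma tangent_eq_range_lift: "p \<in> topspace X \<Longrightarrow> T p = range (lift p)"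
  using lift_tangent lift_proj by (auto simp: image_iff) (metis lift_proj)

text \<open>Coordinates of a tangent field in a chart solve a linear system with smooth coefficients.\<close>

lemma chart_coordinates:
  assumes lp: "local_param X \<phi> U \<psi>" and b: "C_k_on k U b"
    and w: "\<And>u. u \<in> U \<Longrightarrow> proj (\<psi> u) (frechet_derivative (\<phi> \<circ> \<psi>) (at u) (w u)) = b u"
  shows "C_k_on k U w"
proof (rule C_k_on_linear_solve[OF local_paramD(1)[OF lp] _ b])
  note U = local_paramD(1)[OF lp]
  let ?f = "\<lambda>u w. proj (\<psi> u) (frechet_derivative (\<phi> \<circ> \<psi>) (at u) w)"
  have UX: "\<psi> ` U \<subseteq> topspace X" using local_paramD(7)[OF lp] by blast
  show "det (matrix (?f u)) \<noteq> 0" if "u \<in> U" for u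
    using det_nz_iff_inj[OF proj_chart(1)[OF lp that]] proj_chart(2)[OF lp that] by blast
  show "matrix (?f u) *v w u = b u" if "u \<in> U" for u
    unfolding matrix_of_linear[OF proj_chart(1)[OF lp that]] by (rule w[OF that])
  have F: "C_k_on k U (\<lambda>u. frechet_derivative (\<phi> \<circ> \<psi>) (at u) v)" for v
    using smooth_on_C_k[OF local_paramD(4)[OF lp], of "Suc k"] by simp
  have s: "C_k_on k U (\<lambda>u. dirn (\<psi> u))" by (rule smooth_fieldD[OF smooth_dirn[OF UX] lp order_refl])
  have "C_k_on k U (\<lambda>u. ?f u v)" for v
    unfolding proj_def
    by (intro C_k_on_add[OF U] C_k_on_bilinear[OF bounded_bilinear_scaleR U] s
       C_k_on_linear[OF bounded_linear_compose[OF bounded_linear_fst bounded_linear_snd] U F]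
       C_k_on_linear[OF bounded_linear_sub[OF bounded_linear_compose[OF bounded_linear_snd bounded_linear_snd] bounded_linear_fst] U F])
  then have "C_k_on k U (\<lambda>u. ?f u (axis j 1) $ i)" for i j
    by (rule C_k_on_linear[OF bounded_linear_vec_nth U])
  then show "C_k_on k U (\<lambda>u. matrix (?f u))"
    by (intro C_k_on_matrix[OF U]) (simp add: matrix_def)
qed

lemma lift_coordinates:
  assumes lp: "local_param X \<phi> U \<psi>" "\<psi> ` U \<subseteq> W" and b: "sm W b"
  obtains w where "\<And>u. u \<in> U \<Longrightarrow> lift (\<psi> u) (b (\<psi> u)) = frechet_derivative (\<phi> \<circ> \<psi>) (at u) (w u)"
    "\<And>k. C_k_on k U w"
proof -
  have "\<exists>w. lift (\<psi> u) (b (\<psi> u)) = frechet_derivative (\<phi> \<circ> \<psi>) (at u) w" if "u \<in> U" for u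
    using lift_tangent[OF local_paramD(7)[OF lp(1) that], of "b (\<psi> u)"] tangent_space_chart[OF lp(1) that] by auto
  then obtain w where w: "\<And>u. u \<in> U \<Longrightarrow> lift (\<psi> u) (b (\<psi> u)) = frechet_derivative (\<phi> \<circ> \<psi>) (at u) (w u)"
    by metis
  have "C_k_on k U w" for k
    by (rule chart_coordinates[OF lp(1) smooth_fieldD[OF b lp]])
       (simp add: w[symmetric] proj_lift[OF local_paramD(7)[OF lp(1)]])
  then show ?thesis using that w by blast
qed

lemma smooth_lift:
  assumes b: "sm W b"
  shows "sm W (\<lambda>q. lift q (b q))"
proof (rule smooth_fieldI)
  fix U \<psi> k assume lp: "local_param X \<phi> U \<psi>" "\<psi> ` U \<subseteq> W"
  note U = local_paramD(1)[OF lp(1)]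
  obtain w where w: "\<And>u. u \<in> U \<Longrightarrow> lift (\<psi> u) (b (\<psi> u)) = frechet_derivative (\<phi> \<circ> \<psi>) (at u) (w u)"
    and wk: "\<And>k. C_k_on k U w"
    using lift_coordinates[OF lp b] by blast
  have "C_k_on k U (\<lambda>u. frechet_derivative (\<phi> \<circ> \<psi>) (at u) (w u))"
    by (rule C_k_on_frechet_apply[OF U smooth_on_C_k[OF local_paramD(4)[OF lp(1)]] wk])
  moreover have "C_k_on k U (\<lambda>u. lift (\<psi> u) (b (\<psi> u)))
      \<longleftrightarrow> C_k_on k U (\<lambda>u. frechet_derivative (\<phi> \<circ> \<psi>) (at u) (w u))"
    by (rule C_k_on_cong[OF U w])
  ultimately show "C_k_on k U (\<lambda>u. lift (\<psi> u) (b (\<psi> u)))" by blast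
qed

text \<open>Derivatives of smooth fields along smooth tangent fields are smooth, which makes all coefficients
  of the second fundamental form smooth.\<close>

lemma smooth_dir_deriv_lift:
  assumes f: "sm W f" and b: "sm W b"
  shows "sm W (\<lambda>q. DD f q (lift q (b q)))"
proof (rule smooth_fieldI)
  fix U \<psi> k assume lp: "local_param X \<phi> U \<psi>" "\<psi> ` U \<subseteq> W"
  note U = local_paramD(1)[OF lp(1)]
  obtain w where w: "\<And>u. u \<in> U \<Longrightarrow> lift (\<psi> u) (b (\<psi> u)) = frechet_derivative (\<phi> \<circ> \<psi>) (at u) (w u)"
    and wk: "\<And>k. C_k_on k U w"
    using lift_coordinates[OF lp b] by blast
  have fk: "C_k_on k U (f \<circ> \<psi>)" for k using smooth_fieldD[OF f lp] by (simp add: comp_def)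
  have "C_k_on k U (\<lambda>u. frechet_derivative (f \<circ> \<psi>) (at u) (w u))"
    by (rule C_k_on_frechet_apply[OF U fk wk])
  moreover have "C_k_on k U (\<lambda>u. DD f (\<psi> u) (lift (\<psi> u) (b (\<psi> u))))
      \<longleftrightarrow> C_k_on k U (\<lambda>u. frechet_derivative (f \<circ> \<psi>) (at u) (w u))"
    by (rule C_k_on_cong[OF U])
       (simp only: w dir_deriv_chart[OF lp(1) _ C_k_on_Suc_has_derivative[OF fk]])
  ultimately show "C_k_on k U (\<lambda>u. DD f (\<psi> u) (lift (\<psi> u) (b (\<psi> u))))" by blast
qed

section \<open>The normal frame\<close>

text \<open>The logarithmic derivatives of the height \<open>t\<close>: \<open>slope p \<bullet> x = (lift p x)(ln t)\<close>. The function \<open>al\<close> is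
  the closed form of \<open>\<alpha>\<close> (see \<open>alpha_eq\<close>).\<close>

definition slope :: "'p \<Rightarrow> real ^ 'n" where
  "slope p = (\<chi> i. fst (lift p (axis i 1)) * inverse (ht p))"

definition al :: "'p \<Rightarrow> real" where "al p = slope p \<bullet> dirn p"

definition slope_perp :: "'p \<Rightarrow> real ^ 'n" where "slope_perp p = slope p - al p *\<^sub>R dirn p"

definition E1 :: "'p \<Rightarrow> 'n mink" where "E1 p = lift p (dirn p)"

text \<open>The vectors \<open>(1, -s, 0) / 2t\<close> and \<open>\<theta>\<close> are null with product \<open>-1\<close>. Orthogonality to \<open>e\<^sub>1\<close> forces
  the last component \<open>al p\<close>, orthogonality to the other lifts forces \<open>slope_perp p\<close>, and the multiple
  of \<open>\<theta>\<close> restores \<open>\<langle>\<xi>, \<xi>\<rangle> = 0\<close>.\<close>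

definition xi :: "'p \<Rightarrow> 'n mink" where
  "xi p = (inverse (2 * ht p), - (inverse (2 * ht p) *\<^sub>R dirn p) + slope_perp p, al p)
     + (((al p)\<^sup>2 + slope_perp p \<bullet> slope_perp p) / 2) *\<^sub>R \<theta> p"

lemma fst_lift:
  assumes p: "p \<in> topspace X"
  shows "fst (lift p x) = ht p * (slope p \<bullet> x)"
proof -
  have "linear (\<lambda>x. fst (lift p x))"
    using linear_compose[OF linear_lift[OF p] linear_fst] by (simp add: comp_def)
  from linear_axis_expansion[OF this, of x] have "fst (lift p x) = (\<Sum>i\<in>UNIV. x $ i * fst (lift p (axis i 1)))"
    by simp
  also have "\<dots> = (\<Sum>i\<in>UNIV. ht p * (slope p $ i * x $ i))"
    using ht_pos[OF p] by (intro sum.cong) (auto simp: slope_def)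
  finally show ?thesis by (simp add: inner_vec_def sum_distrib_left)
qed

lemma lift_eq:
  assumes p: "p \<in> topspace X"
  shows "lift p x = (x \<bullet> dirn p) *\<^sub>R d_last + (0, x - (x \<bullet> dirn p) *\<^sub>R dirn p, 0) + (slope p \<bullet> x) *\<^sub>R \<theta> p"
  using tangent_form[OF p lift_tangent[OF p], of x] fst_lift[OF p, of x]
  by (simp add: proj_lift[OF p] cone_field_eq[OF p] d_last_def mult.commute)

lemma E1_eq: "p \<in> topspace X \<Longrightarrow> E1 p = d_last + al p *\<^sub>R \<theta> p"
  by (simp add: E1_def lift_eq dirn_unit al_def zero_prod_def[symmetric])

lemma slope_perp_dirn: "p \<in> topspace X \<Longrightarrow> slope_perp p \<bullet> dirn p = 0"
  by (simp add: slope_perp_def al_def inner_diff_left dirn_unit)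

lemma smooth_slope: "W \<subseteq> topspace X \<Longrightarrow> sm W slope"
  by (rule smooth_field_vec)
     (simp add: slope_def, intro smooth_field_bilinear[OF bounded_bilinear_mult] smooth_inverse_ht
        smooth_field_linear[OF bounded_linear_fst] smooth_lift smooth_field_const)

lemma smooth_al: "W \<subseteq> topspace X \<Longrightarrow> sm W al"
  unfolding al_def[abs_def]
  by (intro smooth_field_bilinear[OF bounded_bilinear_inner] smooth_slope smooth_dirn)

lemma smooth_slope_perp: "W \<subseteq> topspace X \<Longrightarrow> sm W slope_perp"
  unfolding slope_perp_def[abs_def]
  by (intro smooth_field_diff smooth_field_bilinear[OF bounded_bilinear_scaleR] smooth_al smooth_slope smooth_dirn)

lemma smooth_E1: "W \<subseteq> topspace X \<Longrightarrow> sm W E1"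
  unfolding E1_def[abs_def] by (intro smooth_lift smooth_dirn)

lemma smooth_xi: assumes W: "W \<subseteq> topspace X" shows "sm W xi"
proof -
  have 1: "sm W (\<lambda>q. inverse (ht q) / 2)"
    by (rule smooth_field_linear[OF bounded_linear_divide smooth_inverse_ht[OF W]])
  have 2: "sm W (\<lambda>q. (al q * al q + slope_perp q \<bullet> slope_perp q) / 2)"
    by (intro smooth_field_linear[OF bounded_linear_divide] smooth_field_add smooth_al[OF W] smooth_slope_perp[OF W]
        smooth_field_bilinear[OF bounded_bilinear_mult] smooth_field_bilinear[OF bounded_bilinear_inner])
  have "sm W (\<lambda>q. (inverse (ht q) / 2, - ((inverse (ht q) / 2) *\<^sub>R dirn q) + slope_perp q, al q)
     + ((al q * al q + slope_perp q \<bullet> slope_perp q) / 2) *\<^sub>R \<theta> q)"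
    by (intro smooth_field_add smooth_field_Pair smooth_field_minus 1 2 smooth_slope_perp[OF W] smooth_al[OF W]
        smooth_dirn[OF W] smooth_field_bilinear[OF bounded_bilinear_scaleR] smooth_cone_field)
  then show ?thesis
    by (simp add: xi_def[abs_def] power2_eq_square)
qed

lemma lorentz_cone_lift: "p \<in> topspace X \<Longrightarrow> lorentz (\<theta> p) (lift p x) = 0"
  using tangent_cone[OF _ lift_tangent, of p x]
  by (simp add: cone_field_eq lorentz_eq)

lemma lorentz_cone_xi: "p \<in> topspace X \<Longrightarrow> lorentz (\<theta> p) (xi p) = -1"
  using ht_pos[of p] dirn_unit[of p] slope_perp_dirn[of p]
  by (simp add: xi_def lorentz.add_right lorentz.scaleR_right cone_field_null)
     (simp add: cone_field_eq lorentz_eq inner_diff_right inner_commute[of "dirn p" "slope_perp p"])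

lemma xi_null: "p \<in> topspace X \<Longrightarrow> lorentz (xi p) (xi p) = 0"
proof -
  assume p: "p \<in> topspace X"
  let ?b = "(inverse (2 * ht p), - (inverse (2 * ht p) *\<^sub>R dirn p) + slope_perp p, al p)"
  let ?a = "((al p)\<^sup>2 + slope_perp p \<bullet> slope_perp p) / 2"
  have bt: "lorentz ?b (\<theta> p) = -1"
    using ht_pos[OF p] dirn_unit[OF p] slope_perp_dirn[OF p]
    by (simp add: cone_field_eq[OF p] lorentz_eq inner_diff_left)
  have bb: "lorentz ?b ?b = 2 * ?a"
    using dirn_unit[OF p] slope_perp_dirn[OF p]
    by (simp add: lorentz_eq inner_diff_left inner_diff_right inner_commute[of "dirn p" "slope_perp p"] power2_eq_square)
  have "lorentz (xi p) (xi p) = lorentz ?b ?b + 2 * ?a * lorentz ?b (\<theta> p) + ?a * ?a * lorentz (\<theta> p) (\<theta> p)"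
  proof -
    have "lorentz (b + a *\<^sub>R t) (b + a *\<^sub>R t) = lorentz b b + 2 * a * lorentz b t + a * a * lorentz t t"
      for b t :: "'n mink" and a
      using lorentz_commute[of t b]
      by (simp add: lorentz.add_left lorentz.add_right lorentz.scaleR_left lorentz.scaleR_right algebra_simps)
    then show ?thesis unfolding xi_def .
  qed
  then show ?thesis unfolding bt bb cone_field_null[OF p] by simp
qed

lemma lorentz_xi_lift: "p \<in> topspace X \<Longrightarrow> lorentz (xi p) (lift p x) = 0"
proof -
  assume p: "p \<in> topspace X"
  have "lorentz (xi p) (lift p x) =
     lorentz (inverse (2 * ht p), - (inverse (2 * ht p) *\<^sub>R dirn p) + slope_perp p, al p) (lift p x)"
    by (simp add: xi_def lorentz.add_left lorentz.scaleR_left lorentz_cone_lift[OF p])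
  also have "\<dots> = 0"
    using ht_pos[OF p] dirn_unit[OF p] slope_perp_dirn[OF p]
    unfolding lift_eq[OF p]
    by (simp add: lorentz_eq d_last_def cone_field_eq[OF p] inner_add_left inner_add_right inner_diff_left inner_diff_right
        inner_commute slope_perp_def al_def algebra_simps)
  finally show ?thesis .
qed

text \<open>The lifts together with \<open>\<theta>\<close> and \<open>\<xi>\<close> span the whole space.\<close>

lemma orthogonal_to_all:
  assumes p: "p \<in> topspace X" and l: "\<And>x. lorentz w (lift p x) = 0"
    and t: "lorentz w (\<theta> p) = 0" and x: "lorentz w (xi p) = 0"
  shows "w = 0"
proof -
  note h = ht_pos[OF p] dirn_unit[OF p]
  have l': "(x \<bullet> dirn p) * snd (snd w) + fst (snd w) \<bullet> (x - (x \<bullet> dirn p) *\<^sub>R dirn p) = 0" for x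
    using l[of x] unfolding lift_eq[OF p] lorentz.add_right lorentz.scaleR_right t
    by (simp add: lorentz_eq d_last_def)
  \<comment> \<open>Test against \<open>e\<^sub>1\<close>, then \<open>\<theta>\<close>, then the lifts of vectors orthogonal to \<open>s\<close>, then \<open>\<xi>\<close>.\<close>
  have z: "snd (snd w) = 0" using l'[of "dirn p"] h(2) by simp
  have "ht p * (fst (snd w) \<bullet> dirn p - fst w) = 0"
    using t by (simp add: cone_field_eq[OF p] lorentz_eq algebra_simps)
  then have a: "fst w = fst (snd w) \<bullet> dirn p" using h(1) by simp
  have "(fst (snd w) - (fst (snd w) \<bullet> dirn p) *\<^sub>R dirn p) \<bullet> x = 0" for x
    using l'[of x] z by (simp add: inner_diff_left inner_diff_right inner_commute algebra_simps)
  then have "fst (snd w) - (fst (snd w) \<bullet> dirn p) *\<^sub>R dirn p = 0" by (metis inner_eq_zero_iff)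
  then have b: "fst (snd w) = fst w *\<^sub>R dirn p" using a by simp
  have "lorentz w (inverse (2 * ht p), - (inverse (2 * ht p) *\<^sub>R dirn p) + slope_perp p, al p) = 0"
    using x by (simp add: xi_def lorentz.add_right lorentz.scaleR_right t)
  then have "fst w * inverse (ht p) = 0"
    using z h slope_perp_dirn[OF p] by (simp add: lorentz_eq b inner_diff_right inner_commute[of "dirn p" "slope_perp p"])
  then have "fst w = 0" using h(1) by simp
  then show ?thesis using b z by (simp add: prod_eq_iff)
qed

lemma normal_space_iff:
  assumes "p \<in> topspace X"
  shows "w \<in> N p \<longleftrightarrow> (\<forall>x. lorentz w (lift p x) = 0)"
  by (auto simp: normal_space_def tangent_eq_range_lift[OF assms])

lemma normal_decomp:
  assumes p: "p \<in> topspace X" and w: "w \<in> N p"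
  shows "w = - (lorentz w (xi p) *\<^sub>R \<theta> p) - lorentz w (\<theta> p) *\<^sub>R xi p"
proof -
  let ?A = "lorentz w (xi p) *\<^sub>R \<theta> p" and ?B = "lorentz w (\<theta> p) *\<^sub>R xi p"
  have wl: "lorentz w (lift p x) = 0" for x using w by (simp add: normal_space_iff[OF p])
  have xt: "lorentz (xi p) (\<theta> p) = -1" using lorentz_commute[of "xi p" "\<theta> p"] lorentz_cone_xi[OF p] by simp
  have sum: "w + ?A + ?B = 0"
    by (rule orthogonal_to_all[OF p])
       (simp_all add: lorentz.add_left lorentz.scaleR_left wl xt lorentz_xi_lift[OF p] lorentz_cone_lift[OF p]
          cone_field_null[OF p] xi_null[OF p] lorentz_cone_xi[OF p])
  have "w = (w + ?A + ?B) - ?A - ?B" by simp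
  then show ?thesis unfolding sum by simp
qed

lemma pseudo_orthonormal_frame:
  assumes p: "p \<in> topspace X"
  shows "pseudo_orthonormal_basis_of (N p) (\<theta> p) (xi p)"
  unfolding pseudo_orthonormal_basis_of_def light_like_def future_pointing_def
proof (intro conjI)
  show "lorentz (\<theta> p) (\<theta> p) = 0" "lorentz (xi p) (xi p) = 0" "lorentz (\<theta> p) (xi p) = -1"
    using cone_field_null xi_null lorentz_cone_xi p by auto
  then show "\<theta> p \<noteq> 0" "xi p \<noteq> 0" by (auto simp: lorentz.zero_left lorentz.zero_right)
  show "lorentz (\<theta> p) d_first < 0" using ht_pos[OF p] by (simp add: lorentz_eq d_first_def cone_field_eq[OF p])
  have "fst (xi p) > 0"
    using ht_pos[OF p] by (simp add: xi_def cone_field_eq[OF p] add_pos_nonneg)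
  then show "lorentz (xi p) d_first < 0" by (simp add: lorentz_eq d_first_def)
  show "span {\<theta> p, xi p} = N p"
  proof
    have sub: "subspace (N p)"
      by (rule subspaceI) (auto simp: normal_space_iff[OF p] lorentz.zero_left lorentz.add_left lorentz.scaleR_left)
    show "span {\<theta> p, xi p} \<subseteq> N p"
      by (rule span_minimal[OF _ sub])
         (simp add: normal_space_iff[OF p] lorentz_xi_lift[OF p] lorentz_cone_lift[OF p])
    show "N p \<subseteq> span {\<theta> p, xi p}"
    proof
      fix w assume w: "w \<in> N p"
      have "- (lorentz w (xi p) *\<^sub>R \<theta> p) - lorentz w (\<theta> p) *\<^sub>R xi p \<in> span {\<theta> p, xi p}"
        by (intro span_diff span_neg span_scale span_base) auto
      then show "w \<in> span {\<theta> p, xi p}" using normal_decomp[OF p w] by simp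
    qed
  qed
qed

lemma tan_part_eq:
  assumes p: "p \<in> topspace X" and x: "\<And>z. lorentz w (lift p z) = x \<bullet> z"
  shows "tan_part X \<phi> p w = lift p x"
  unfolding tan_part_def
proof (rule the_equality)
  show "lift p x \<in> T p \<and> w - lift p x \<in> N p"
    using x by (simp add: lift_tangent[OF p] normal_space_iff[OF p] lorentz.diff_left lorentz_lift[OF p])
next
  fix v assume v: "v \<in> T p \<and> w - v \<in> N p"
  have "(proj p v - x) \<bullet> z = 0" for z
  proof -
    have "lorentz (w - v) (lift p z) = 0" using v by (simp add: normal_space_iff[OF p])
    moreover have "lorentz v (lift p z) = proj p v \<bullet> z"
      using tangent_lorentz[OF p conjunct1[OF v] lift_tangent[OF p]] by (simp add: proj_lift[OF p])
    ultimately show ?thesis by (simp add: lorentz.diff_left x inner_diff_left)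
  qed
  then have "proj p v = x" by (metis inner_eq_zero_iff eq_iff_diff_eq_0)
  then show "v = lift p x" using lift_proj[OF p conjunct1[OF v]] by simp
qed

lemma tan_part_props:
  assumes p: "p \<in> topspace X"
  obtains x where "tan_part X \<phi> p w = lift p x" "\<And>z. lorentz w (lift p z) = x \<bullet> z"
proof -
  define x where "x = (\<chi> i. lorentz w (lift p (axis i 1)))"
  have "lorentz w (lift p z) = x \<bullet> z" for z
  proof -
    have "linear (\<lambda>z. lorentz w (lift p z))"
      using linear_compose[OF linear_lift[OF p] bounded_linear.linear[OF lorentz.bounded_linear_right, of w]]
      by (simp add: comp_def)
    from linear_axis_expansion[OF this, of z] show ?thesis by (simp add: x_def inner_vec_def mult.commute)
  qed
  then show ?thesis using that tan_part_eq[OF p, of w x] by blast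
qed

lemma nor_part_normal: "p \<in> topspace X \<Longrightarrow> nor_part X \<phi> p w \<in> N p"
proof -
  assume p: "p \<in> topspace X"
  obtain x where "tan_part X \<phi> p w = lift p x" "\<And>z. lorentz w (lift p z) = x \<bullet> z"
    using tan_part_props[OF p] by metis
  then show ?thesis by (simp add: nor_part_def normal_space_iff[OF p] lorentz.diff_left lorentz_lift[OF p])
qed

lemma nor_part_eq:
  assumes p: "p \<in> topspace X"
  shows "nor_part X \<phi> p w = - (lorentz w (xi p) *\<^sub>R \<theta> p) - lorentz w (\<theta> p) *\<^sub>R xi p"
proof -
  obtain x where x: "tan_part X \<phi> p w = lift p x" using tan_part_props[OF p] by metis
  have "lorentz (nor_part X \<phi> p w) (xi p) = lorentz w (xi p)" "lorentz (nor_part X \<phi> p w) (\<theta> p) = lorentz w (\<theta> p)"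
    using lorentz_xi_lift[OF p, of x] lorentz_cone_lift[OF p, of x]
      lorentz_commute[of "lift p x" "xi p"] lorentz_commute[of "lift p x" "\<theta> p"]
    by (simp_all add: nor_part_def x lorentz.diff_left)
  then show ?thesis using normal_decomp[OF p nor_part_normal[OF p, of w]] by simp
qed

section \<open>Gauss and Weingarten formulas\<close>

lemma cone_field_normal: "p \<in> topspace X \<Longrightarrow> \<theta> p \<in> N p"
  by (simp add: normal_space_iff lorentz_cone_lift)

lemma xi_normal: "p \<in> topspace X \<Longrightarrow> xi p \<in> N p"
  by (simp add: normal_space_iff lorentz_xi_lift)

lemma tan_nor_sum:
  assumes p: "p \<in> topspace X" and n: "n \<in> N p"
  shows "tan_part X \<phi> p (lift p x + n) = lift p x" and "nor_part X \<phi> p (lift p x + n) = n"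
proof -
  show "tan_part X \<phi> p (lift p x + n) = lift p x"
    by (rule tan_part_eq[OF p])
       (use n in \<open>simp add: lorentz.add_left lorentz_lift[OF p] normal_space_iff[OF p]\<close>)
  then show "nor_part X \<phi> p (lift p x + n) = n" by (simp add: nor_part_def)
qed

lemma normal_scale: "p \<in> topspace X \<Longrightarrow> n \<in> N p \<Longrightarrow> c *\<^sub>R n \<in> N p"
  by (simp add: normal_space_iff lorentz.scaleR_left)

definition perp :: "'p \<Rightarrow> real ^ 'n \<Rightarrow> real ^ 'n" where
  "perp p x = x - (x \<bullet> dirn p) *\<^sub>R dirn p"

lemma linear_perp: "linear (perp p)"
  by (simp add: linear_iff perp_def inner_add_left algebra_simps)

lemma perp_inner: "perp p x \<bullet> z = x \<bullet> perp p z"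
  by (simp add: perp_def inner_diff_left inner_diff_right inner_commute)

lemma perp_dirn: "p \<in> topspace X \<Longrightarrow> perp p (dirn p) = 0"
  by (simp add: perp_def dirn_unit)

lemma perp_id: "x \<bullet> dirn p = 0 \<Longrightarrow> perp p x = x"
  by (simp add: perp_def)

text \<open>Since \<open>\<theta>\<close> is the position vector without its last component, \<open>D\<^sub>v \<theta>\<close> is \<open>v\<close> without its last
  component; the right-hand side splits this into tangential and normal part.\<close>

lemma DD_cone_lift:
  assumes p: "p \<in> topspace X"
  shows "DD \<theta> p (lift p x) = lift p (perp p x) + ((x \<bullet> dirn p) * al p) *\<^sub>R \<theta> p"
proof -
  have "snd (snd (lift p x)) = x \<bullet> dirn p"
    unfolding lift_eq[OF p] by (simp add: d_last_def cone_field_eq[OF p])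
  then have "DD \<theta> p (lift p x) = lift p x - (x \<bullet> dirn p) *\<^sub>R d_last"
    unfolding DD_cone_field[OF p lift_tangent[OF p]] by (simp add: d_last_def prod_eq_iff)
  moreover have "lift p (perp p x) = lift p x - (x \<bullet> dirn p) *\<^sub>R E1 p"
    by (simp add: perp_def linear_diff[OF linear_lift[OF p]] linear_scale[OF linear_lift[OF p]] E1_def)
  ultimately have "(x \<bullet> dirn p) *\<^sub>R d_last + DD \<theta> p (lift p x)
      = (x \<bullet> dirn p) *\<^sub>R d_last + (lift p (perp p x) + ((x \<bullet> dirn p) * al p) *\<^sub>R \<theta> p)"
    by (simp add: E1_eq[OF p] scaleR_add_right)
  then show ?thesis by simp
qed

lemma tan_nor_DD_cone:
  assumes p: "p \<in> topspace X"
  shows "tan_part X \<phi> p (DD \<theta> p (lift p x)) = lift p (perp p x)"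
    and "nor_part X \<phi> p (DD \<theta> p (lift p x)) = ((x \<bullet> dirn p) * al p) *\<^sub>R \<theta> p"
  unfolding DD_cone_lift[OF p]
  using tan_nor_sum[OF p, of "((x \<bullet> dirn p) * al p) *\<^sub>R \<theta> p" "perp p x"]
    normal_scale[OF p cone_field_normal[OF p]] by blast+

lemma cone_field_nonzero: "p \<in> topspace X \<Longrightarrow> \<theta> p \<noteq> 0"
  using ht_pos[of p] by (simp add: cone_field_eq prod_eq_iff)

lemma alpha_eq:
  assumes p: "p \<in> topspace X"
  shows "alpha X \<phi> p = al p"
proof -
  have "d_last = lift p (dirn p) + (- al p) *\<^sub>R \<theta> p" using E1_eq[OF p] by (simp add: E1_def)
  then have "tan_part X \<phi> p d_last = lift p (dirn p)"
    using tan_nor_sum(1)[OF p normal_scale[OF p cone_field_normal[OF p]]] by metis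
  then have "normal_conn X \<phi> \<theta> p (tan_part X \<phi> p d_last) = al p *\<^sub>R \<theta> p"
    by (simp add: normal_conn_def tan_nor_DD_cone(2)[OF p] dirn_unit[OF p])
  then show ?thesis unfolding alpha_def using cone_field_nonzero[OF p] by simp
qed

lemma DD_E1_lift:
  assumes p: "p \<in> topspace X"
  shows "DD E1 p (lift p x) = al p *\<^sub>R lift p (perp p x)
    + (DD al p (lift p x) + (al p)\<^sup>2 * (x \<bullet> dirn p)) *\<^sub>R \<theta> p"
proof -
  interpret tangent_direction X \<phi> "topspace X" p "lift p x" by (rule tangent_direction_at[OF p lift_tangent[OF p]])
  have sm1: "sm (topspace X) (\<lambda>q. al q *\<^sub>R \<theta> q)"
    by (intro smooth_field_bilinear[OF bounded_bilinear_scaleR] smooth_al smooth_cone_field order_refl)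
  have "DD E1 p (lift p x) = DD (\<lambda>q. d_last + al q *\<^sub>R \<theta> q) p (lift p x)"
    by (rule dd_cong[OF smooth_field_add[OF smooth_field_const sm1] E1_eq])
  also have "\<dots> = DD (\<lambda>q. al q *\<^sub>R \<theta> q) p (lift p x)"
    using dd_add[OF smooth_field_const sm1, of d_last] by (simp add: dd_const)
  also have "\<dots> = al p *\<^sub>R DD \<theta> p (lift p x) + DD al p (lift p x) *\<^sub>R \<theta> p"
    by (rule dd_bilinear[OF bounded_bilinear_scaleR smooth_al[OF order_refl] smooth_cone_field])
  finally show ?thesis
    by (simp add: DD_cone_lift[OF p] algebra_simps power2_eq_square)
qed

text \<open>The derivatives of \<open>\<langle>\<xi>, \<theta>\<rangle> = -1\<close> and \<open>\<langle>\<xi>, \<xi>\<rangle> = 0\<close> determine the normal part of \<open>D\<^sub>v \<xi>\<close>.\<close>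

lemma lorentz_DD_xi:
  assumes p: "p \<in> topspace X"
  shows "lorentz (DD xi p (lift p x)) (\<theta> p) = (x \<bullet> dirn p) * al p"
    and "lorentz (DD xi p (lift p x)) (xi p) = 0"
proof -
  note t = lift_tangent[OF p, of x] and sx = smooth_xi[OF order_refl]
  have c: "lorentz (xi q) (\<theta> q) = -1" if "q \<in> topspace X" for q
    using lorentz_cone_xi[OF that] lorentz_commute[of "xi q" "\<theta> q"] by simp
  have "lorentz (xi p) (DD \<theta> p (lift p x)) + lorentz (DD xi p (lift p x)) (\<theta> p) = 0"
    by (rule DD_lorentz_const[OF p t sx smooth_cone_field c])
  then show "lorentz (DD xi p (lift p x)) (\<theta> p) = (x \<bullet> dirn p) * al p"
    by (simp add: DD_cone_lift[OF p] lorentz.add_right lorentz.scaleR_right lorentz_xi_lift[OF p] c[OF p])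
  have "lorentz (xi p) (DD xi p (lift p x)) + lorentz (DD xi p (lift p x)) (xi p) = 0"
    by (rule DD_lorentz_const[OF p t sx sx xi_null])
  then show "lorentz (DD xi p (lift p x)) (xi p) = 0"
    using lorentz_commute[of "xi p" "DD xi p (lift p x)"] by simp
qed

lemma nor_DD_xi:
  assumes p: "p \<in> topspace X"
  shows "nor_part X \<phi> p (DD xi p (lift p x)) = - (((x \<bullet> dirn p) * al p) *\<^sub>R xi p)"
  by (simp add: nor_part_eq[OF p] lorentz_DD_xi[OF p])

text \<open>The shape operator of \<open>\<xi>\<close>, transported to \<open>\<real>\<^sup>n\<close> (see \<open>shape_op_xi\<close>).\<close>

definition xi_shape :: "'p \<Rightarrow> real ^ 'n ^ 'n" where
  "xi_shape p = (\<chi> i j. - lorentz (DD xi p (lift p (axis j 1))) (lift p (axis i 1)))"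

lemma smooth_xi_shape: "W \<subseteq> topspace X \<Longrightarrow> sm W xi_shape"
  by (rule smooth_field_matrix)
     (simp add: xi_shape_def, intro smooth_field_minus smooth_field_bilinear[OF bounded_bilinear_lorentz]
       smooth_dir_deriv_lift smooth_lift smooth_field_const smooth_xi)

lemma linear_DD_lift:
  assumes p: "p \<in> topspace X" and f: "sm (topspace X) f"
  shows "linear (\<lambda>x. DD f p (lift p x))"
proof -
  have *: "DD f p (lift p (a *\<^sub>R x + b *\<^sub>R y)) = a *\<^sub>R DD f p (lift p x) + b *\<^sub>R DD f p (lift p y)" for a b x y
    using linear_dir_deriv[OF M openin_topspace p f lift_tangent[OF p] lift_tangent[OF p], of a x b y]
    by (simp add: linear_add[OF linear_lift[OF p]] linear_scale[OF linear_lift[OF p]])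
  show ?thesis
    unfolding linear_iff using *[of 1 _ 1] *[of _ _ 0] by simp
qed

lemma xi_shape_inner:
  assumes p: "p \<in> topspace X"
  shows "(xi_shape p *v x) \<bullet> z = - lorentz (DD xi p (lift p x)) (lift p z)"
proof -
  note ldd = linear_DD_lift[OF p smooth_xi[OF order_refl]]
  have "(xi_shape p *v x) $ i = - lorentz (DD xi p (lift p x)) (lift p (axis i 1))" for i
    unfolding linear_axis_expansion[OF ldd, of x]
    by (simp add: matrix_vector_mult_def xi_shape_def lorentz.sum_left lorentz.scaleR_left sum_negf mult.commute)
  then show ?thesis
    unfolding linear_axis_expansion[OF linear_lift[OF p], of z]
    by (simp add: inner_vec_def lorentz.sum_right lorentz.scaleR_right sum_negf mult.commute)
qed

text \<open>Symmetry of second derivatives: with \<open>F = \<phi> \<circ> \<psi>\<close>, the derivative of \<open>\<langle>\<xi>, F\<^sub>b\<rangle> = 0\<close> in the direction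
  \<open>a\<close> reads \<open>- \<langle>D\<^sub>a \<xi>, F\<^sub>b\<rangle> = \<langle>\<xi>, F\<^sub>a\<^sub>b\<rangle>\<close>.\<close>

lemma xi_shape_symmetric:
  assumes p: "p \<in> topspace X"
  shows "(xi_shape p *v x) \<bullet> z = x \<bullet> (xi_shape p *v z)"
proof -
  obtain U \<psi> u where lp: "local_param X \<phi> U \<psi>" and u: "u \<in> U" "\<psi> u = p"
    using chart_inside[OF M openin_topspace p] by metis
  have UX: "\<psi> ` U \<subseteq> topspace X" using local_paramD(7)[OF lp] by blast
  let ?F = "\<phi> \<circ> \<psi>"
  let ?F' = "\<lambda>w u. frechet_derivative ?F (at u) w"
  have "lift p x \<in> range (frechet_derivative ?F (at u))" "lift p z \<in> range (frechet_derivative ?F (at u))"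
    using lift_tangent[OF p] tangent_space_chart[OF lp u(1)] u(2) by auto
  then obtain a b where a: "lift p x = ?F' a u" and b: "lift p z = ?F' b u" by blast
  have Fk: "C_k_on k U ?F" for k by (rule smooth_on_C_k[OF local_paramD(4)[OF lp]])
  have key: "- lorentz (DD xi p (?F' a u)) (?F' b u) = lorentz (xi p) (frechet_derivative (?F' b) (at u) a)" for a b
  proof -
    have "C_k_on (Suc 0) U (?F' b)" using Fk[of "Suc (Suc 0)"] by simp
    note dF = C_k_on_Suc_has_derivative[OF this u(1)]
    note dxi = dir_deriv_smooth_chart[OF smooth_xi[OF order_refl] lp UX u(1)]
    have "((\<lambda>u. lorentz (xi (\<psi> u)) (?F' b u)) has_derivative
       (\<lambda>w. lorentz (xi (\<psi> u)) (frechet_derivative (?F' b) (at u) w) + lorentz (DD xi (\<psi> u) (?F' w u)) (?F' b u))) (at u)"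
      by (rule bounded_bilinear.FDERIV[OF bounded_bilinear_lorentz dxi dF])
    moreover have "((\<lambda>u. lorentz (xi (\<psi> u)) (?F' b u)) has_derivative (\<lambda>w. 0)) (at u)"
    proof (rule has_derivative_transform_within_open[OF has_derivative_const local_paramD(1)[OF lp] u(1)])
      fix y assume y: "y \<in> U"
      have "?F' b y \<in> T (\<psi> y)" using tangent_space_chart[OF lp y] by blast
      then show "0 = lorentz (xi (\<psi> y)) (?F' b y)"
        using xi_normal[OF local_paramD(7)[OF lp y]] by (simp add: normal_space_def)
    qed
    ultimately have "(\<lambda>w. lorentz (xi (\<psi> u)) (frechet_derivative (?F' b) (at u) w) + lorentz (DD xi (\<psi> u) (?F' w u)) (?F' b u)) = (\<lambda>w. 0)"
      by (rule has_derivative_unique)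
    from fun_cong[OF this, of a] show ?thesis by (simp add: u(2))
  qed
  have "frechet_derivative (?F' b) (at u) a = frechet_derivative (?F' a) (at u) b"
    by (rule mixed_derivatives_commute[OF local_paramD(1)[OF lp] Fk u(1)])
  then show ?thesis
    using key[of a b] key[of b a]
    by (simp add: xi_shape_inner[OF p] a b inner_commute[of x])
qed

text \<open>The derivative of \<open>\<langle>\<xi>, e\<^sub>1\<rangle> = 0\<close>, combined with the formula for the derivative of \<open>e\<^sub>1\<close>.\<close>

lemma xi_shape_dirn:
  assumes p: "p \<in> topspace X"
  shows "(xi_shape p *v x) \<bullet> dirn p = - DD al p (lift p x) - (al p)\<^sup>2 * (x \<bullet> dirn p)"
proof -
  have c: "lorentz (xi q) (E1 q) = 0" if "q \<in> topspace X" for q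
    by (simp add: E1_def lorentz_xi_lift[OF that])
  have "lorentz (xi p) (DD E1 p (lift p x)) + lorentz (DD xi p (lift p x)) (E1 p) = 0"
    by (rule DD_lorentz_const[OF p lift_tangent[OF p] smooth_xi[OF order_refl] smooth_E1[OF order_refl] c])
  moreover have "lorentz (xi p) (\<theta> p) = -1"
    using lorentz_cone_xi[OF p] lorentz_commute[of "xi p" "\<theta> p"] by simp
  ultimately show ?thesis
    by (simp add: xi_shape_inner[OF p] DD_E1_lift[OF p] E1_def lorentz.add_right lorentz.scaleR_right lorentz_xi_lift[OF p])
qed

lemma shape_op_cone:
  "p \<in> topspace X \<Longrightarrow> shape_op X \<phi> \<theta> p (lift p x) = - lift p (perp p x)"
  by (simp add: shape_op_def tan_nor_DD_cone(1))

lemma shape_op_xi: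
  assumes p: "p \<in> topspace X"
  shows "shape_op X \<phi> xi p (lift p x) = lift p (xi_shape p *v x)"
proof -
  have "tan_part X \<phi> p (DD xi p (lift p x)) = lift p (- (xi_shape p *v x))"
    by (rule tan_part_eq[OF p]) (simp add: xi_shape_inner[OF p])
  then show ?thesis by (simp add: shape_op_def linear_neg[OF linear_lift[OF p]])
qed

text \<open>For a tangent field \<open>Y\<close> and a normal field \<open>n\<close>, \<open>\<langle>D\<^sub>v Y, n\<rangle> = - \<langle>Y, D\<^sub>v n\<rangle>\<close> depends only on the value of
  \<open>Y\<close> at the point. Taking \<open>\<theta>\<close> and \<open>\<xi>\<close> for \<open>n\<close> determines the normal part of \<open>D\<^sub>v Y\<close>, so the second
  fundamental form is well defined.\<close>

lemma second_ff_eq: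
  assumes p: "p \<in> topspace X"
  shows "second_ff X \<phi> p (lift p x) (lift p z)
     = - (((xi_shape p *v x) \<bullet> z) *\<^sub>R \<theta> p) + (perp p x \<bullet> z) *\<^sub>R xi p"
  unfolding second_ff_def
proof (rule the_equality)
  have *: "nor_part X \<phi> p (DD Y p (lift p x)) = - (((xi_shape p *v x) \<bullet> z) *\<^sub>R \<theta> p) + (perp p x \<bullet> z) *\<^sub>R xi p"
    if W: "openin X W" "p \<in> W" and Y: "sm W Y" "\<forall>q\<in>W. Y q \<in> T q" "Y p = lift p z" for W Y
  proof -
    have WX: "W \<subseteq> topspace X" by (rule openin_subset[OF W(1)])
    interpret tangent_direction X \<phi> W p "lift p x" by unfold_locales (use M W lift_tangent[OF p] in auto)
    have orth: "lorentz (DD Y p (lift p x)) (n p) = - lorentz (lift p z) (DD n p (lift p x))"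
      if n: "sm W n" "\<And>q. q \<in> W \<Longrightarrow> n q \<in> N q" for n
    proof -
      have "lorentz (Y q) (n q) = 0" if "q \<in> W" for q
        using n(2)[OF that] Y(2) that lorentz_commute[of "Y q" "n q"] by (simp add: normal_space_def)
      then have "DD (\<lambda>q. lorentz (Y q) (n q)) p (lift p x) = 0"
        using dd_cong[OF smooth_field_const, of "\<lambda>q. lorentz (Y q) (n q)" 0] dd_const[of 0] by simp
      then show ?thesis using dd_bilinear[OF bounded_bilinear_lorentz Y(1) n(1)] Y(3) by simp
    qed
    have 1: "lorentz (DD Y p (lift p x)) (\<theta> p) = - (perp p x \<bullet> z)"
      using orth[OF smooth_cone_field cone_field_normal] WX lorentz_lift[OF p, of z "perp p x"]
        lorentz_commute[of "lift p z" "\<theta> p"] lorentz_cone_lift[OF p, of z]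
      by (simp add: subset_iff DD_cone_lift[OF p] lorentz.add_right lorentz.scaleR_right inner_commute[of z "perp p x"])
    have 2: "lorentz (DD Y p (lift p x)) (xi p) = (xi_shape p *v x) \<bullet> z"
      using orth[OF smooth_xi[OF WX] xi_normal] WX lorentz_commute[of "lift p z" "DD xi p (lift p x)"]
      by (simp add: subset_iff xi_shape_inner[OF p])
    show ?thesis by (simp add: nor_part_eq[OF p] 1 2)
  qed
  let ?r = "- (((xi_shape p *v x) \<bullet> z) *\<^sub>R \<theta> p) + (perp p x \<bullet> z) *\<^sub>R xi p"
  show "\<exists>W Y. openin X W \<and> p \<in> W \<and> sm W Y \<and> (\<forall>q\<in>W. Y q \<in> T q) \<and> Y p = lift p z \<and>
      ?r = nor_part X \<phi> p (DD Y p (lift p x))"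
  proof (intro exI conjI)
    show "sm (topspace X) (\<lambda>q. lift q z)" by (rule smooth_lift[OF smooth_field_const])
    show "?r = nor_part X \<phi> p (DD (\<lambda>q. lift q z) p (lift p x))"
      by (rule *[symmetric, of "topspace X"]) (auto simp: p lift_tangent smooth_lift[OF smooth_field_const])
  qed (auto simp: p lift_tangent)
  fix r assume "\<exists>W Y. openin X W \<and> p \<in> W \<and> sm W Y \<and> (\<forall>q\<in>W. Y q \<in> T q) \<and> Y p = lift p z \<and>
      r = nor_part X \<phi> p (DD Y p (lift p x))"
  then show "r = ?r" using * by blast
qed

text \<open>The compression to \<open>s\<^sup>\<bottom>\<close> lives on a space that varies with the point. Completing it to an operator on
  the fixed space \<open>\<real>\<^sup>n\<close> by an eigenvalue in the direction \<open>s\<close> does not disturb its spectrum, because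
  that eigenvalue, \<open>1 + \<parallel>S\<parallel>\<^sup>2 > \<parallel>S\<parallel>\<close> for the shape operator \<open>S\<close>, is smooth and exceeds all others.\<close>

definition top_value :: "'p \<Rightarrow> real" where "top_value p = 1 + xi_shape p \<bullet> xi_shape p"

definition compressed_shape :: "'p \<Rightarrow> real ^ 'n ^ 'n" where
  "compressed_shape p = (\<chi> i j. (perp p (xi_shape p *v perp p (axis j 1))
      + (top_value p * (axis j 1 \<bullet> dirn p)) *\<^sub>R dirn p) $ i)"

lemma compressed_shape_mult:
  "compressed_shape p *v x = perp p (xi_shape p *v perp p x) + (top_value p * (x \<bullet> dirn p)) *\<^sub>R dirn p"
proof -
  let ?f = "\<lambda>x. perp p (xi_shape p *v perp p x) + (top_value p * (x \<bullet> dirn p)) *\<^sub>R dirn p"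
  have l: "linear ?f"
    by (simp add: linear_iff linear_add[OF linear_perp] linear_scale[OF linear_perp] matrix_vector_right_distrib
        matrix_vector_mult_scaleR inner_add_left algebra_simps)
  have "compressed_shape p = matrix ?f" by (simp add: compressed_shape_def matrix_def)
  then show ?thesis using matrix_of_linear[OF l] by simp
qed

lemma smooth_perp: "W \<subseteq> topspace X \<Longrightarrow> sm W f \<Longrightarrow> sm W (\<lambda>q. perp q (f q))"
  unfolding perp_def
  by (intro smooth_field_diff smooth_field_bilinear[OF bounded_bilinear_scaleR]
      smooth_field_bilinear[OF bounded_bilinear_inner] smooth_dirn)

lemma smooth_top_value: "W \<subseteq> topspace X \<Longrightarrow> sm W top_value"
  unfolding top_value_def[abs_def]
  by (intro smooth_field_add smooth_field_const smooth_field_bilinear[OF bounded_bilinear_inner] smooth_xi_shape)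

lemma smooth_compressed_shape:
  assumes W: "W \<subseteq> topspace X"
  shows "sm W compressed_shape"
proof (rule smooth_field_matrix)
  fix i j
  have "sm W (\<lambda>q. (perp q (xi_shape q *v perp q (axis j 1))
      + (top_value q * (axis j 1 \<bullet> dirn q)) *\<^sub>R dirn q) $ i)"
    by (intro smooth_field_linear[OF bounded_linear_vec_nth] smooth_field_add smooth_perp[OF W]
        smooth_field_bilinear[OF bounded_bilinear_matrix_vector_mult] smooth_xi_shape[OF W] smooth_field_const
        smooth_field_bilinear[OF bounded_bilinear_scaleR] smooth_field_bilinear[OF bounded_bilinear_mult]
        smooth_top_value[OF W] smooth_field_bilinear[OF bounded_bilinear_inner] smooth_dirn[OF W])
  then show "sm W (\<lambda>q. compressed_shape q $ i $ j)" by (simp add: compressed_shape_def)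
qed

lemma compressed_shape_symmetric:
  "p \<in> topspace X \<Longrightarrow> (compressed_shape p *v x) \<bullet> z = x \<bullet> (compressed_shape p *v z)"
  by (simp add: compressed_shape_mult inner_add_left inner_add_right perp_inner
      xi_shape_symmetric inner_commute[of "dirn p" z])

lemma compressed_shape_dirn: "p \<in> topspace X \<Longrightarrow> compressed_shape p *v dirn p = top_value p *\<^sub>R dirn p"
  by (simp add: compressed_shape_mult perp_dirn dirn_unit linear_0[OF linear_perp])

lemma sorted_frame_exists:
  assumes p: "p \<in> topspace X"
  shows "\<exists>x l. sorted_eigenframe (compressed_shape p) x l \<and> x 1 = dirn p \<and> (\<forall>a\<in>{2..CARD('n)}. l a < l 1)"
proof -
  let ?V = "{y \<in> UNIV. \<forall>z\<in>span {dirn p}. orthogonal z y}"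
  let ?f = "(*v) (compressed_shape p)"
  have V: "y \<in> ?V \<longleftrightarrow> y \<bullet> dirn p = 0" for y
    by (auto simp: span_singleton orthogonal_def inner_commute)
  have "dirn p \<noteq> 0" using dirn_unit[OF p] by auto
  then have "dim (span {dirn p}) = 1" by simp
  then have dimV: "dim ?V = CARD('n) - 1"
    using dim_subspace_orthogonal_to_vectors[of "span {dirn p}" "UNIV :: (real^'n) set"] by simp
  have sub: "subspace ?V"
    by (rule subspaceI) (simp_all only: V inner_add_left inner_scaleR_left, simp_all)
  have inv: "?f ` ?V \<subseteq> ?V"
  proof (rule image_subsetI, unfold V)
    fix y assume "y \<bullet> dirn p = 0"
    then show "(compressed_shape p *v y) \<bullet> dirn p = 0"
      by (simp add: compressed_shape_symmetric[OF p] compressed_shape_dirn[OF p])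
  qed
  obtain x l where on: "orthonormal_on {2..<2 + (CARD('n) - 1)} x"
    and ev: "\<forall>i\<in>{2..<2 + (CARD('n) - 1)}. x i \<in> ?V \<and> ?f (x i) = l i *\<^sub>R x i"
    and srt: "\<forall>i\<in>{2..<2 + (CARD('n) - 1)}. \<forall>j\<in>{2..<2 + (CARD('n) - 1)}. i \<le> j \<longrightarrow> l j \<le> (l i :: real)"
    using sorted_eigenbasis_subspace[OF matrix_vector_mul_linear compressed_shape_symmetric[OF p] sub inv dimV, of 2]
    by blast
  have set: "{2..<2 + (CARD('n) - 1)} = {2..CARD('n)}" using zero_less_card_finite[where 'a='n] by auto
  have I: "i \<in> {1..CARD('n)} \<longleftrightarrow> i = 1 \<or> i \<in> {2..CARD('n)}" for i
    using zero_less_card_finite[where 'a='n] by auto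
  have perp: "x i \<bullet> dirn p = 0" "dirn p \<bullet> x i = 0" if "i \<in> {2..CARD('n)}" for i
    using ev that V unfolding set by (simp_all add: inner_commute)
  have n1: "i \<noteq> 1" if "i \<in> {2..CARD('n)}" for i using that by auto
  have less: "l i < top_value p" if i: "i \<in> {2..CARD('n)}" for i
  proof -
    have xx: "x i \<bullet> x i = 1" using orthonormal_onD[OF on, of i i] i unfolding set by simp
    then have nx: "norm (x i) = 1" by (simp add: norm_eq_sqrt_inner)
    have "l i = (compressed_shape p *v x i) \<bullet> x i" using ev i xx unfolding set by simp
    also have "\<dots> = (xi_shape p *v x i) \<bullet> x i"
      by (simp add: compressed_shape_mult perp[OF i] perp_id perp_inner)
    also have "\<dots> \<le> norm (xi_shape p *v x i) * norm (x i)" by (rule norm_cauchy_schwarz)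
    also have "\<dots> \<le> norm (xi_shape p)" using norm_matrix_vector_mult_le[of "xi_shape p" "x i"] nx by simp
    also have "\<dots> < 1 + (norm (xi_shape p))\<^sup>2"
    proof -
      have "r < 1 + r\<^sup>2" for r :: real
        using zero_le_power2[of "r - 1 / 2"] by (simp add: power2_eq_square algebra_simps)
      then show ?thesis .
    qed
    finally show ?thesis by (simp add: top_value_def power2_norm_eq_inner)
  qed
  have "orthonormal_on {1..CARD('n)} (x(1 := dirn p))"
    unfolding orthonormal_on_def
  proof (intro ballI)
    fix i j assume "i \<in> {1..CARD('n)}" "j \<in> {1..CARD('n)}"
    then consider "i = 1" "j = 1" | "i = 1" "j \<in> {2..CARD('n)}" | "i \<in> {2..CARD('n)}" "j = 1"
      | "i \<in> {2..CARD('n)}" "j \<in> {2..CARD('n)}"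
      unfolding I by blast
    then show "(x(1 := dirn p)) i \<bullet> (x(1 := dirn p)) j = (if i = j then 1 else 0)"
    proof cases
      case 1 then show ?thesis by (simp add: dirn_unit[OF p])
    next
      case 2 then show ?thesis using n1[of j] perp[of j] by simp
    next
      case 3 then show ?thesis using n1[of i] perp[of i] by simp
    next
      case 4 then show ?thesis using n1[of i] n1[of j] orthonormal_onD[OF on[unfolded set] 4] by simp
    qed
  qed
  moreover have "\<forall>i\<in>{1..CARD('n)}. compressed_shape p *v (x(1 := dirn p)) i = (l(1 := top_value p)) i *\<^sub>R (x(1 := dirn p)) i"
    using ev compressed_shape_dirn[OF p] unfolding set Ball_def I by simp
  moreover have "(l(1 := top_value p)) j \<le> (l(1 := top_value p)) i"
    if ij: "i \<in> {1..CARD('n)}" "j \<in> {1..CARD('n)}" "i \<le> j" for i j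
  proof (cases "i = 1")
    case True
    then show ?thesis using less[of j] ij(2) unfolding I by auto
  next
    case False
    then have "i \<in> {2..CARD('n)}" "j \<in> {2..CARD('n)}" using ij by auto
    then show ?thesis using srt ij(3) n1[of i] n1[of j] unfolding set by simp
  qed
  ultimately have "sorted_eigenframe (compressed_shape p) (x(1 := dirn p)) (l(1 := top_value p))"
    unfolding sorted_eigenframe_def eigenframe_def by blast
  then show ?thesis
    using less by (intro exI[of _ "x(1 := dirn p)"] exI[of _ "l(1 := top_value p)"]) simp
qed

section \<open>Frames of eigenvectors are adapted frames\<close>

text \<open>Pointwise form of the theorem: the lift of an eigenbasis of the compressed shape operator that
  starts with \<open>s\<close> satisfies all the conditions at that point.\<close>

lemma adapted_frame:
  assumes p: "p \<in> topspace X" and ef: "eigenframe (compressed_shape p) x l" and x1: "x 1 = dirn p"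
    and e1: "e 1 = E1" and e: "\<And>i. i \<in> {1..CARD('n)} \<Longrightarrow> e i p = lift p (x i)"
    and \<beta>: "\<And>a. a \<in> {2..CARD('n)} \<Longrightarrow> \<beta> a p = l a"
  shows "adapted_at X \<phi> e \<theta> xi (alpha X \<phi>) \<beta> p"
proof -
  note linl = linear_lift[OF p]
  have on: "orthonormal_on {1..CARD('n)} x" using ef by (simp add: eigenframe_def)
  have one: "1 \<in> {1..CARD('n)}" by (simp add: Suc_leI)
  have a1: "a \<in> {1..CARD('n)}" "a \<noteq> 1" if "a \<in> {2..CARD('n)}" for a using that by auto
  have split: "i = 1 \<or> i \<in> {2..CARD('n)}" if "i \<in> {1..CARD('n)}" for i using that by auto
  \<comment> \<open>The facts about \<open>e 1\<close> are used as rewrite rules, so the index must not become \<open>Suc 0\<close>.\<close>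
  note One_nat_def [simp del]
  have e1p: "e 1 p = lift p (dirn p)" using e[OF one] x1 by simp
  have ea: "e a p = lift p (x a)" if "a \<in> {2..CARD('n)}" for a using e[OF a1(1)[OF that]] .
  have xd: "x a \<bullet> dirn p = 0" if "a \<in> {2..CARD('n)}" for a
    using orthonormal_onD[OF on a1(1)[OF that] one] a1(2)[OF that] x1 by simp
  have px: "perp p (x a) = x a" if "a \<in> {2..CARD('n)}" for a by (rule perp_id[OF xd[OF that]])
  have Sx: "(xi_shape p *v x a) \<bullet> x b = (if a = b then l a else 0)"
    if ab: "a \<in> {2..CARD('n)}" "b \<in> {2..CARD('n)}" for a b
  proof -
    have "(compressed_shape p *v x a) \<bullet> x b = (xi_shape p *v x a) \<bullet> x b"
      by (simp add: compressed_shape_mult px[OF ab(1)] px[OF ab(2)] xd[OF ab(1)] perp_inner)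
    moreover have "compressed_shape p *v x a = l a *\<^sub>R x a" using ef a1(1)[OF ab(1)] by (simp add: eigenframe_def)
    ultimately show ?thesis
      using orthonormal_onD[OF on a1(1)[OF ab(1)] a1(1)[OF ab(2)]] by (cases "a = b") simp_all
  qed
  have al: "alpha X \<phi> p = al p" by (rule alpha_eq[OF p])
  have dal: "DD (alpha X \<phi>) p (lift p y) = DD al p (lift p y)" for y
    by (rule tangent_direction.dd_cong[OF tangent_direction_at[OF p lift_tangent[OF p]] smooth_al[OF order_refl] alpha_eq])
  have Sd: "(xi_shape p *v y) \<bullet> dirn p = - DD al p (lift p y) - (al p)\<^sup>2 * (y \<bullet> dirn p)" for y
    by (rule xi_shape_dirn[OF p])
  have dd1: "dirn p \<bullet> dirn p = 1" by (rule dirn_unit[OF p])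
  have levi: "levi_civita X \<phi> E1 p (lift p y) = al p *\<^sub>R lift p (perp p y)" for y
  proof -
    have dd: "DD E1 p (lift p y) = lift p (al p *\<^sub>R perp p y) + (DD al p (lift p y) + (al p)\<^sup>2 * (y \<bullet> dirn p)) *\<^sub>R \<theta> p"
      unfolding DD_E1_lift[OF p] by (simp add: linear_scale[OF linl])
    show ?thesis
      unfolding levi_civita_def dd tan_nor_sum(1)[OF p normal_scale[OF p cone_field_normal[OF p]]]
      by (rule linear_scale[OF linl])
  qed
  have "orthonormal_basis_of (T p) (\<lambda>i. e i p)"
    unfolding orthonormal_basis_of_def
  proof (intro conjI ballI)
    fix i j assume ij: "i \<in> {1..CARD('n)}" "j \<in> {1..CARD('n)}"
    show "lorentz (e i p) (e j p) = (if i = j then 1 else 0)"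
      unfolding e[OF ij(1)] e[OF ij(2)] lorentz_lift[OF p] by (rule orthonormal_onD[OF on ij])
  next
    have "(\<lambda>i. e i p) ` {1..CARD('n)} = lift p ` x ` {1..CARD('n)}"
      unfolding image_image by (rule image_cong[OF refl e])
    moreover have "span (x ` {1..CARD('n)}) = UNIV"
    proof -
      have "y \<in> span (x ` {1..CARD('n)})" for y
        by (subst orthonormal_expansion[OF on, of y]) (intro span_sum span_scale span_base imageI)
      then show ?thesis by blast
    qed
    ultimately show "span ((\<lambda>i. e i p) ` {1..CARD('n)}) = T p"
      using linear_span_image[OF linl, of "x ` {1..CARD('n)}"] tangent_eq_range_lift[OF p] by simp
  qed
  moreover have "d_last = e 1 p - alpha X \<phi> p *\<^sub>R \<theta> p"
    using E1_eq[OF p] by (simp add: e1 al)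
  moreover have "levi_civita X \<phi> (e 1) p (e 1 p) = 0"
    unfolding e1 using levi[of "dirn p"] e1p[unfolded e1]
    by (simp add: perp_dirn[OF p] linear_0[OF linl])
  moreover have "\<forall>a\<in>{2..CARD('n)}. levi_civita X \<phi> (e 1) p (e a p) = alpha X \<phi> p *\<^sub>R e a p"
    unfolding e1 by (simp add: ea levi px al)
  moreover have "has_matrix (shape_op X \<phi> \<theta> p) (\<lambda>i. e i p) (\<lambda>i j. if i = j \<and> i \<noteq> 1 then -1 else 0)"
    unfolding has_matrix_def
  proof
    fix j assume j: "j \<in> {1..CARD('n)}"
    have "(\<Sum>i=1..CARD('n). (if i = j \<and> i \<noteq> 1 then - 1 else 0) *\<^sub>R e i p)
        = (\<Sum>i=1..CARD('n). if i = j then (if j = 1 then 0 else - e j p) else 0)"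
      by (rule sum.cong) auto
    also have "\<dots> = (if j = 1 then 0 else - e j p)" using j by simp
    also have "\<dots> = shape_op X \<phi> \<theta> p (e j p)"
      using split[OF j] by (auto simp: e1p ea shape_op_cone[OF p] px perp_dirn[OF p] linear_0[OF linl])
    finally show "shape_op X \<phi> \<theta> p (e j p) = (\<Sum>i=1..CARD('n). (if i = j \<and> i \<noteq> 1 then - 1 else 0) *\<^sub>R e i p)"
      by simp
  qed
  moreover have "has_matrix (shape_op X \<phi> xi p) (\<lambda>i. e i p)
       (\<lambda>i j. if i = 1 \<and> j = 1 then - DD (alpha X \<phi>) p (e 1 p) - (alpha X \<phi> p)\<^sup>2
              else if i = 1 then - DD (alpha X \<phi>) p (e j p)
              else if j = 1 then - DD (alpha X \<phi>) p (e i p)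
              else if i = j then \<beta> i p
              else 0)" (is "has_matrix _ _ ?A")
    unfolding has_matrix_def
  proof
    fix j assume j: "j \<in> {1..CARD('n)}"
    have entry: "?A i j = (xi_shape p *v x j) \<bullet> x i" if i: "i \<in> {1..CARD('n)}" for i
    proof -
      consider "i = 1" "j = 1" | "i = 1" "j \<in> {2..CARD('n)}" | "i \<in> {2..CARD('n)}" "j = 1"
        | "i \<in> {2..CARD('n)}" "j \<in> {2..CARD('n)}"
        using split[OF i] split[OF j] by blast
      then show ?thesis
      proof cases
        case 1
        then show ?thesis using x1 by (simp add: e1p dal al Sd dd1)
      next
        case 2
        then show ?thesis using a1(2)[OF 2(2)] x1 by (simp add: ea dal Sd xd)
      next
        case 3
        have "(xi_shape p *v dirn p) \<bullet> x i = (xi_shape p *v x i) \<bullet> dirn p"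
          using xi_shape_symmetric[OF p, of "dirn p" "x i"] by (simp add: inner_commute)
        then show ?thesis using 3 a1(2)[OF 3(1)] x1 by (simp add: ea dal Sd xd)
      next
        case 4
        then show ?thesis using a1(2)[OF 4(1)] a1(2)[OF 4(2)] by (simp add: Sx \<beta>)
      qed
    qed
    have "shape_op X \<phi> xi p (e j p) = lift p (xi_shape p *v x j)"
      unfolding e[OF j] by (rule shape_op_xi[OF p])
    also have "\<dots> = lift p (\<Sum>i=1..CARD('n). ((xi_shape p *v x j) \<bullet> x i) *\<^sub>R x i)"
      using orthonormal_expansion[OF on, of "xi_shape p *v x j"] by simp
    also have "\<dots> = (\<Sum>i=1..CARD('n). ((xi_shape p *v x j) \<bullet> x i) *\<^sub>R lift p (x i))"
      by (simp add: linear_sum[OF linl] linear_scale[OF linl])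
    also have "\<dots> = (\<Sum>i=1..CARD('n). ?A i j *\<^sub>R e i p)"
      by (rule sum.cong[OF refl]) (subst entry, assumption, subst e, assumption, rule refl)
    finally show "shape_op X \<phi> xi p (e j p) = (\<Sum>i=1..CARD('n). ?A i j *\<^sub>R e i p)" .
  qed
  moreover have "normal_conn X \<phi> \<theta> p (e 1 p) = alpha X \<phi> p *\<^sub>R \<theta> p"
    by (simp add: normal_conn_def e1p tan_nor_DD_cone(2)[OF p] dd1 al)
  moreover have "normal_conn X \<phi> xi p (e 1 p) = - (alpha X \<phi> p *\<^sub>R xi p)"
    by (simp add: normal_conn_def e1p nor_DD_xi[OF p] dd1 al)
  moreover have "\<forall>v\<in>T p. lorentz v (e 1 p) = 0 \<longrightarrow> normal_conn X \<phi> \<theta> p v = 0 \<and> normal_conn X \<phi> xi p v = 0"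
  proof (intro ballI impI)
    fix v assume v: "v \<in> T p" "lorentz v (e 1 p) = 0"
    obtain y where y: "v = lift p y" using v(1) tangent_eq_range_lift[OF p] by blast
    have "y \<bullet> dirn p = 0" using v(2) by (simp add: y e1p lorentz_lift[OF p])
    then show "normal_conn X \<phi> \<theta> p v = 0 \<and> normal_conn X \<phi> xi p v = 0"
      by (simp add: normal_conn_def y tan_nor_DD_cone(2)[OF p] nor_DD_xi[OF p])
  qed
  moreover have "second_ff X \<phi> p (e 1 p) (e 1 p) = (DD (alpha X \<phi>) p (e 1 p) + (alpha X \<phi> p)\<^sup>2) *\<^sub>R \<theta> p"
    by (simp add: e1p second_ff_eq[OF p] dal al Sd dd1 perp_dirn[OF p] algebra_simps)
  moreover have "\<forall>a\<in>{2..CARD('n)}. second_ff X \<phi> p (e 1 p) (e a p) = DD (alpha X \<phi>) p (e a p) *\<^sub>R \<theta> p"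
  proof
    fix a assume a: "a \<in> {2..CARD('n)}"
    have "(xi_shape p *v dirn p) \<bullet> x a = (xi_shape p *v x a) \<bullet> dirn p"
      using xi_shape_symmetric[OF p, of "dirn p" "x a"] by (simp add: inner_commute)
    then show "second_ff X \<phi> p (e 1 p) (e a p) = DD (alpha X \<phi>) p (e a p) *\<^sub>R \<theta> p"
      by (simp add: e1p ea[OF a] second_ff_eq[OF p] dal Sd xd[OF a] perp_dirn[OF p])
  qed
  moreover have "\<forall>a\<in>{2..CARD('n)}. second_ff X \<phi> p (e a p) (e a p) = - (\<beta> a p *\<^sub>R \<theta> p) + xi p"
    using orthonormal_onD[OF on a1(1) a1(1)] by (simp add: ea second_ff_eq[OF p] Sx \<beta> px)
  moreover have "\<forall>a\<in>{2..CARD('n)}. \<forall>b\<in>{2..CARD('n)}. a \<noteq> b \<longrightarrow> second_ff X \<phi> p (e a p) (e b p) = 0"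
    using orthonormal_onD[OF on a1(1) a1(1)] by (simp add: ea second_ff_eq[OF p] Sx px)
  ultimately show ?thesis
    unfolding adapted_at_def using pseudo_orthonormal_frame[OF p] by blast
qed

text \<open>The strict inequality keeps the eigenvalue of \<open>s\<close> apart from the others, so that all coincidences
  of eigenvalues are coincidences among \<open>\<beta>\<^sub>2, \<dots>, \<beta>\<^sub>n\<close>. For surfaces the unit vector orthogonal to \<open>s\<close> is
  unique up to sign, and a quarter turn of \<open>s\<close> chooses the sign smoothly.\<close>

lemma frame_choice:
  obtains x l where
    "\<And>p. p \<in> topspace X \<Longrightarrow> sorted_eigenframe (compressed_shape p) (x p) (l p)"
    "\<And>p. p \<in> topspace X \<Longrightarrow> x p 1 = dirn p"
    "\<And>p a. p \<in> topspace X \<Longrightarrow> a \<in> {2..CARD('n)} \<Longrightarrow> l p a < l p 1"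
    "CARD('n) = 2 \<Longrightarrow> sm (topspace X) (\<lambda>p. x p 2)"
proof -
  have "\<forall>p. \<exists>x l. p \<in> topspace X \<longrightarrow> sorted_eigenframe (compressed_shape p) x l \<and> x 1 = dirn p \<and> (\<forall>a\<in>{2..CARD('n)}. l a < l 1)"
    using sorted_frame_exists by blast
  then obtain x l where xl: "\<And>p. p \<in> topspace X \<Longrightarrow> sorted_eigenframe (compressed_shape p) (x p) (l p)"
    "\<And>p. p \<in> topspace X \<Longrightarrow> x p 1 = dirn p"
    "\<And>p a. p \<in> topspace X \<Longrightarrow> a \<in> {2..CARD('n)} \<Longrightarrow> l p a < l p 1"
    by metis
  show ?thesis
  proof (cases "CARD('n) = 2")
    case False
    then show ?thesis using that[OF xl] by blast
  next
    case True
    then obtain i j :: 'n where ij: "UNIV = {i, j}" "i \<noteq> j" using card_2_iff by metis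
    define r where "r p = (\<chi> k. if k = i then - dirn p $ j else dirn p $ i)" for p
    have inner2: "(y :: real^'n) \<bullet> z = y $ i * z $ i + y $ j * z $ j" for y z
      using ij(2) by (simp add: inner_vec_def ij(1))
    have rd: "r p \<bullet> dirn p = 0" for p using ij(2) by (simp add: inner2 r_def)
    have rr: "r p \<bullet> r p = 1" if "p \<in> topspace X" for p
      using ij(2) dirn_unit[OF that] by (simp add: inner2 r_def)
    have smr: "sm (topspace X) r"
    proof (rule smooth_field_vec)
      fix k
      have d: "sm (topspace X) (\<lambda>p. dirn p $ m)" for m
        by (rule smooth_field_linear[OF bounded_linear_vec_nth smooth_dirn[OF order_refl]])
      show "sm (topspace X) (\<lambda>p. r p $ k)"
        using d[of i] smooth_field_minus[OF d[of j]] by (cases "k = i") (simp_all add: r_def)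
    qed
    have set: "{1..CARD('n)} = {1, 2}" unfolding True by auto
    let ?x = "\<lambda>p. (x p)(2 := r p)"
    have fr: "sorted_eigenframe (compressed_shape p) (?x p) (l p)" if p: "p \<in> topspace X" for p
    proof -
      have on: "orthonormal_on {1..CARD('n)} (x p)"
        and ev: "compressed_shape p *v x p 2 = l p 2 *\<^sub>R x p 2" "compressed_shape p *v x p 1 = l p 1 *\<^sub>R x p 1"
        using xl(1)[OF p] unfolding sorted_eigenframe_def eigenframe_def set by auto
      have "r p = (r p \<bullet> x p 1) *\<^sub>R x p 1 + (r p \<bullet> x p 2) *\<^sub>R x p 2"
        using orthonormal_expansion[OF on, of "r p"] unfolding set by simp
      then have r2: "r p = (r p \<bullet> x p 2) *\<^sub>R x p 2" using rd[of p] xl(2)[OF p] by simp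
      have "compressed_shape p *v r p = l p 2 *\<^sub>R r p"
        by (subst (1 2) r2) (simp add: matrix_vector_mult_scaleR ev mult.commute)
      moreover have "orthonormal_on {1..CARD('n)} (?x p)"
        using rd[of p] rr[OF p] dirn_unit[OF p] xl(2)[OF p]
        unfolding orthonormal_on_def set by (simp add: inner_commute[of "dirn p" "r p"])
      ultimately show ?thesis
        using xl(1)[OF p] ev unfolding sorted_eigenframe_def eigenframe_def set by simp
    qed
    show ?thesis by (rule that[of ?x l]) (use fr xl smr in \<open>auto\<close>)
  qed
qed

section \<open>Smooth eigenframes\<close>

text \<open>By Weyl's inequality, a sorted eigenvalue is a 1-Lipschitz function of the matrix.\<close>

lemma eigenvalue_chart_continuous:
  assumes fr: "\<And>p. p \<in> topspace X \<Longrightarrow> sorted_eigenframe (compressed_shape p) (x p) (l p)"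
    and i: "i \<in> {1..CARD('n)}" and lp: "local_param X \<phi> U \<psi>"
  shows "continuous_on U (\<lambda>u. l (\<psi> u) i)"
  unfolding continuous_on_iff
proof (intro ballI allI impI)
  fix u and e :: real assume u: "u \<in> U" and e: "e > 0"
  have UX: "\<psi> ` U \<subseteq> topspace X" using local_paramD(7)[OF lp] by blast
  have "continuous_on U (\<lambda>u. compressed_shape (\<psi> u))"
    using smooth_fieldD[OF smooth_compressed_shape[OF UX] lp order_refl, of 0] by simp
  then obtain d where d: "d > 0" "\<And>z. z \<in> U \<Longrightarrow> dist z u < d \<Longrightarrow> dist (compressed_shape (\<psi> z)) (compressed_shape (\<psi> u)) < e"
    unfolding continuous_on_iff using u e by blast
  have "dist (l (\<psi> z) i) (l (\<psi> u) i) < e" if z: "z \<in> U" "dist z u < d" for z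
    using Weyl_inequality[OF fr[OF local_paramD(7)[OF lp z(1)]] fr[OF local_paramD(7)[OF lp u]] i] d(2)[OF z]
    by (simp add: dist_norm)
  then show "\<exists>d>0. \<forall>z\<in>U. dist z u < d \<longrightarrow> dist (l (\<psi> z) i) (l (\<psi> u) i) < e" using d(1) by blast
qed

lemma distinct_eigenvalues_stay_distinct:
  assumes fr: "\<And>p. p \<in> topspace X \<Longrightarrow> sorted_eigenframe (compressed_shape p) (x p) (l p)"
    and p: "p \<in> topspace X"
  obtains W where "openin X W" "p \<in> W"
    "\<And>q a b. q \<in> W \<Longrightarrow> a \<in> {1..CARD('n)} \<Longrightarrow> b \<in> {1..CARD('n)} \<Longrightarrow> l q a = l q b \<Longrightarrow> l p a = l p b"
proof -
  let ?I = "{1..CARD('n)}"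
  let ?K = "{(a, b) \<in> ?I \<times> ?I. l p a \<noteq> l p b}"
  let ?O = "\<lambda>(a, b). {q \<in> topspace X. l q a - l q b \<in> - {0}}"
  have "finite ?K" by (rule finite_subset[of _ "?I \<times> ?I"]) auto
  moreover have "openin X (?O k)" if k: "k \<in> ?K" for k
  proof -
    obtain a b where ab: "k = (a, b)" "a \<in> ?I" "b \<in> ?I" using k by auto
    have "openin X {q \<in> topspace X. l q a - l q b \<in> - {0}}"
    proof (rule openin_chart_continuous_preimage[OF M openin_topspace])
      fix U \<psi> assume lp: "local_param X \<phi> U \<psi>"
      show "continuous_on U (\<lambda>u. l (\<psi> u) a - l (\<psi> u) b)"
        by (rule continuous_on_diff[OF eigenvalue_chart_continuous[OF fr ab(2) lp]
              eigenvalue_chart_continuous[OF fr ab(3) lp]])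
    qed (rule open_Compl[OF closed_singleton])
    then show ?thesis by (simp add: ab(1))
  qed
  ultimately have "openin X ((\<Inter>k\<in>?K. ?O k) \<inter> topspace X)" by (rule openin_INT)
  then show ?thesis by (rule that) (use p in auto)
qed

lemma eigenvalue_smooth:
  assumes fr: "\<And>p. p \<in> topspace X \<Longrightarrow> sorted_eigenframe (compressed_shape p) (x p) (l p)"
    and W: "W \<subseteq> topspace X"
    and R: "\<And>q i j. q \<in> W \<Longrightarrow> i \<in> {1..CARD('n)} \<Longrightarrow> j \<in> {1..CARD('n)} \<Longrightarrow> l q i = l q j \<longleftrightarrow> R i j"
    and i: "i \<in> {1..CARD('n)}"
  shows "sm W (\<lambda>q. l q i)"
proof (rule smooth_fieldI)
  fix U \<psi> k assume lp: "local_param X \<phi> U \<psi>" and UW: "\<psi> ` U \<subseteq> W"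
  show "C_k_on k U (\<lambda>u. l (\<psi> u) i)"
  proof (rule C_k_on_eigenvalue[where A="\<lambda>u. compressed_shape (\<psi> u)" and x="\<lambda>u. x (\<psi> u)" and l="\<lambda>u. l (\<psi> u)" and R=R])
    show "eigenframe (compressed_shape (\<psi> u)) (x (\<psi> u)) (l (\<psi> u))" if "u \<in> U" for u
      using fr[OF local_paramD(7)[OF lp that]] by (simp add: sorted_eigenframe_def)
    show "l (\<psi> u) i = l (\<psi> u) j \<longleftrightarrow> R i j" if "u \<in> U" "i \<in> {1..CARD('n)}" "j \<in> {1..CARD('n)}" for u i j
      by (rule R) (use that UW in auto)
    show "continuous_on U (\<lambda>u. l (\<psi> u) i)" if "i \<in> {1..CARD('n)}" for i
      by (rule eigenvalue_chart_continuous[OF fr that lp])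
  qed (rule local_paramD(1)[OF lp] smooth_fieldD[OF smooth_compressed_shape[OF W] lp UW] i)+
qed

text \<open>Projecting a fixed eigenbasis at \<open>p\<close> to the eigenspaces at nearby points and orthonormalizing
  it there; orthonormalization does not leave an eigenspace, because different eigenspaces are
  orthogonal.\<close>

lemma smooth_eigenframe:
  assumes W: "openin X W" "p \<in> W"
    and ef: "\<And>q. q \<in> W \<Longrightarrow> eigenframe (compressed_shape q) (x q) (l q)"
    and x1: "\<And>q. q \<in> W \<Longrightarrow> x q 1 = dirn q"
    and l: "\<And>i. i \<in> {1..CARD('n)} \<Longrightarrow> sm W (\<lambda>q. l q i)"
    and R: "\<And>q i j. q \<in> W \<Longrightarrow> i \<in> {1..CARD('n)} \<Longrightarrow> j \<in> {1..CARD('n)} \<Longrightarrow> l q i = l q j \<longleftrightarrow> R i j"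
    and m: "1 \<le> m" "m \<le> CARD('n)"
  shows "\<exists>W' z. openin X W' \<and> p \<in> W' \<and> W' \<subseteq> W \<and> z 1 = dirn \<and>
    (\<forall>i\<in>{1..m}. sm W' (z i) \<and> z i p = x p i \<and> (\<forall>q\<in>W'. compressed_shape q *v z i q = l q i *\<^sub>R z i q)) \<and>
    (\<forall>q\<in>W'. orthonormal_on {1..m} (\<lambda>i. z i q))"
  using m
proof (induction m rule: nat_induct_at_least)
  case base
  have WX: "W \<subseteq> topspace X" by (rule openin_subset[OF W(1)])
  have one: "1 \<in> {1..CARD('n)}" by (simp add: Suc_leI)
  have "compressed_shape q *v dirn q = l q 1 *\<^sub>R dirn q" if "q \<in> W" for q
    using ef[OF that] x1[OF that] one unfolding eigenframe_def by metis
  then show ?case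
    using W WX x1[OF W(2)] dirn_unit
    by (intro exI[of _ W] exI[of _ "\<lambda>i. dirn"]) (auto simp: smooth_dirn orthonormal_on_def)
next
  case (Suc m)
  have m: "m < CARD('n)" using Suc.prems by simp
  obtain W1 z where W1: "openin X W1" "p \<in> W1" "W1 \<subseteq> W" and z1: "z 1 = dirn"
    and z: "\<And>i. i \<in> {1..m} \<Longrightarrow> sm W1 (z i)" "\<And>i. i \<in> {1..m} \<Longrightarrow> z i p = x p i"
      "\<And>i q. i \<in> {1..m} \<Longrightarrow> q \<in> W1 \<Longrightarrow> compressed_shape q *v z i q = l q i *\<^sub>R z i q"
    and on: "\<And>q. q \<in> W1 \<Longrightarrow> orthonormal_on {1..m} (\<lambda>i. z i q)"
    using Suc.IH m by (metis less_imp_le)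
  have W1X: "W1 \<subseteq> topspace X" by (rule openin_subset[OF W1(1)])
  let ?c = "Suc m"
  have c: "?c \<in> {1..CARD('n)}" using m by simp
  have iI: "i \<in> {1..CARD('n)}" if "i \<in> {1..m}" for i using that m by auto
  \<comment> \<open>The indices of the other eigenvalues; a repeated eigenvalue gives a repeated, harmless factor of the filter.\<close>
  define js where "js = filter (\<lambda>j. \<not> R ?c j) [1..<CARD('n) + 1]"
  have js: "j \<in> set js \<longleftrightarrow> j \<in> {1..CARD('n)} \<and> \<not> R ?c j" for j
    unfolding js_def set_filter set_upt by auto
  define y where "y q = spectral_filter (compressed_shape q) (l q ?c) (map (l q) js) (x p ?c)" for q
  have ne: "l q ?c \<noteq> l q j" if "q \<in> W" "j \<in> set js" for q j
    using R[OF that(1) c, of j] that(2) js by blast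
  have notin: "l q ?c \<notin> set (map (l q) js)" if "q \<in> W" for q using ne[OF that] by auto
  have rest: "l q j \<in> set (map (l q) js)" if "q \<in> W" "j \<in> {1..CARD('n)}" "l q j \<noteq> l q ?c" for q j
    using R[OF that(1) c that(2)] that js by auto
  have Ay: "compressed_shape q *v y q = l q ?c *\<^sub>R y q" if "q \<in> W" for q
    unfolding y_def by (rule spectral_filter_in_eigenspace[OF ef[OF that] notin[OF that] rest[OF that]])
  have "compressed_shape p *v x p ?c = l p ?c *\<^sub>R x p ?c" using ef[OF W(2)] c by (simp add: eigenframe_def)
  from spectral_filter_eigenvector[OF this notin[OF W(2)]] have yp: "y p = x p ?c" by (simp add: y_def)
  have smy: "sm W1 y"
    unfolding y_def[abs_def]
    by (rule smooth_field_spectral_filter[OF smooth_compressed_shape[OF W1X] smooth_field_mono[OF l[OF c] W1(3)]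
          smooth_field_mono[OF l W1(3)] ne]) (use js W1(3) in auto)
  \<comment> \<open>One step of the Gram-Schmidt process.\<close>
  define w where "w q = y q - (\<Sum>i=1..m. (y q \<bullet> z i q) *\<^sub>R z i q)" for q
  have smw: "sm W1 w"
    unfolding w_def[abs_def]
    by (intro smooth_field_diff smooth_field_sum smooth_field_bilinear[OF bounded_bilinear_scaleR]
        smooth_field_bilinear[OF bounded_bilinear_inner] smy z(1))
  have perp: "y q \<bullet> z i q = 0" if q: "q \<in> W1" and i: "i \<in> {1..m}" and neq: "l q i \<noteq> l q ?c" for q i
  proof -
    have qW: "q \<in> W" using q W1(3) by blast
    have "l q ?c * (y q \<bullet> z i q) = l q i * (y q \<bullet> z i q)"
      using eigenframe_symmetric[OF ef[OF qW], of "y q" "z i q"] Ay[OF qW] z(3)[OF i q] by simp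
    then show ?thesis using neq by simp
  qed
  have Aw: "compressed_shape q *v w q = l q ?c *\<^sub>R w q" if q: "q \<in> W1" for q
  proof -
    have qW: "q \<in> W" using q W1(3) by blast
    have "compressed_shape q *v w q = l q ?c *\<^sub>R y q - (\<Sum>i=1..m. (y q \<bullet> z i q) *\<^sub>R (compressed_shape q *v z i q))"
      by (simp add: w_def matrix_vector_mult_diff_distrib linear_sum[OF matrix_vector_mul_linear]
          matrix_vector_mult_scaleR Ay[OF qW])
    also have "(\<Sum>i=1..m. (y q \<bullet> z i q) *\<^sub>R (compressed_shape q *v z i q)) = (\<Sum>i=1..m. l q ?c *\<^sub>R ((y q \<bullet> z i q) *\<^sub>R z i q))"
    proof (rule sum.cong[OF refl])
      fix i assume i: "i \<in> {1..m}"
      show "(y q \<bullet> z i q) *\<^sub>R (compressed_shape q *v z i q) = l q ?c *\<^sub>R ((y q \<bullet> z i q) *\<^sub>R z i q)"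
        using perp[OF q i] z(3)[OF i q] by (cases "l q i = l q ?c") simp_all
    qed
    finally show ?thesis by (simp add: w_def scaleR_right_diff_distrib scaleR_sum_right)
  qed
  have wz: "w q \<bullet> z j q = 0" if q: "q \<in> W1" and j: "j \<in> {1..m}" for q j
  proof -
    have "(\<Sum>i=1..m. (y q \<bullet> z i q) * (z i q \<bullet> z j q)) = (\<Sum>i=1..m. if i = j then y q \<bullet> z j q else 0)"
      by (rule sum.cong[OF refl]) (use orthonormal_onD[OF on[OF q] _ j] in simp)
    also have "\<dots> = y q \<bullet> z j q" using j by simp
    finally show ?thesis by (simp add: w_def inner_diff_left inner_sum_left)
  qed
  have xon: "orthonormal_on {1..CARD('n)} (x p)" using ef[OF W(2)] by (simp add: eigenframe_def)
  have wp: "w p = x p ?c"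
  proof -
    have "(\<Sum>i=1..m. (y p \<bullet> z i p) *\<^sub>R z i p) = (\<Sum>i=1..m. 0)"
    proof (rule sum.cong[OF refl])
      fix i assume i: "i \<in> {1..m}"
      then have "x p ?c \<bullet> x p i = 0" using orthonormal_onD[OF xon c iI[OF i]] by auto
      then show "(y p \<bullet> z i p) *\<^sub>R z i p = 0" by (simp add: yp z(2)[OF i])
    qed
    then show ?thesis by (simp add: w_def yp)
  qed
  have xx: "x p ?c \<bullet> x p ?c = 1" using orthonormal_onD[OF xon c c] by simp
  define W2 where "W2 = {q \<in> W1. w q \<in> - {0}}"
  have W2: "openin X W2"
    unfolding W2_def by (rule openin_smooth_preimage[OF M W1(1) open_Compl[OF closed_singleton] smw])
  have W21: "W2 \<subseteq> W1" by (auto simp: W2_def)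
  have pW2: "p \<in> W2" using W1(2) wp xx by (auto simp: W2_def)
  define zc where "zc q = inverse (sqrt (w q \<bullet> w q)) *\<^sub>R w q" for q
  have wpos: "w q \<bullet> w q > 0" if "q \<in> W2" for q using that by (simp add: W2_def)
  have smzc: "sm W2 zc"
    unfolding zc_def[abs_def]
    by (intro smooth_field_bilinear[OF bounded_bilinear_scaleR] smooth_field_inverse smooth_field_sqrt
        smooth_field_bilinear[OF bounded_bilinear_inner] smooth_field_mono[OF smw W21])
       (use wpos in force)+
  have zcp: "zc p = x p ?c" by (simp add: zc_def wp xx)
  have zczc: "zc q \<bullet> zc q = 1" if "q \<in> W2" for q
  proof -
    have "inverse (sqrt r) * (inverse (sqrt r) * r) = 1" if "r > 0" for r :: real
      using that real_sqrt_mult_self[of r] by (simp add: field_simps)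
    from this[OF wpos[OF that]] show ?thesis by (simp add: zc_def)
  qed
  have zcz: "zc q \<bullet> z i q = 0" if "q \<in> W2" "i \<in> {1..m}" for q i
    using wz[of q i] that W21 by (auto simp: zc_def)
  have ic: "i \<noteq> ?c" if "i \<in> {1..m}" for i using that by auto
  have split: "i = ?c \<or> i \<in> {1..m}" if "i \<in> {1..?c}" for i using that by auto
  show ?case
  proof (intro exI[of _ W2] exI[of _ "z(?c := zc)"] conjI ballI)
    show "openin X W2" "p \<in> W2" by (rule W2 pW2)+
    show "W2 \<subseteq> W" using W21 W1(3) by blast
    show "(z(?c := zc)) 1 = dirn" using z1 Suc.hyps by simp
  next
    fix i assume i: "i \<in> {1..?c}"
    show "sm W2 ((z(?c := zc)) i)"
      using split[OF i] smzc smooth_field_mono[OF z(1) W21] ic by auto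
    show "(z(?c := zc)) i p = x p i" using split[OF i] zcp z(2) ic by auto
    fix q assume q: "q \<in> W2"
    show "compressed_shape q *v (z(?c := zc)) i q = l q i *\<^sub>R (z(?c := zc)) i q"
    proof (cases "i = ?c")
      case True
      then show ?thesis using Aw[of q] q W21 by (auto simp: zc_def matrix_vector_mult_scaleR)
    next
      case False
      then show ?thesis using z(3)[of i q] split[OF i] q W21 by auto
    qed
  next
    fix q assume q: "q \<in> W2"
    then have q1: "q \<in> W1" using W21 by blast
    show "orthonormal_on {1..?c} (\<lambda>i. (z(?c := zc)) i q)"
      unfolding orthonormal_on_def
    proof (intro ballI)
      fix i j assume "i \<in> {1..?c}" "j \<in> {1..?c}"
      then consider "i = ?c" "j = ?c" | "i = ?c" "j \<in> {1..m}" | "i \<in> {1..m}" "j = ?c"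
        | "i \<in> {1..m}" "j \<in> {1..m}"
        using split by blast
      then show "(z(?c := zc)) i q \<bullet> (z(?c := zc)) j q = (if i = j then 1 else 0)"
      proof cases
        case 1 then show ?thesis by (simp add: zczc[OF q])
      next
        case 2 then show ?thesis using ic[of j] zcz[OF q, of j] by simp
      next
        case 3 then show ?thesis using ic[of i] zcz[OF q, of i] by (simp add: inner_commute)
      next
        case 4 then show ?thesis using ic[of i] ic[of j] orthonormal_onD[OF on[OF q1] 4] by simp
      qed
    qed
  qed
qed

end

section \<open>Existence of adapted frames\<close>

theorem lemma3p2:
  fixes X :: "'p topology" and \<phi> :: "'p \<Rightarrow> 'n::finite mink"
  assumes n: "CARD('n) \<ge> 2"
    and M: "submanifold X \<phi>"
    and nondeg: "non_degenerate X \<phi>"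
    and lies_on: "\<forall>p\<in>topspace X. \<phi> p \<in> LC_times_R"
    and alpha_nonzero: "\<forall>p\<in>topspace X. alpha X \<phi> p \<noteq> 0"
  shows "\<exists>e \<theta> \<xi> \<beta>.
     smooth_field X \<phi> (topspace X) (alpha X \<phi>) \<and>
     smooth_field X \<phi> (topspace X) (e 1) \<and>
     smooth_field X \<phi> (topspace X) \<theta> \<and>
     smooth_field X \<phi> (topspace X) \<xi> \<and>
     (\<forall>p\<in>topspace X. adapted_at X \<phi> e \<theta> \<xi> (alpha X \<phi>) \<beta> p) \<and>
     (CARD('n) = 2 \<longrightarrow> smooth_field X \<phi> (topspace X) (e 2)) \<and>
     (let V = constant_multiplicity_points X CARD('n) \<beta> in
        openin X V \<and> X closure_of V = topspace X \<and>
        (\<forall>a\<in>{2..CARD('n)}. smooth_field X \<phi> V (\<beta> a)) \<and>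
        (\<forall>p\<in>V. \<exists>W e'. openin X W \<and> p \<in> W \<and> W \<subseteq> V \<and> e' 1 = e 1 \<and>
           (\<forall>a\<in>{2..CARD('n)}. smooth_field X \<phi> W (e' a)) \<and>
           (\<forall>q\<in>W. adapted_at X \<phi> e' \<theta> \<xi> (alpha X \<phi>) \<beta> q)))"
proof -
  interpret cone_submanifold X \<phi>
    by unfold_locales (use M nondeg lies_on in auto)
  obtain x l where fr: "\<And>p. p \<in> topspace X \<Longrightarrow> sorted_eigenframe (compressed_shape p) (x p) (l p)"
    and x1: "\<And>p. p \<in> topspace X \<Longrightarrow> x p 1 = dirn p"
    and less: "\<And>p a. p \<in> topspace X \<Longrightarrow> a \<in> {2..CARD('n)} \<Longrightarrow> l p a < l p 1"
    and x2: "CARD('n) = 2 \<Longrightarrow> sm (topspace X) (\<lambda>p. x p 2)"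
    using frame_choice by blast
  have ef: "eigenframe (compressed_shape p) (x p) (l p)" if "p \<in> topspace X" for p
    using fr[OF that] by (simp add: sorted_eigenframe_def)
  define e where "e = (\<lambda>i. if i = 1 then E1 else (\<lambda>p. lift p (x p i)))"
  define \<beta> where "\<beta> = (\<lambda>a p. l p a)"
  define J where "J = {2..CARD('n)}"
  define cnt where "cnt q = card ((\<lambda>a. \<beta> a q) ` J)" for q
  define V where "V = constant_multiplicity_points X CARD('n) \<beta>"
  have J1: "a \<in> {1..CARD('n)}" if "a \<in> J" for a using that by (auto simp: J_def)
  have finJ: "finite J" by (simp add: J_def)
  have split: "i = 1 \<or> i \<in> J" if "i \<in> {1..CARD('n)}" for i using that by (auto simp: J_def)
  have V_eq: "V = {p. \<exists>W. openin X W \<and> p \<in> W \<and> (\<forall>q\<in>W. cnt q = cnt p)}"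
    by (simp add: V_def constant_multiplicity_points_def cnt_def J_def)
  have V_iff: "p \<in> V \<longleftrightarrow> (\<exists>W. openin X W \<and> p \<in> W \<and> (\<forall>q\<in>W. cnt q = cnt p))" for p
    by (subst V_eq) (rule mem_Collect_eq)
  have e1: "e 1 = E1" by (simp add: e_def)
  have adapted: "adapted_at X \<phi> e \<theta> xi (alpha X \<phi>) \<beta> p" if p: "p \<in> topspace X" for p
  proof (rule adapted_frame[where x="x p" and l="l p"])
    show "p \<in> topspace X" by (rule p)
    show "eigenframe (compressed_shape p) (x p) (l p)" by (rule ef[OF p])
    show "x p 1 = dirn p" by (rule x1[OF p])
    show "e 1 = E1" by (rule e1)
    show "e i p = lift p (x p i)" for i using x1[OF p] by (simp add: e_def E1_def)
    show "\<beta> a p = l p a" for a by (simp add: \<beta>_def)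
  qed
  have openV: "openin X V" unfolding V_eq by (rule openin_locally_constant_points)
  have VX: "V \<subseteq> topspace X" by (rule openin_subset[OF openV])
  have lsc: "\<exists>W. openin X W \<and> p \<in> W \<and> (\<forall>q\<in>W. cnt p \<le> cnt q)" if p: "p \<in> topspace X" for p
  proof -
    obtain W where W: "openin X W" "p \<in> W" and dist: "\<And>q a b. q \<in> W \<Longrightarrow> a \<in> {1..CARD('n)} \<Longrightarrow>
        b \<in> {1..CARD('n)} \<Longrightarrow> l q a = l q b \<Longrightarrow> l p a = l p b"
      using distinct_eigenvalues_stay_distinct[OF fr p] by blast
    have "cnt p \<le> cnt q" if q: "q \<in> W" for q
      unfolding cnt_def \<beta>_def by (rule card_image_refine(1)[OF finJ]) (rule dist[OF q J1 J1])
    then show ?thesis using W by blast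
  qed
  have cnt_bound: "cnt q \<le> CARD('n)" for q
    unfolding cnt_def using card_image_le[OF finJ, of "\<lambda>a. \<beta> a q"] by (simp add: J_def)
  have dense: "X closure_of V = topspace X"
    unfolding V_eq by (rule closure_of_locally_constant_points[OF cnt_bound lsc])
  define same_pattern where "same_pattern W p \<longleftrightarrow>
      (\<forall>q\<in>W. \<forall>a\<in>{1..CARD('n)}. \<forall>b\<in>{1..CARD('n)}. l q a = l q b \<longleftrightarrow> l p a = l p b)" for W p
  have same_patternD: "l q a = l q b \<longleftrightarrow> l p a = l p b"
    if "same_pattern W p" "q \<in> W" "a \<in> {1..CARD('n)}" "b \<in> {1..CARD('n)}" for W p q a b
    by (rule bspec[OF bspec[OF bspec[OF same_pattern_def[THEN iffD1, OF that(1)] that(2)] that(3)] that(4)])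
  \<comment> \<open>Distinct eigenvalues stay distinct; as their number does not grow, equal ones stay equal.\<close>
  have pattern: "\<exists>W. openin X W \<and> p \<in> W \<and> W \<subseteq> V \<and> same_pattern W p" if p: "p \<in> V" for p
  proof -
    have pX: "p \<in> topspace X" using p VX by blast
    have "\<exists>W. openin X W \<and> p \<in> W \<and> (\<forall>q\<in>W. cnt q = cnt p)" by (rule V_iff[THEN iffD1, OF p])
    then obtain W1 where W1: "openin X W1 \<and> p \<in> W1 \<and> (\<forall>q\<in>W1. cnt q = cnt p)" by (rule exE)
    obtain W2 where W2: "openin X W2" "p \<in> W2" and dist: "\<And>q a b. q \<in> W2 \<Longrightarrow> a \<in> {1..CARD('n)} \<Longrightarrow>
        b \<in> {1..CARD('n)} \<Longrightarrow> l q a = l q b \<Longrightarrow> l p a = l p b"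
      using distinct_eigenvalues_stay_distinct[OF fr pX] by blast
    have same: "l q a = l q b"
      if q: "q \<in> W1" "q \<in> W2" and ab: "a \<in> {1..CARD('n)}" "b \<in> {1..CARD('n)}" and eq: "l p a = l p b" for q a b
    proof -
      have ref: "l p a = l p b" if "a \<in> J" "b \<in> J" "l q a = l q b" for a b
        by (rule dist[OF q(2) J1[OF that(1)] J1[OF that(2)] that(3)])
      have cnt_q: "card ((\<lambda>a. l p a) ` J) = card ((\<lambda>a. l q a) ` J)"
        using bspec[OF W1[THEN conjunct2, THEN conjunct2] q(1)] by (simp add: cnt_def \<beta>_def)
      consider "a = b" | "a = 1" "b \<in> J" | "a \<in> J" "b = 1" | "a \<in> J" "b \<in> J"
        using split[OF ab(1)] split[OF ab(2)] by blast
      then show ?thesis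
      proof cases
        case 2 then show ?thesis using less[OF pX, of b] eq by (simp add: J_def)
      next
        case 3 then show ?thesis using less[OF pX, of a] eq by (simp add: J_def)
      next
        case 4
        show ?thesis by (rule card_image_refine(2)[OF finJ ref cnt_q 4 eq])
      qed simp
    qed
    have "openin X (W1 \<inter> W2 \<inter> V)" using W1 W2(1) openV by blast
    moreover have "p \<in> W1 \<inter> W2 \<inter> V" using W1 W2(2) p by blast
    moreover have "same_pattern (W1 \<inter> W2 \<inter> V) p"
      unfolding same_pattern_def
    proof (intro ballI iffI)
      fix q a b assume q: "q \<in> W1 \<inter> W2 \<inter> V" and ab: "a \<in> {1..CARD('n)}" "b \<in> {1..CARD('n)}"
      show "l p a = l p b" if "l q a = l q b" by (rule dist[OF _ ab that]) (use q in blast)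
      show "l q a = l q b" if "l p a = l p b" by (rule same[OF _ _ ab that]) (use q in blast)+
    qed
    ultimately show ?thesis by blast
  qed
  have smooth_l: "sm W (\<lambda>q. l q i)"
    if W: "openin X W" and pat: "same_pattern W p" and i: "i \<in> {1..CARD('n)}" for W p i
    by (rule eigenvalue_smooth[OF fr openin_subset[OF W] same_patternD[OF pat] i])
  have smooth_\<beta>: "sm V (\<beta> a)" if a: "a \<in> {2..CARD('n)}" for a
    unfolding \<beta>_def
  proof (rule smooth_field_local)
    fix p assume "p \<in> V"
    then obtain W where W: "openin X W" "p \<in> W" and pat: "same_pattern W p"
      using pattern by blast
    have "a \<in> {1..CARD('n)}" using a by auto
    then show "\<exists>W. openin X W \<and> p \<in> W \<and> sm W (\<lambda>p. l p a)" using smooth_l[OF W(1) pat] W by blast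
  qed
  have frames: "\<exists>W e'. openin X W \<and> p \<in> W \<and> W \<subseteq> V \<and> e' 1 = e 1 \<and>
      (\<forall>a\<in>{2..CARD('n)}. sm W (e' a)) \<and> (\<forall>q\<in>W. adapted_at X \<phi> e' \<theta> xi (alpha X \<phi>) \<beta> q)" if p: "p \<in> V" for p
  proof -
    obtain W where W: "openin X W" "p \<in> W" "W \<subseteq> V" and pat: "same_pattern W p"
      using pattern[OF p] by blast
    have WX: "q \<in> topspace X" if "q \<in> W" for q using that W(3) VX by blast
    have card1: "1 \<le> CARD('n)" using n by simp
    have "\<exists>W' z. openin X W' \<and> p \<in> W' \<and> W' \<subseteq> W \<and> z 1 = dirn \<and>
        (\<forall>i\<in>{1..CARD('n)}. sm W' (z i) \<and> z i p = x p i \<and> (\<forall>q\<in>W'. compressed_shape q *v z i q = l q i *\<^sub>R z i q)) \<and>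
        (\<forall>q\<in>W'. orthonormal_on {1..CARD('n)} (\<lambda>i. z i q))"
      by (rule smooth_eigenframe[OF W(1,2) ef[OF WX] x1[OF WX] smooth_l[OF W(1) pat] same_patternD[OF pat]
          card1 order_refl])
    then obtain W' z where W': "openin X W'" "p \<in> W'" "W' \<subseteq> W" and z1: "z 1 = dirn"
      and z: "\<forall>i\<in>{1..CARD('n)}. sm W' (z i) \<and> z i p = x p i \<and> (\<forall>q\<in>W'. compressed_shape q *v z i q = l q i *\<^sub>R z i q)"
      and on: "\<forall>q\<in>W'. orthonormal_on {1..CARD('n)} (\<lambda>i. z i q)"
      by (elim exE conjE) (rule that)
    define e' where "e' = (\<lambda>i. if i = 1 then E1 else (\<lambda>q. lift q (z i q)))"
    have "sm W' (e' a)" if a: "a \<in> {2..CARD('n)}" for a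
    proof -
      have "e' a = (\<lambda>q. lift q (z a q))" "a \<in> {1..CARD('n)}" using a by (auto simp: e'_def)
      then show ?thesis using smooth_lift[of W' "z a"] z by simp
    qed
    moreover have "adapted_at X \<phi> e' \<theta> xi (alpha X \<phi>) \<beta> q" if q: "q \<in> W'" for q
    proof (rule adapted_frame[where x="\<lambda>i. z i q" and l="l q"])
      show "q \<in> topspace X" using q W'(3) WX by blast
      show "eigenframe (compressed_shape q) (\<lambda>i. z i q) (l q)"
        unfolding eigenframe_def using z on q by blast
      show "z 1 q = dirn q" by (simp only: z1)
      show "e' 1 = E1" by (simp add: e'_def)
      show "e' i q = lift q (z i q)" for i
        by (cases "i = 1") (simp_all add: e'_def E1_def z1[unfolded One_nat_def])
      show "\<beta> a q = l q a" for a by (simp add: \<beta>_def)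
    qed
    moreover have "e' 1 = e 1" by (simp add: e'_def e1[unfolded One_nat_def])
    ultimately show ?thesis using W' W(3) by (intro exI[of _ W'] exI[of _ e']) blast
  qed
  show ?thesis
  proof (rule exI[of _ e], rule exI[of _ \<theta>], rule exI[of _ xi], rule exI[of _ \<beta>], intro conjI)
    show "sm (topspace X) (alpha X \<phi>)"
      by (rule smooth_field_cong[OF smooth_al[OF order_refl]]) (simp add: alpha_eq)
    show "sm (topspace X) (e 1)" unfolding e1 by (rule smooth_E1[OF order_refl])
    show "sm (topspace X) \<theta>" by (rule smooth_cone_field)
    show "sm (topspace X) xi" by (rule smooth_xi[OF order_refl])
    show "\<forall>p\<in>topspace X. adapted_at X \<phi> e \<theta> xi (alpha X \<phi>) \<beta> p" using adapted by blast
    show "CARD('n) = 2 \<longrightarrow> sm (topspace X) (e 2)" using x2 by (simp add: e_def smooth_lift)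
    show "let V = constant_multiplicity_points X CARD('n) \<beta> in
        openin X V \<and> X closure_of V = topspace X \<and>
        (\<forall>a\<in>{2..CARD('n)}. sm V (\<beta> a)) \<and>
        (\<forall>p\<in>V. \<exists>W e'. openin X W \<and> p \<in> W \<and> W \<subseteq> V \<and> e' 1 = e 1 \<and>
           (\<forall>a\<in>{2..CARD('n)}. sm W (e' a)) \<and>
           (\<forall>q\<in>W. adapted_at X \<phi> e' \<theta> xi (alpha X \<phi>) \<beta> q))"
      unfolding Let_def V_def[symmetric] by (intro conjI ballI openV dense smooth_\<beta> frames)
  qed
qed

end
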